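(* Let $X$ be a compact geodesic space. Then the homotopy critical spectrum of $X$ is precisely $\frac23$ of the covering spectrum of $X$; that is, $\varepsilon>0$ belongs to the homotopy critical spectrum of $X$ if and only if $\frac{3\varepsilon}{2}$ belongs to the covering spectrum of $X$.
   Context: A geodesic space is a metric space in which any two points are joined by a path whose length equals their distance. Fix a base point $*\in X$. Homotopy critical spectrum. For $\varepsilon>0$, an $\varepsilon$-chain is a finite sequence $\{x_0,\dots,x_n\}$ with $d(x_i,x_{i+1})<\varepsilon$ for all $i$; it is an $\varepsilon$-loop based at $*$ if $x_0=x_n=*$. An $\varepsilon$-homotopy is a finite sequence of $\varepsilon$-chains, each obtained from its predecessor by adding or removing a single point, endpoints always fixed. An $\varepsilon$-loop is $\varepsilon$-null if it is $\varepsilon$-homotopic to the trivial chain $\{*\}$. A number $\varepsilon>0$ is a homotopy critical value of $X$ if there is an $\varepsilon$-loop based at $*$ that is not $\varepsilon$-null but is $\delta$-null for all $\delta>\varepsilon$. The homotopy critical spectrum is the set of homotopy critical values. Covering spectrum. For $\delta>0$ let $S_\delta\subset\pi_1(X,* )$ be the subgroup generated by the classes of all loops $c*L*\overline c$, where $c$ is a path starting at $*$, $\overline c$ its reversal, and $L$ is a loop at the endpoint of $c$ lying entirely in some open ball of radius $\delta$. The $\delta$-cover $\pi^\delta:\widetilde X^\delta\to X$ is the (connected) covering map characterized by: a loop at $*$ lifts to a loop in $\widetilde X^\delta$ (at the base point) if and only if its class lies in $S_\delta$. The covering spectrum of $X$ is the set of all $\delta>0$ such that $\widetilde X^\delta\neq\widetilde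 X^{\delta'}$ (i.e. they are not equivalent as covers of $X$) for all $\delta'>\delta$. *)

theory Defs
  imports "HOL-Analysis.Analysis" "HOL-Algebra.Generated_Groups"
begin

section \<open>Geodesic spaces\<close>

text \<open>A space is a set \<open>X\<close> in a type of class \<open>metric_space\<close>, with the restricted metric.
  In \<open>path_length\<close>, \<open>t 0 \<le> \<dots> \<le> t n\<close> runs over the subdivisions of the unit interval; the value is
  infinite for non-rectifiable paths.\<close>

definition path_length :: "(real \<Rightarrow> 'a::metric_space) \<Rightarrow> ennreal" where
  "path_length g =
     (SUP (n, t) \<in> {(n::nat, t::nat \<Rightarrow> real). t 0 = 0 \<and> t n = 1 \<and> (\<forall>i<n. t i \<le> t (Suc i))}.
        \<Sum>i<n. ennreal (dist (g (t i)) (g (t (Suc i)))))"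

definition geodesic_space :: "'a::metric_space set \<Rightarrow> bool" where
  "geodesic_space X \<longleftrightarrow>
     (\<forall>x\<in>X. \<forall>y\<in>X. \<exists>g. path g \<and> path_image g \<subseteq> X \<and> pathstart g = x \<and> pathfinish g = y \<and>
        path_length g = ennreal (dist x y))"

section \<open>The homotopy critical spectrum\<close>

definition eps_chain :: "'a::metric_space set \<Rightarrow> real \<Rightarrow> 'a list \<Rightarrow> bool" where
  "eps_chain X \<epsilon> xs \<longleftrightarrow> xs \<noteq> [] \<and> set xs \<subseteq> X \<and> successively (\<lambda>x y. dist x y < \<epsilon>) xs"

definition eps_loop :: "'a::metric_space set \<Rightarrow> 'a \<Rightarrow> real \<Rightarrow> 'a list \<Rightarrow> bool" where
  "eps_loop X b \<epsilon> xs \<longleftrightarrow> eps_chain X \<epsilon> xs \<and> hd xs = b \<and> last xs = b"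

text \<open>The first and last point are preserved as points of the space. The new entry itself may be in
  first or last position; this is what relates \<open>[b]\<close> to \<open>[b, b]\<close>.\<close>

definition eps_step :: "'a::metric_space set \<Rightarrow> real \<Rightarrow> 'a list \<Rightarrow> 'a list \<Rightarrow> bool" where
  "eps_step X \<epsilon> xs ys \<longleftrightarrow>
     eps_chain X \<epsilon> xs \<and> eps_chain X \<epsilon> ys \<and> hd xs = hd ys \<and> last xs = last ys \<and>
     (\<exists>us z vs. xs = us @ vs \<and> ys = us @ z # vs \<or> xs = us @ z # vs \<and> ys = us @ vs)"

definition eps_homotopic :: "'a::metric_space set \<Rightarrow> real \<Rightarrow> 'a list \<Rightarrow> 'a list \<Rightarrow> bool" where
  "eps_homotopic X \<epsilon> xs ys \<longleftrightarrow> eps_chain X \<epsilon> xs \<and> (eps_step X \<epsilon>)\<^sup>*\<^sup>* xs ys"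

definition eps_null :: "'a::metric_space set \<Rightarrow> 'a \<Rightarrow> real \<Rightarrow> 'a list \<Rightarrow> bool" where
  "eps_null X b \<epsilon> xs \<longleftrightarrow> eps_homotopic X \<epsilon> xs [b]"

definition homotopy_critical_spectrum :: "'a::metric_space set \<Rightarrow> 'a \<Rightarrow> real set" where
  "homotopy_critical_spectrum X b =
     {\<epsilon>. \<epsilon> > 0 \<and> (\<exists>xs. eps_loop X b \<epsilon> xs \<and> \<not> eps_null X b \<epsilon> xs \<and> (\<forall>\<delta>>\<epsilon>. eps_null X b \<delta> xs))}"

section \<open>The fundamental group and its subgroups \<open>S\<^sub>\<delta>\<close>\<close>

definition loops_at :: "'a::topological_space set \<Rightarrow> 'a \<Rightarrow> (real \<Rightarrow> 'a) set" where
  "loops_at X b = {g. path g \<and> path_image g \<subseteq> X \<and> pathstart g = b \<and> pathfinish g = b}"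

definition path_class :: "'a::topological_space set \<Rightarrow> (real \<Rightarrow> 'a) \<Rightarrow> (real \<Rightarrow> 'a) set" where
  "path_class X p = {q. homotopic_paths X p q}"

text \<open>On classes of loops, the product is a union of copies of the single class of \<open>p +++ q\<close>.\<close>

definition fundamental_group ::
    "'a::topological_space set \<Rightarrow> 'a \<Rightarrow> (real \<Rightarrow> 'a) set monoid" where
  "fundamental_group X b =
     \<lparr>carrier = path_class X ` loops_at X b,
      monoid.mult = (\<lambda>P Q. \<Union>p\<in>P. \<Union>q\<in>Q. path_class X (p +++ q)),
      one = path_class X (\<lambda>_. b)\<rparr>"

definition delta_subgroup :: "'a::metric_space set \<Rightarrow> 'a \<Rightarrow> real \<Rightarrow> (real \<Rightarrow> 'a) set set" where
  "delta_subgroup X b \<delta> =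
     generate (fundamental_group X b)
       {path_class X (c +++ L +++ reversepath c) | c L.
          path c \<and> path_image c \<subseteq> X \<and> pathstart c = b \<and>
          L \<in> loops_at X (pathfinish c) \<and> (\<exists>x\<in>X. path_image L \<subseteq> ball x \<delta>)}"

section \<open>\<open>\<delta>\<close>-covers and the covering spectrum\<close>

text \<open>\<open>covering_map\<close> is the library's \<open>covering_space\<close> for a total space given as a \<open>'c topology\<close>
  rather than as a subset of a type of class \<open>topological_space\<close>.\<close>

definition covering_map :: "'c topology \<Rightarrow> 'a topology \<Rightarrow> ('c \<Rightarrow> 'a) \<Rightarrow> bool" where
  "covering_map C X p \<longleftrightarrow>
     continuous_map C X p \<and> p ` topspace C = topspace X \<and>
     (\<forall>x\<in>topspace X. \<exists>T. x \<in> T \<and> openin X T \<and>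
        (\<exists>V. \<Union>V = {c \<in> topspace C. p c \<in> T} \<and>
             (\<forall>U\<in>V. openin C U) \<and> pairwise disjnt V \<and>
             (\<forall>U\<in>V. homeomorphic_map (subtopology C U) (subtopology X T) p)))"

definition is_delta_cover ::
    "'a::metric_space set \<Rightarrow> 'a \<Rightarrow> real \<Rightarrow> 'c topology \<Rightarrow> ('c \<Rightarrow> 'a) \<Rightarrow> 'c \<Rightarrow> bool" where
  "is_delta_cover X b \<delta> C p e \<longleftrightarrow>
     covering_map C (top_of_set X) p \<and> connected_space C \<and> e \<in> topspace C \<and> p e = b \<and>
     (\<forall>g\<in>loops_at X b.
        (\<exists>h. pathin C h \<and> h 0 = e \<and> h 1 = e \<and> (\<forall>t\<in>{0..1}. p (h t) = g t)) \<longleftrightarrow>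
        path_class X g \<in> delta_subgroup X b \<delta>)"

text \<open>The \<open>\<delta>\<close>-cover of a geodesic space is unique up to equivalence of pointed covers, so the choice
  below is immaterial. The carrier type \<open>(real \<Rightarrow> 'a) set\<close> is no restriction: a point of a connected
  cover is determined by the set of those paths in \<open>X\<close> from \<open>b\<close> whose lift from the base point
  ends there, so every connected cover has a copy on this type.\<close>

definition delta_cover ::
    "'a::metric_space set \<Rightarrow> 'a \<Rightarrow> real \<Rightarrow>
       (real \<Rightarrow> 'a) set topology \<times> ((real \<Rightarrow> 'a) set \<Rightarrow> 'a) \<times> (real \<Rightarrow> 'a) set" where
  "delta_cover X b \<delta> = (SOME (C, p, e). is_delta_cover X b \<delta> C p e)"

definition equivalent_covers ::
    "'c topology \<Rightarrow> ('c \<Rightarrow> 'a) \<Rightarrow> 'd topology \<Rightarrow> ('d \<Rightarrow> 'a) \<Rightarrow> bool" where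
  "equivalent_covers C p D q \<longleftrightarrow>
     (\<exists>h. homeomorphic_map C D h \<and> (\<forall>x\<in>topspace C. q (h x) = p x))"

definition covering_spectrum :: "'a::metric_space set \<Rightarrow> 'a \<Rightarrow> real set" where
  "covering_spectrum X b =
     {\<delta>. \<delta> > 0 \<and> (\<forall>\<delta>'>\<delta>. case delta_cover X b \<delta> of (C, p, _) \<Rightarrow>
        case delta_cover X b \<delta>' of (D, q, _) \<Rightarrow> \<not> equivalent_covers C p D q)}"

end

theory Submission
  imports Defs
begin

text \<open>On the \<open>\<delta>\<close>-cover, jumps along geodesics shorter than \<open>2 * \<delta> / 3\<close> are trivial around triangles, because a geodesic triangle of perimeter
  less than \<open>2 * \<delta>\<close> lies in a ball of radius \<open>\<delta>\<close>; hence an \<open>\<epsilon>\<close>-null loop of chains, filled in by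
  geodesics, represents an element of \<open>S\<^sub>\<delta>\<close> for \<open>\<delta> = 3 * \<epsilon> / 2\<close>. Conversely, jumps on the space of
  \<open>\<epsilon>\<close>-homotopy classes of chains define a continuation along paths under which loops in balls of radius
  \<open>3 * \<epsilon> / 2\<close> are trivial. So \<open>S\<^sub>\<delta>\<close> consists exactly of the loops whose discretizations are \<open>\<epsilon>\<close>-null.
  What remains is to find one \<open>\<epsilon>\<close>-loop that is not \<open>\<epsilon>\<close>-null but \<open>\<delta>\<close>-null for all \<open>\<delta> > \<epsilon>\<close>, given such a
  loop for each \<open>\<delta>\<close> separately: each of these yields a nontrivial triangle with sides less than \<open>\<delta>\<close>, and as
  \<open>\<delta>\<close> tends to \<open>\<epsilon>\<close> the triangles, subdivided at their midpoints, converge along a subsequence to a hexagon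
  with the required properties.\<close>

section \<open>Geodesics\<close>

text \<open>The factor 3/2 arises from both sides. In a triangle with sides less than \<epsilon> the
  two ways along the boundary from a vertex to a point of the opposite side add up to less than
  3\<epsilon>, so one of them is shorter than 3\<epsilon>/2. Conversely, a point at distance less
  than 3\<epsilon>/2 from a centre reaches it by a step below \<epsilon>/2 and a step below
  \<epsilon>, which leaves room for moving the intermediate point. In the limit the obstacle is
  strictness: sides less than \<delta> for all \<delta> > \<epsilon> become sides at most
  \<epsilon>, so the limiting triangle need not be an \<epsilon>-chain. The hexagon has sides at
  most \<epsilon>/2 and is one; for \<delta> > \<epsilon> dropping its midpoints is allowed and
  leaves a triangle with sides less than \<delta>, which is null. A nontrivial triangle at scale
  \<delta> exists because otherwise jumps through midpoints would satisfy the triangle law for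
  \<delta>, and every \<delta>-null \<epsilon>-loop would be \<epsilon>-null.\<close>

definition geo_path :: "'a::metric_space set \<Rightarrow> 'a \<Rightarrow> 'a \<Rightarrow> real \<Rightarrow> 'a" where
  "geo_path X x y = (SOME g. path g \<and> path_image g \<subseteq> X \<and> pathstart g = x \<and> pathfinish g = y \<and>
     path_length g = ennreal (dist x y))"

text \<open>The subdivision \<open>0 \<le> t \<le> 1\<close> is one of those in the supremum. For a
  geodesic this forces equality in the triangle inequality at each of its points, the only metric
  information about geodesics that is used later.\<close>

lemma dist_sum_le_path_length:
  assumes "t \<in> {0..1}"
  shows "ennreal (dist (g 0) (g t) + dist (g t) (g 1)) \<le> path_length g"
proof -
  define s :: "nat \<Rightarrow> real" where "s = (\<lambda>i. if i = 0 then 0 else if i = 1 then t else 1)"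
  have "(\<Sum>i<2. ennreal (dist (g (s i)) (g (s (Suc i))))) \<le> path_length g"
    unfolding path_length_def
    by (rule SUP_upper2[where i = "(2, s)"]) (use assms in \<open>auto simp: s_def less_2_cases_iff\<close>)
  then show ?thesis
    by (simp add: s_def numeral_2_eq_2)
qed

lemma geo_path:
  assumes "geodesic_space X" "x \<in> X" "y \<in> X"
  shows "path (geo_path X x y)" "path_image (geo_path X x y) \<subseteq> X"
    "pathstart (geo_path X x y) = x" "pathfinish (geo_path X x y) = y"
    "\<And>t. t \<in> {0..1} \<Longrightarrow> geo_path X x y t \<in> X"
    "\<And>t. t \<in> {0..1} \<Longrightarrow> dist x (geo_path X x y t) + dist (geo_path X x y t) y = dist x y"
proof -
  have ex: "\<exists>g. path g \<and> path_image g \<subseteq> X \<and> pathstart g = x \<and> pathfinish g = y \<and>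
     path_length g = ennreal (dist x y)"
    using assms unfolding geodesic_space_def by blast
  note g = someI_ex[OF ex, folded geo_path_def]
  show "path (geo_path X x y)" "path_image (geo_path X x y) \<subseteq> X"
    "pathstart (geo_path X x y) = x" "pathfinish (geo_path X x y) = y"
    using g by auto
  fix t :: real assume t: "t \<in> {0..1}"
  show "geo_path X x y t \<in> X" using g t by (auto simp: path_image_def)
  have "ennreal (dist x (geo_path X x y t) + dist (geo_path X x y t) y) \<le> ennreal (dist x y)"
    using dist_sum_le_path_length[OF t, of "geo_path X x y"] g
    by (simp only: pathstart_def pathfinish_def)
  then have "dist x (geo_path X x y t) + dist (geo_path X x y t) y \<le> dist x y"
    by (simp only: ennreal_le_iff[OF zero_le_dist])
  then show "dist x (geo_path X x y t) + dist (geo_path X x y t) y = dist x y"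
    using dist_triangle[of x y "geo_path X x y t"] by linarith
qed

text \<open>A geodesic is not assumed to be parametrized by arc length, so the point is found by the
  intermediate value theorem for the distance from \<open>x\<close>.\<close>

lemma geodesic_point:
  assumes "geodesic_space X" "x \<in> X" "y \<in> X" "0 \<le> r" "r \<le> dist x y"
  obtains z where "z \<in> X" "dist x z = r" "dist z y = dist x y - r"
proof -
  note g = geo_path[OF assms(1-3)]
  have "continuous_on {0..1} (\<lambda>t. dist x (geo_path X x y t))"
    using g(1) by (intro continuous_intros) (simp add: path_def)
  then have "\<exists>t\<ge>0. t \<le> 1 \<and> dist x (geo_path X x y t) = r"
    using IVT'[of "\<lambda>t. dist x (geo_path X x y t)" 0 r 1] assms g(3,4)
    by (auto simp: pathstart_def pathfinish_def)
  then obtain t where "0 \<le> t" "t \<le> 1" "dist x (geo_path X x y t) = r" by auto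
  then show thesis using that[of "geo_path X x y t"] g(5,6)[of t] by auto
qed

section \<open>Spaces with continuation along short jumps\<close>

text \<open>Points \<open>c\<close> over \<open>p c\<close> can be moved along any jump of length less than \<open>\<epsilon>\<close>, and moving is trivial
  around triangles with sides less than \<open>\<epsilon>\<close>. Both the \<open>\<epsilon>\<close>-homotopy classes of \<open>\<epsilon>\<close>-chains and the
  points of the \<open>\<delta>\<close>-cover with \<open>\<delta> = 3 * \<epsilon> / 2\<close> are of this kind.\<close>

locale jump_space =
  fixes X :: "'a::metric_space set" and \<epsilon> :: real
    and A :: "'c set" and p :: "'c \<Rightarrow> 'a" and act :: "'c \<Rightarrow> 'a \<Rightarrow> 'c"
  assumes eps_pos: "\<epsilon> > 0"
    and p_in: "c \<in> A \<Longrightarrow> p c \<in> X"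
    and act_in: "\<lbrakk>c \<in> A; y \<in> X; dist (p c) y < \<epsilon>\<rbrakk> \<Longrightarrow> act c y \<in> A"
    and p_act: "\<lbrakk>c \<in> A; y \<in> X; dist (p c) y < \<epsilon>\<rbrakk> \<Longrightarrow> p (act c y) = y"
    and act_self: "c \<in> A \<Longrightarrow> act c (p c) = c"
    and act_act: "\<lbrakk>c \<in> A; y \<in> X; z \<in> X; dist (p c) y < \<epsilon>; dist y z < \<epsilon>; dist (p c) z < \<epsilon>\<rbrakk>
        \<Longrightarrow> act (act c y) z = act c z"
begin

lemma act_back:
  assumes "c \<in> A" "y \<in> X" "dist (p c) y < \<epsilon>"
  shows "act (act c y) (p c) = c"
  using assms act_act[of c y "p c"] p_in act_self eps_pos by (simp add: dist_commute)

text \<open>Two triangles share the side from \<open>p c\<close> to \<open>y\<close>, and both sides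
  of the equation are the direct jump along it.\<close>

lemma act_shift:
  assumes "c \<in> A" "x \<in> X" "y \<in> X" "y' \<in> X"
    and "dist (p c) x < \<epsilon>" "dist (p c) y < \<epsilon>" "dist (p c) y' < \<epsilon>" "dist x y < \<epsilon>" "dist y' y < \<epsilon>"
  shows "act (act c y') y = act (act c x) y"
  by (simp only: act_act[OF assms(1,4,3,7,9,6)] act_act[OF assms(1,2,3,5,8,6)])

subsection \<open>Moving along chains\<close>

lemma run_chain:
  assumes "c \<in> A" "set xs \<subseteq> X" "successively (\<lambda>x y. dist x y < \<epsilon>) (p c # xs)"
  shows "foldl act c xs \<in> A" "p (foldl act c xs) = last (p c # xs)"
proof -
  have "foldl act c xs \<in> A \<and> p (foldl act c xs) = last (p c # xs)"
    using assms
  proof (induction xs arbitrary: c)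
    case (Cons x xs)
    then show ?case
      using Cons.IH[of "act c x"] by (auto simp: act_in p_act)
  qed simp
  then show "foldl act c xs \<in> A" "p (foldl act c xs) = last (p c # xs)" by auto
qed

text \<open>A point inserted between two entries adds one triangle, which \<open>act_act\<close>
  removes. In first or last position only a repetition of the end point can be inserted, because end
  points are fixed, and \<open>act_self\<close> removes it.\<close>

lemma run_eps_step_aux:
  assumes c: "c \<in> A" and ch: "eps_chain X \<epsilon> (us @ vs)" "eps_chain X \<epsilon> (us @ z # vs)"
    and hd: "hd (us @ vs) = p c" "hd (us @ z # vs) = p c"
    and la: "last (us @ vs) = last (us @ z # vs)"
  shows "foldl act c (us @ z # vs) = foldl act c (us @ vs)"
proof (cases us)
  case Nil
  then show ?thesis using hd c by (simp add: act_self)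
next
  case (Cons u us')
  have u: "u = p c" using hd Cons by simp
  have "successively (\<lambda>x y. dist x y < \<epsilon>) (us @ z # vs)" "set (us @ z # vs) \<subseteq> X"
    using ch(2) by (auto simp: eps_chain_def)
  then have su: "successively (\<lambda>x y. dist x y < \<epsilon>) us" and "dist (last us) z < \<epsilon>"
    and sz: "successively (\<lambda>x y. dist x y < \<epsilon>) (z # vs)"
    and sX: "set us \<subseteq> X" "z \<in> X" "set vs \<subseteq> X"
    using Cons by (auto simp only: successively_append_iff set_append) auto
  have "foldl act c us = foldl act c us'"
    using Cons u c by (simp add: act_self)
  moreover have "successively (\<lambda>x y. dist x y < \<epsilon>) (p c # us')" "set us' \<subseteq> X"
    using su Cons u sX by auto
  ultimately have d: "foldl act c us \<in> A" "p (foldl act c us) = last us"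
    using run_chain[OF c, of us'] Cons u by auto
  show ?thesis
  proof (cases vs)
    case Nil
    then have "z = last us" using la Cons by simp
    then show ?thesis using Nil d act_self[of "foldl act c us"] by simp
  next
    case (Cons v vs')
    have "dist (last us) v < \<epsilon>"
      using ch(1) Cons \<open>us = u # us'\<close> by (auto simp only: eps_chain_def successively_append_iff) auto
    then have "act (act (foldl act c us) z) v = act (foldl act c us) v"
      using d sX sz Cons \<open>dist (last us) z < \<epsilon>\<close> by (intro act_act) auto
    then show ?thesis using Cons by simp
  qed
qed

lemma run_eps_step:
  assumes "eps_step X \<epsilon> xs ys" "c \<in> A" "hd xs = p c"
  shows "foldl act c xs = foldl act c ys"
  using assms run_eps_step_aux[of c] unfolding eps_step_def by metis

lemma run_eps_homotopic:
  assumes "eps_homotopic X \<epsilon> xs ys" "c \<in> A" "hd xs = p c"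
  shows "foldl act c xs = foldl act c ys"
proof -
  have "(eps_step X \<epsilon>)\<^sup>*\<^sup>* xs ys" using assms by (simp add: eps_homotopic_def)
  then have "foldl act c xs = foldl act c ys \<and> hd ys = p c"
  proof induction
    case (step y z)
    then show ?case
      using run_eps_step[OF step(2) assms(2)] by (auto simp: eps_step_def)
  qed (use assms in auto)
  then show ?thesis by simp
qed

text \<open>The reversed chain begins with the current end point, a trivial jump; then each jump is
  undone by \<open>act_back\<close>.\<close>

lemma run_back:
  assumes "c \<in> A" "set xs \<subseteq> X" "successively (\<lambda>x y. dist x y < \<epsilon>) (p c # xs)"
  shows "foldl act (foldl act c xs) (rev (p c # xs)) = c"
  using assms
proof (induction xs arbitrary: c)
  case (Cons x xs)
  then have "dist (p c) x < \<epsilon>" by simp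
  then have "foldl act (foldl act (act c x) xs) (rev (p (act c x) # xs)) = act c x"
    using Cons.prems by (intro Cons.IH) (auto simp: act_in p_act)
  then have "foldl act (foldl act c (x # xs)) (rev (x # xs)) = act c x"
    using Cons.prems by (simp add: p_act)
  then have "foldl act (foldl act c (x # xs)) (rev (p c # x # xs)) = act (act c x) (p c)"
    by simp
  also have "\<dots> = c" using Cons.prems by (intro act_back) auto
  finally show ?case .
qed (auto simp: act_self)

subsection \<open>Lifting paths\<close>

text \<open>Continuity of the lift is expressed by jumps: near \<open>t\<close> its values come from
  \<open>h t\<close> by a single jump. So the monodromy can be developed before \<open>A\<close> has
  a topology; for \<open>jump_topology\<close> these are exactly the continuous lifts of a path, by
  \<open>pathin_lift\<close> and \<open>lift_pathin\<close>.\<close>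

definition lift_on :: "real set \<Rightarrow> (real \<Rightarrow> 'a) \<Rightarrow> (real \<Rightarrow> 'c) \<Rightarrow> bool" where
  "lift_on I g h \<longleftrightarrow>
     (\<forall>t\<in>I. h t \<in> A \<and> p (h t) = g t \<and>
        (\<exists>\<eta>>0. \<forall>s\<in>I. \<bar>s - t\<bar> < \<eta> \<longrightarrow> dist (g t) (g s) < \<epsilon> \<and> h s = act (h t) (g s)))"

lemma lift_onD:
  assumes "lift_on I g h" "t \<in> I"
  shows "h t \<in> A" "p (h t) = g t" "g t \<in> X"
proof -
  have *: "h t \<in> A \<and> p (h t) = g t" using assms unfolding lift_on_def by blast
  then show "h t \<in> A" "p (h t) = g t" "g t \<in> X" using p_in[of "h t"] by auto
qed

lemma lift_onE:
  assumes "lift_on I g h" "t \<in> I"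
  obtains \<eta> where "\<eta> > 0"
    "\<And>s. s \<in> I \<Longrightarrow> \<bar>s - t\<bar> < \<eta> \<Longrightarrow> dist (g t) (g s) < \<epsilon> \<and> h s = act (h t) (g s)"
  using assms unfolding lift_on_def by blast

lemma lift_on_reparam:
  assumes h: "lift_on I g h" and \<phi>: "continuous_on J \<phi>" "\<phi> ` J \<subseteq> I"
  shows "lift_on J (g \<circ> \<phi>) (h \<circ> \<phi>)"
  unfolding lift_on_def
proof (intro ballI conjI)
  fix t assume t: "t \<in> J"
  then have I: "\<phi> t \<in> I" using \<phi> by auto
  show "(h \<circ> \<phi>) t \<in> A" "p ((h \<circ> \<phi>) t) = (g \<circ> \<phi>) t"
    using lift_onD[OF h I] by auto
  obtain \<eta> where \<eta>: "\<eta> > 0"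
    "\<And>s. s \<in> I \<Longrightarrow> \<bar>s - \<phi> t\<bar> < \<eta> \<Longrightarrow> dist (g (\<phi> t)) (g s) < \<epsilon> \<and> h s = act (h (\<phi> t)) (g s)"
    using lift_onE[OF h I] by blast
  obtain d where d: "d > 0" "\<And>s. s \<in> J \<Longrightarrow> dist s t < d \<Longrightarrow> dist (\<phi> s) (\<phi> t) < \<eta>"
    using \<phi>(1) t \<eta>(1) unfolding continuous_on_iff by metis
  have "dist ((g \<circ> \<phi>) t) ((g \<circ> \<phi>) s) < \<epsilon> \<and> (h \<circ> \<phi>) s = act ((h \<circ> \<phi>) t) ((g \<circ> \<phi>) s)"
    if "s \<in> J" "\<bar>s - t\<bar> < d" for s
    using \<eta>(2)[of "\<phi> s"] d(2)[of s] that \<phi> by (auto simp: dist_real_def)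
  then show "\<exists>\<eta>>0. \<forall>s\<in>J. \<bar>s - t\<bar> < \<eta> \<longrightarrow>
      dist ((g \<circ> \<phi>) t) ((g \<circ> \<phi>) s) < \<epsilon> \<and> (h \<circ> \<phi>) s = act ((h \<circ> \<phi>) t) ((g \<circ> \<phi>) s)"
    using d(1) by blast
qed

lemma lift_on_glue:
  fixes a b c :: real
  assumes h: "lift_on {a..b} g h" and k: "lift_on {b..c} g k" and eq: "h b = k b"
    and le: "a \<le> b" "b \<le> c"
  shows "lift_on {a..c} g (\<lambda>t. if t \<le> b then h t else k t)"
  unfolding lift_on_def
proof (intro ballI conjI)
  let ?f = "\<lambda>t. if t \<le> b then h t else k t"
  fix t assume t: "t \<in> {a..c}"
  show "?f t \<in> A" "p (?f t) = g t"
    using t lift_onD[OF h, of t] lift_onD[OF k, of t] by auto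
  consider "t < b" | "t = b" | "t > b" by linarith
  then show "\<exists>\<eta>>0. \<forall>s\<in>{a..c}. \<bar>s - t\<bar> < \<eta> \<longrightarrow> dist (g t) (g s) < \<epsilon> \<and> ?f s = act (?f t) (g s)"
  proof cases
    case 1
    obtain \<eta> where \<eta>: "\<eta> > 0"
      "\<And>s. s \<in> {a..b} \<Longrightarrow> \<bar>s - t\<bar> < \<eta> \<Longrightarrow> dist (g t) (g s) < \<epsilon> \<and> h s = act (h t) (g s)"
      using lift_onE[OF h, of t] 1 t by auto
    have "dist (g t) (g s) < \<epsilon> \<and> ?f s = act (?f t) (g s)"
      if "s \<in> {a..c}" "\<bar>s - t\<bar> < min \<eta> (b - t)" for s
      using \<eta>(2)[of s] that 1 by auto
    then show ?thesis
      using \<eta>(1) 1 by (intro exI[of _ "min \<eta> (b - t)"]) simp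
  next
    case 2
    obtain \<eta> where \<eta>: "\<eta> > 0"
      "\<And>s. s \<in> {a..b} \<Longrightarrow> \<bar>s - t\<bar> < \<eta> \<Longrightarrow> dist (g t) (g s) < \<epsilon> \<and> h s = act (h t) (g s)"
      using lift_onE[OF h, of t] 2 t by auto
    obtain \<theta> where \<theta>: "\<theta> > 0"
      "\<And>s. s \<in> {b..c} \<Longrightarrow> \<bar>s - t\<bar> < \<theta> \<Longrightarrow> dist (g t) (g s) < \<epsilon> \<and> k s = act (k t) (g s)"
      using lift_onE[OF k, of t] 2 t by auto
    have "dist (g t) (g s) < \<epsilon> \<and> ?f s = act (?f t) (g s)"
      if "s \<in> {a..c}" "\<bar>s - t\<bar> < min \<eta> \<theta>" for s
      using \<eta>(2)[of s] \<theta>(2)[of s] that 2 eq by (cases "s \<le> b") auto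
    then show ?thesis
      using \<eta>(1) \<theta>(1) by (intro exI[of _ "min \<eta> \<theta>"]) simp
  next
    case 3
    obtain \<eta> where \<eta>: "\<eta> > 0"
      "\<And>s. s \<in> {b..c} \<Longrightarrow> \<bar>s - t\<bar> < \<eta> \<Longrightarrow> dist (g t) (g s) < \<epsilon> \<and> k s = act (k t) (g s)"
      using lift_onE[OF k, of t] 3 t by auto
    have "dist (g t) (g s) < \<epsilon> \<and> ?f s = act (?f t) (g s)"
      if "s \<in> {a..c}" "\<bar>s - t\<bar> < min \<eta> (t - b)" for s
      using \<eta>(2)[of s] that 3 by auto
    then show ?thesis
      using \<eta>(1) 3 by (intro exI[of _ "min \<eta> (t - b)"]) simp
  qed
qed

text \<open>Near \<open>x\<close> both lifts come from their values at \<open>x\<close> by the same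
  jump, and this jump can be undone. Hence agreement at nearby times is equivalent to agreement at
  \<open>x\<close>, and \<open>Bolzano\<close> turns this local equivalence into a global
  one.\<close>

lemma lift_on_unique:
  assumes h: "lift_on {0..1} g h" and k: "lift_on {0..1} g k" and eq: "h 0 = k 0"
    and t: "t \<in> {0..1}"
  shows "h t = k t"
proof -
  have le: "0 \<le> t" using t by simp
  have "0 \<le> (0::real) \<longrightarrow> t \<le> 1 \<longrightarrow> (h 0 = k 0 \<longleftrightarrow> h t = k t)"
    using le
  proof (induction rule: Bolzano[where P = "\<lambda>a b. 0 \<le> a \<longrightarrow> b \<le> 1 \<longrightarrow> (h a = k a \<longleftrightarrow> h b = k b)"])
    case (local x)
    then have x: "x \<in> {0..1}" using t by auto
    obtain \<eta> where \<eta>: "\<eta> > 0"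
      "\<And>s. s \<in> {0..1} \<Longrightarrow> \<bar>s - x\<bar> < \<eta> \<Longrightarrow> dist (g x) (g s) < \<epsilon> \<and> h s = act (h x) (g s)"
      using lift_onE[OF h x] by blast
    obtain \<theta> where \<theta>: "\<theta> > 0"
      "\<And>s. s \<in> {0..1} \<Longrightarrow> \<bar>s - x\<bar> < \<theta> \<Longrightarrow> dist (g x) (g s) < \<epsilon> \<and> k s = act (k x) (g s)"
      using lift_onE[OF k x] by blast
    have eqv: "h s = k s \<longleftrightarrow> h x = k x" if "s \<in> {0..1}" "\<bar>s - x\<bar> < min \<eta> \<theta>" for s
    proof -
      have "h s = act (h x) (g s)" "k s = act (k x) (g s)" "dist (g x) (g s) < \<epsilon>"
        using \<eta>(2) \<theta>(2) that by auto
      moreover have "act (act (h x) (g s)) (g x) = h x" "act (act (k x) (g s)) (g x) = k x"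
        using act_back[of "h x" "g s"] act_back[of "k x" "g s"] lift_onD[OF h x] lift_onD[OF k x]
          lift_onD[OF h that(1)] \<open>dist (g x) (g s) < \<epsilon>\<close> by auto
      ultimately show ?thesis by metis
    qed
    show ?case
    proof (intro exI conjI allI impI)
      show "min \<eta> \<theta> > 0" using \<eta>(1) \<theta>(1) by simp
      fix a b :: real assume "a \<le> x \<and> x \<le> b \<and> b - a < min \<eta> \<theta>" "0 \<le> a" "b \<le> 1"
      then show "h a = k a \<longleftrightarrow> h b = k b"
        using eqv[of a] eqv[of b] by auto
    qed
  qed auto
  then show ?thesis using eq t by auto
qed

text \<open>All points of the path are within one jump of \<open>c\<close>, so jumping directly from
  \<open>c\<close> gives a lift; the local condition is the triangle law for \<open>p c\<close>,
  \<open>g t\<close>, \<open>g s\<close>.\<close>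

lemma lift_on_small_path:
  assumes g: "continuous_on I g" "g ` I \<subseteq> X" and c: "c \<in> A" and d: "\<And>t. t \<in> I \<Longrightarrow> dist (p c) (g t) < \<epsilon>"
  shows "lift_on I g (\<lambda>t. act c (g t))"
  unfolding lift_on_def
proof (intro ballI conjI)
  fix t assume t: "t \<in> I"
  have X: "g s \<in> X" if "s \<in> I" for s using that g by auto
  show "act c (g t) \<in> A" "p (act c (g t)) = g t"
    using X d t c by (auto simp: act_in p_act)
  obtain \<eta> where \<eta>: "\<eta> > 0" "\<And>s. s \<in> I \<Longrightarrow> dist s t < \<eta> \<Longrightarrow> dist (g s) (g t) < \<epsilon>"
    using g(1) t eps_pos unfolding continuous_on_iff by metis
  show "\<exists>\<eta>>0. \<forall>s\<in>I. \<bar>s - t\<bar> < \<eta> \<longrightarrow>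
      dist (g t) (g s) < \<epsilon> \<and> act c (g s) = act (act c (g t)) (g s)"
  proof (intro exI conjI ballI impI)
    fix s assume s: "s \<in> I" "\<bar>s - t\<bar> < \<eta>"
    show 1: "dist (g t) (g s) < \<epsilon>" using \<eta>(2)[of s] s by (simp add: dist_real_def dist_commute)
    show "act c (g s) = act (act c (g t)) (g s)"
      by (rule act_act[symmetric]) (use 1 s t X d c in auto)
  qed (rule \<eta>(1))
qed

lemma lift_on_exists:
  assumes g: "path g" "path_image g \<subseteq> X" and c: "c \<in> A" "p c = pathstart g"
  obtains h where "lift_on {0..1} g h" "h 0 = c"
proof -
  have cont: "continuous_on {0..1} g" using g by (simp add: path_def)
  have X: "g t \<in> X" if "t \<in> {0..1}" for t using that g by (auto simp: path_image_def)
  have le: "(0::real) \<le> 1" by simp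
  have "0 \<le> (0::real) \<longrightarrow> (1::real) \<le> 1 \<longrightarrow>
     (\<forall>c\<in>A. p c = g 0 \<longrightarrow> (\<exists>h. lift_on {0..1} g h \<and> h 0 = c))"
    using le
  proof (induction rule: Bolzano[where P = "\<lambda>a b. 0 \<le> a \<longrightarrow> b \<le> 1 \<longrightarrow>
     (\<forall>c\<in>A. p c = g a \<longrightarrow> (\<exists>h. lift_on {a..b} g h \<and> h a = c))"])
    case (trans a b d)
    show ?case
    proof (intro impI ballI)
      fix c assume *: "0 \<le> a" "d \<le> 1" "c \<in> A" "p c = g a"
      then obtain h where h: "lift_on {a..b} g h" "h a = c" using trans by force
      have "h b \<in> A" "p (h b) = g b" using lift_onD[OF h(1), of b] trans by auto
      then obtain k where k: "lift_on {b..d} g k" "k b = h b" using trans * by force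
      show "\<exists>h. lift_on {a..d} g h \<and> h a = c"
        using lift_on_glue[OF h(1) k(1)] k(2) trans(3,4) h(2) by force
    qed
  next
    case (local x)
    then have x: "x \<in> {0..1}" by simp
    \<comment> \<open>Half of \<epsilon>, because the jumps start at the left end \<open>g a\<close>
      of the interval and not at \<open>g x\<close>.\<close>
    obtain \<eta> where \<eta>: "\<eta> > 0" "\<And>s. s \<in> {0..1} \<Longrightarrow> dist s x < \<eta> \<Longrightarrow> dist (g s) (g x) < \<epsilon>/2"
      using cont x eps_pos unfolding continuous_on_iff by (metis half_gt_zero)
    have "\<exists>h. lift_on {a..b} g h \<and> h a = c"
      if *: "a \<le> x" "x \<le> b" "b - a < \<eta>" "0 \<le> a" "b \<le> 1" "c \<in> A" "p c = g a" for a b c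
    proof (intro exI conjI)
      show "lift_on {a..b} g (\<lambda>t. act c (g t))"
      proof (rule lift_on_small_path)
        show "continuous_on {a..b} g" using cont by (rule continuous_on_subset) (use * in auto)
        show "g ` {a..b} \<subseteq> X" using X * by auto
        fix t assume "t \<in> {a..b}"
        then have "dist (g t) (g x) < \<epsilon>/2" "dist (g a) (g x) < \<epsilon>/2"
          using * \<eta>(2)[of t] \<eta>(2)[of a] by (auto simp: dist_real_def abs_less_iff)
        then show "dist (p c) (g t) < \<epsilon>"
          using dist_triangle_half_l[of "g a" "g x" \<epsilon> "g t"] *(7) by simp
      qed fact
      show "act c (g a) = c" using act_self[OF *(6)] *(7) by simp
    qed
    then show ?case using \<eta>(1) by blast
  qed
  then show thesis using c that by (auto simp: pathstart_def)
qed

section \<open>Monodromy along paths and its invariance under homotopies\<close>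

definition transports :: "(real \<Rightarrow> 'a) \<Rightarrow> 'c \<Rightarrow> 'c \<Rightarrow> bool" where
  "transports g c c' \<longleftrightarrow> (\<exists>h. lift_on {0..1} g h \<and> h 0 = c \<and> h 1 = c')"

lemma transports_in:
  assumes "transports g c c'"
  shows "c \<in> A" "c' \<in> A" "p c = pathstart g" "p c' = pathfinish g"
proof -
  obtain h where h: "lift_on {0..1} g h" "h 0 = c" "h 1 = c'"
    using assms by (auto simp: transports_def)
  show "c \<in> A" "c' \<in> A" "p c = pathstart g" "p c' = pathfinish g"
    using lift_onD[OF h(1), of 0] lift_onD[OF h(1), of 1] h(2,3)
    by (auto simp: pathstart_def pathfinish_def)
qed

lemma transports_ex:
  assumes "path g" "path_image g \<subseteq> X" "c \<in> A" "p c = pathstart g"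
  obtains c' where "transports g c c'"
  using lift_on_exists[OF assms] unfolding transports_def by metis

lemma transports_unique: "transports g c c' \<Longrightarrow> transports g c c'' \<Longrightarrow> c' = c''"
  unfolding transports_def using lift_on_unique[of g _ _ 1] by force

lemma transports_small_path:
  assumes "path g" "path_image g \<subseteq> X" "c \<in> A" "p c = pathstart g"
    and "\<And>t. t \<in> {0..1} \<Longrightarrow> dist (p c) (g t) < \<epsilon>"
  shows "transports g c (act c (pathfinish g))"
proof -
  have "lift_on {0..1} g (\<lambda>t. act c (g t))"
    using assms by (intro lift_on_small_path) (auto simp: path_def path_image_def)
  moreover have "act c (g 0) = c" using assms act_self by (metis pathstart_def)
  ultimately show ?thesis unfolding transports_def pathfinish_def by blast
qed

lemma transports_reversepath:
  assumes "transports g c c'"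
  shows "transports (reversepath g) c' c"
proof -
  obtain h where h: "lift_on {0..1} g h" "h 0 = c" "h 1 = c'"
    using assms by (auto simp: transports_def)
  have "lift_on {0..1} (g \<circ> (\<lambda>t. 1 - t)) (h \<circ> (\<lambda>t. 1 - t))"
    by (rule lift_on_reparam[OF h(1)]) (auto intro!: continuous_intros)
  then show ?thesis
    unfolding transports_def reversepath_def comp_def using h
    by (intro exI[of _ "\<lambda>t. h (1 - t)"]) auto
qed

lemma lift_on_cong:
  assumes "lift_on I g h" "\<And>t. t \<in> I \<Longrightarrow> g t = g' t"
  shows "lift_on I g' h"
  using assms unfolding lift_on_def by metis

lemma transports_joinD:
  assumes "transports (g1 +++ g2) c c'" "pathfinish g1 = pathstart g2"
  obtains d where "transports g1 c d" "transports g2 d c'"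
proof -
  obtain h where h: "lift_on {0..1} (g1 +++ g2) h" "h 0 = c" "h 1 = c'"
    using assms by (auto simp: transports_def)
  have "lift_on {0..1} ((g1 +++ g2) \<circ> (\<lambda>t. t/2)) (h \<circ> (\<lambda>t. t/2))"
    by (rule lift_on_reparam[OF h(1)]) (auto intro!: continuous_intros)
  then have "lift_on {0..1} g1 (h \<circ> (\<lambda>t. t/2))"
    by (rule lift_on_cong) (auto simp: joinpaths_def)
  then have 1: "transports g1 c (h (1/2))"
    using h by (auto simp: transports_def comp_def intro!: exI[of _ "\<lambda>t. h (t/2)"])
  have "lift_on {0..1} ((g1 +++ g2) \<circ> (\<lambda>t. (t+1)/2)) (h \<circ> (\<lambda>t. (t+1)/2))"
    by (rule lift_on_reparam[OF h(1)]) (auto intro!: continuous_intros)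
  then have "lift_on {0..1} g2 (h \<circ> (\<lambda>t. (t+1)/2))"
    by (rule lift_on_cong)
      (use assms(2) in \<open>auto simp: joinpaths_def pathstart_def pathfinish_def field_simps\<close>)
  then have 2: "transports g2 (h (1/2)) c'"
    using h by (auto simp: transports_def comp_def intro!: exI[of _ "\<lambda>t. h ((t+1)/2)"])
  show thesis using that 1 2 by blast
qed

text \<open>The join has some transport, \<open>transports_joinD\<close> splits it, and uniqueness
  on each half identifies the pieces with the given ones.\<close>

lemma transports_join:
  assumes "transports g1 c d" "transports g2 d c'"
    and "path g1" "path_image g1 \<subseteq> X" "path g2" "path_image g2 \<subseteq> X" "pathfinish g1 = pathstart g2"
  shows "transports (g1 +++ g2) c c'"
proof -
  have "path_image (g1 +++ g2) \<subseteq> X" using assms by (simp add: path_image_join)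
  then obtain e where e: "transports (g1 +++ g2) c e"
    using transports_ex[of "g1 +++ g2" c] assms(3,5,7) transports_in[OF assms(1)]
    by (metis path_join_imp pathstart_join)
  then show ?thesis
    using transports_joinD[OF e assms(7)] transports_unique assms(1,2) by metis
qed

text \<open>The lift of \<open>g'\<close> is obtained from that of \<open>g\<close> by the jump from
  \<open>g t\<close> to \<open>g' t\<close>. For nearby times \<open>t\<close> and \<open>s\<close>
  the jumps via \<open>g s\<close> and via \<open>g' t\<close> both equal the direct jump from
  \<open>h t\<close> to \<open>g' s\<close>; the bound \<epsilon>/2 makes this diagonal shorter than
  \<epsilon>.\<close>

lemma transports_close:
  assumes tr: "transports g c c'" and g': "path g'" "path_image g' \<subseteq> X"
    and close: "\<And>t. t \<in> {0..1} \<Longrightarrow> dist (g t) (g' t) < \<epsilon> / 2"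
    and ends: "pathstart g' = pathstart g" "pathfinish g' = pathfinish g"
  shows "transports g' c c'"
proof -
  obtain h where h: "lift_on {0..1} g h" "h 0 = c" "h 1 = c'"
    using tr by (auto simp: transports_def)
  have X: "g' t \<in> X" if "t \<in> {0..1}" for t using that g' by (auto simp: path_image_def)
  have close': "dist (g t) (g' t) < \<epsilon>" if "t \<in> {0..1}" for t
    using close[OF that] eps_pos by simp
  have "lift_on {0..1} g' (\<lambda>t. act (h t) (g' t))"
    unfolding lift_on_def
  proof (intro ballI conjI)
    fix t :: real assume t: "t \<in> {0..1}"
    note ht = lift_onD[OF h(1) t]
    show "act (h t) (g' t) \<in> A" "p (act (h t) (g' t)) = g' t"
      using act_in p_act ht X[OF t] close'[OF t] by auto
    obtain \<eta> where \<eta>: "\<eta> > 0"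
      "\<And>s. s \<in> {0..1} \<Longrightarrow> \<bar>s - t\<bar> < \<eta> \<Longrightarrow> dist (g t) (g s) < \<epsilon> \<and> h s = act (h t) (g s)"
      using lift_onE[OF h(1) t] by blast
    obtain \<theta> where \<theta>: "\<theta> > 0" "\<And>s. s \<in> {0..1} \<Longrightarrow> dist s t < \<theta> \<Longrightarrow> dist (g' s) (g' t) < \<epsilon>/2"
      using g'(1) t eps_pos unfolding path_def continuous_on_iff by (metis half_gt_zero)
    have "dist (g' t) (g' s) < \<epsilon> \<and> act (h s) (g' s) = act (act (h t) (g' t)) (g' s)"
      if s: "s \<in> {0..1}" "\<bar>s - t\<bar> < min \<eta> \<theta>" for s
    proof -
      have 1: "dist (g t) (g s) < \<epsilon>" "h s = act (h t) (g s)" using \<eta>(2) s by auto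
      have 2: "dist (g' t) (g' s) < \<epsilon>/2" using \<theta>(2)[of s] s by (auto simp: dist_real_def dist_commute)
      then have 3: "dist (g t) (g' s) < \<epsilon>"
        using close[OF t] dist_triangle_half_r[of "g' t" "g t" \<epsilon> "g' s"] by (simp add: dist_commute)
      have "act (act (h t) (g s)) (g' s) = act (h t) (g' s)"
        using ht 1 3 close'[OF s(1)] X[OF s(1)] lift_onD[OF h(1) s(1)] by (intro act_act) auto
      moreover have "act (act (h t) (g' t)) (g' s) = act (h t) (g' s)"
        using ht 2 3 close'[OF t] X s(1) t eps_pos by (intro act_act) auto
      ultimately show ?thesis using 1 2 eps_pos by auto
    qed
    then show "\<exists>\<eta>>0. \<forall>s\<in>{0..1}. \<bar>s - t\<bar> < \<eta> \<longrightarrow>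
       dist (g' t) (g' s) < \<epsilon> \<and> act (h s) (g' s) = act (act (h t) (g' t)) (g' s)"
      using \<eta>(1) \<theta>(1) by (intro exI[of _ "min \<eta> \<theta>"]) auto
  qed
  moreover have "act (h 0) (g' 0) = c" "act (h 1) (g' 1) = c'"
    using ends h act_self[of "h 0"] act_self[of "h 1"] lift_onD[OF h(1), of 0] lift_onD[OF h(1), of 1]
    by (auto simp: pathstart_def pathfinish_def)
  ultimately show ?thesis unfolding transports_def by blast
qed

text \<open>By uniform continuity neighbouring stages of the homotopy are \<epsilon>/2-close, and
  \<open>transports_close\<close> carries the transport from each stage to the next.\<close>

lemma transports_homotopic_paths:
  assumes hom: "homotopic_paths X g g'" and tr: "transports g c c'"
  shows "transports g' c c'"
proof -
  obtain H :: "real \<times> real \<Rightarrow> 'a" where H: "continuous_on ({0..1} \<times> {0..1}) H" "H \<in> ({0..1} \<times> {0..1}) \<rightarrow> X"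
    "\<forall>x \<in> {0..1}. H(0,x) = g x" "\<forall>x \<in> {0..1}. H(1,x) = g' x"
    "\<forall>t \<in> {0..1}. pathstart(H \<circ> Pair t) = pathstart g \<and> pathfinish(H \<circ> Pair t) = pathfinish g"
    using hom unfolding homotopic_paths by blast
  have uc: "uniformly_continuous_on ({0..1} \<times> {0..1}) H"
    using H(1) by (intro compact_uniformly_continuous compact_Times) auto
  obtain d where d: "d > 0" "\<And>u v. u \<in> {0..1} \<times> {0..1} \<Longrightarrow> v \<in> {0..1} \<times> {0..1} \<Longrightarrow>
     dist v u < d \<Longrightarrow> dist (H v) (H u) < \<epsilon>/2"
    using uc eps_pos unfolding uniformly_continuous_on_def by (metis half_gt_zero)
  have pa: "path (H \<circ> Pair u)" "path_image (H \<circ> Pair u) \<subseteq> X" if "u \<in> {0..1}" for u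
  proof -
    show "path (H \<circ> Pair u)" unfolding path_def
      by (intro continuous_on_compose continuous_intros continuous_on_subset[OF H(1)]) (use that in auto)
    show "path_image (H \<circ> Pair u) \<subseteq> X" unfolding path_image_def using H(2) that by auto
  qed
  have cl: "transports (H \<circ> Pair v) c c'"
    if "transports (H \<circ> Pair u) c c'" "u \<in> {0..1}" "v \<in> {0..1}" "\<bar>u - v\<bar> < d" for u v
    using that(1)
  proof (rule transports_close)
    show "dist ((H \<circ> Pair u) t) ((H \<circ> Pair v) t) < \<epsilon> / 2" if "t \<in> {0..1}" for t
      using d(2)[of "(v,t)" "(u,t)"] that \<open>u \<in> {0..1}\<close> \<open>v \<in> {0..1}\<close> \<open>\<bar>u - v\<bar> < d\<close>
      by (simp add: dist_Pair_Pair dist_real_def)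
  qed (use that pa H(5) in auto)
  have le: "(0::real) \<le> 1" by simp
  have "0 \<le> (0::real) \<longrightarrow> (1::real) \<le> 1 \<longrightarrow>
     transports (H \<circ> Pair 0) c c' \<longrightarrow> transports (H \<circ> Pair 1) c c'"
    using le
  proof (induction rule: Bolzano[where P = "\<lambda>a b. 0 \<le> a \<longrightarrow> b \<le> 1 \<longrightarrow>
     transports (H \<circ> Pair a) c c' \<longrightarrow> transports (H \<circ> Pair b) c c'"])
    case (local x)
    show ?case using d(1) cl by (intro exI[of _ d]) auto
  qed auto
  moreover have "transports (H \<circ> Pair 0) c c'"
    using tr H(3) unfolding transports_def by (force intro: lift_on_cong)
  ultimately have "transports (H \<circ> Pair 1) c c'" by simp
  then show ?thesis using H(4) unfolding transports_def by (force intro: lift_on_cong)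
qed

text \<open>For a loop \<open>L\<close> in a ball around \<open>x\<close> of radius \<open>3 * \<epsilon> / 2\<close>, let \<open>m (L t)\<close> divide a geodesic
  from \<open>L t\<close> to \<open>x\<close> in the ratio 1:2. Then the point over \<open>x\<close> reached from the lift of \<open>L\<close> at \<open>t\<close> via
  \<open>m (L t)\<close> is locally constant in \<open>t\<close>.\<close>

lemma transports_loop_in_ball:
  assumes geo: "geodesic_space X" and x: "x \<in> X"
    and L: "path L" "path_image L \<subseteq> X" "pathfinish L = pathstart L"
    and ball: "path_image L \<subseteq> ball x (3 * \<epsilon> / 2)"
    and tr: "transports L c c'"
  shows "c' = c"
proof -
  obtain h where h: "lift_on {0..1} L h" "h 0 = c" "h 1 = c'"
    using tr by (auto simp: transports_def)
  have "\<exists>a. a \<in> X \<and> dist y a = dist y x / 3 \<and> dist a x = 2 * dist y x / 3" if "y \<in> X" for y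
    using geodesic_point[OF geo that x, of "dist y x / 3"] by fastforce
  then obtain m where m: "\<And>y. y \<in> X \<Longrightarrow> m y \<in> X" "\<And>y. y \<in> X \<Longrightarrow> dist y (m y) = dist y x / 3"
      "\<And>y. y \<in> X \<Longrightarrow> dist (m y) x = 2 * dist y x / 3"
    by metis
  have LX: "L t \<in> X" "dist (L t) x < 3 * \<epsilon> / 2" if "t \<in> {0..1}" for t
  proof -
    have "L t \<in> path_image L" using that by (simp add: path_image_def)
    then have "L t \<in> X" "L t \<in> ball x (3 * \<epsilon> / 2)" using L(2) ball by blast+
    then show "L t \<in> X" "dist (L t) x < 3 * \<epsilon> / 2" by (simp_all add: dist_commute)
  qed
  have lm: "dist (L t) (m (L t)) < \<epsilon>" "dist (m (L t)) x < \<epsilon>" "m (L t) \<in> X" if "t \<in> {0..1}" for t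
    using m[OF LX(1)[OF that]] LX[OF that] zero_le_dist[of "L t" x] eps_pos by linarith+
  define k where "k t = act (act (h t) (m (L t))) x" for t
  have am: "act (h t) (m (L t)) \<in> A" "p (act (h t) (m (L t))) = m (L t)" if "t \<in> {0..1}" for t
    using act_in p_act lift_onD[OF h(1) that] lm[OF that] by auto
  have loc: "\<exists>d>0. \<forall>s\<in>{0..1}. \<bar>s - t\<bar> < d \<longrightarrow> k s = k t" if t: "t \<in> {0..1}" for t
  proof -
    \<comment> \<open>The slack left by two steps of length \<open>dist (L t) x / 3\<close>. With
      \<open>L s\<close> closer than \<open>r/2\<close> to \<open>L t\<close>, the way from
      \<open>m (L t)\<close> via \<open>L t\<close> and \<open>L s\<close> to \<open>m (L s)\<close>
      is still shorter than \<epsilon>.\<close>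
    define r where "r = \<epsilon> - 2 * dist (L t) x / 3"
    have r: "r > 0" using LX(2)[OF t] by (simp add: r_def)
    obtain \<eta> where \<eta>: "\<eta> > 0"
      "\<And>s. s \<in> {0..1} \<Longrightarrow> \<bar>s - t\<bar> < \<eta> \<Longrightarrow> dist (L t) (L s) < \<epsilon> \<and> h s = act (h t) (L s)"
      using lift_onE[OF h(1) t] by blast
    obtain \<theta> where \<theta>: "\<theta> > 0" "\<And>s. s \<in> {0..1} \<Longrightarrow> dist s t < \<theta> \<Longrightarrow> dist (L s) (L t) < r/2"
      using L(1) t r unfolding path_def continuous_on_iff by (metis half_gt_zero)
    have "k s = k t" if s: "s \<in> {0..1}" "\<bar>s - t\<bar> < min \<eta> \<theta>" for s
    proof -
      note ht = lift_onD[OF h(1) t]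
      have 1: "dist (L t) (L s) < \<epsilon>" "h s = act (h t) (L s)" using \<eta>(2) s by auto
      have 2: "dist (L t) (L s) < r/2"
        using \<theta>(2)[of s] s by (auto simp: dist_real_def dist_commute)
      note ms = m(2)[OF LX(1)[OF s(1)]] and mt = m(2)[OF LX(1)[OF t]]
      have 3: "dist (L s) x \<le> dist (L t) x + dist (L t) (L s)"
        using dist_triangle[of "L s" x "L t"] by (simp add: dist_commute)
      have "dist (L t) (m (L s)) \<le> dist (L t) (L s) + dist (L s) (m (L s))"
        by (rule dist_triangle)
      then have 4: "dist (L t) (m (L s)) < \<epsilon>"
        using 2 3 ms r_def r zero_le_dist[of "L t" x] by linarith
      have "dist (m (L t)) (m (L s)) \<le> dist (L t) (m (L t)) + dist (L t) (m (L s))"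
        using dist_triangle[of "m (L t)" "m (L s)" "L t"] by (simp add: dist_commute)
      then have 5: "dist (m (L t)) (m (L s)) < \<epsilon>"
        using \<open>dist (L t) (m (L s)) \<le> _\<close> 2 3 ms mt r_def r zero_le_dist[of "L t" x] by linarith
      \<comment> \<open>Three triangles fill the strip between the two ways to \<open>x\<close>:
        \<open>L t\<close>, \<open>L s\<close>, \<open>m (L s)\<close>, then \<open>L t\<close>,
        \<open>m (L t)\<close>, \<open>m (L s)\<close>, and finally \<open>m (L t)\<close>,
        \<open>m (L s)\<close>, \<open>x\<close>.\<close>
      have "act (act (h t) (L s)) (m (L s)) = act (h t) (m (L s))"
        using ht 1 4 lm[OF s(1)] LX[OF s(1)] by (intro act_act) auto
      moreover have "act (act (h t) (m (L t))) (m (L s)) = act (h t) (m (L s))"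
        using ht 4 5 lm[OF s(1)] lm[OF t] by (intro act_act) auto
      moreover have "act (act (act (h t) (m (L t))) (m (L s))) x = act (act (h t) (m (L t))) x"
        using am[OF t] lm[OF s(1)] lm[OF t] x 5 by (intro act_act) auto
      ultimately show ?thesis using 1 by (simp add: k_def)
    qed
    then show ?thesis using \<eta>(1) \<theta>(1) by (intro exI[of _ "min \<eta> \<theta>"]) auto
  qed
  have le: "(0::real) \<le> 1" by simp
  have "0 \<le> (0::real) \<longrightarrow> (1::real) \<le> 1 \<longrightarrow> k 0 = k 1"
    using le
  proof (induction rule: Bolzano[where P = "\<lambda>a b. 0 \<le> a \<longrightarrow> b \<le> 1 \<longrightarrow> k a = k b"])
    case (local t)
    then obtain d where d: "d > 0" "\<forall>s\<in>{0..1}. \<bar>s - t\<bar> < d \<longrightarrow> k s = k t" using loc[of t] by auto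
    show ?case
    proof (intro exI conjI allI impI)
      fix u v :: real assume "u \<le> t \<and> t \<le> v \<and> v - u < d" "0 \<le> u" "v \<le> 1"
      then have "k u = k t" "k v = k t" by (auto intro!: d(2)[rule_format])
      then show "k u = k v" by simp
    qed (rule d(1))
  qed auto
  then have k: "k 0 = k 1" by simp
  \<comment> \<open>The jumps to \<open>x\<close> can be undone, so \<open>h t\<close> depends only
    on \<open>k t\<close> and \<open>L t\<close>, which agree at both ends.\<close>
  have "act (act (k t) (m (L t))) (L t) = h t" if t: "t \<in> {0..1}" for t
  proof -
    have "act (k t) (m (L t)) = act (h t) (m (L t))"
      unfolding k_def using act_back[of "act (h t) (m (L t))" x] am[OF t] x lm[OF t] by auto
    then show ?thesis
      using act_back[of "h t" "m (L t)"] lm[OF t] lift_onD[OF h(1) t] by auto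
  qed
  from this[of 0] this[of 1] show ?thesis
    using k h L(3) by (auto simp: pathstart_def pathfinish_def)
qed

end

subsection \<open>The covering space of a jump space\<close>

context jump_space
begin

text \<open>The points reached from \<open>c\<close> by jumps shorter than \<open>r\<close> serve as
  small neighbourhoods of \<open>c\<close>, which makes \<open>p\<close> a local
  homeomorphism.\<close>

definition jump_topology :: "'c topology" where
  "jump_topology = topology (\<lambda>W. W \<subseteq> A \<and>
     (\<forall>c\<in>W. \<exists>r>0. \<forall>y\<in>X. dist (p c) y < r \<longrightarrow> act c y \<in> W))"

lemma openin_jump_topology:
  "openin jump_topology W \<longleftrightarrow>
     W \<subseteq> A \<and> (\<forall>c\<in>W. \<exists>r>0. \<forall>y\<in>X. dist (p c) y < r \<longrightarrow> act c y \<in> W)"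
proof -
  define P where "P W \<longleftrightarrow> W \<subseteq> A \<and> (\<forall>c\<in>W. \<exists>r>0. \<forall>y\<in>X. dist (p c) y < r \<longrightarrow> act c y \<in> W)" for W
  have "P (U \<inter> V)" if UV: "P U" "P V" for U V
    unfolding P_def
  proof (intro conjI ballI)
    fix c assume c: "c \<in> U \<inter> V"
    obtain r where "r > 0" "\<forall>y\<in>X. dist (p c) y < r \<longrightarrow> act c y \<in> U"
      using UV c by (auto simp: P_def)
    moreover obtain r' where "r' > 0" "\<forall>y\<in>X. dist (p c) y < r' \<longrightarrow> act c y \<in> V"
      using UV c by (auto simp: P_def)
    ultimately show "\<exists>r>0. \<forall>y\<in>X. dist (p c) y < r \<longrightarrow> act c y \<in> U \<inter> V"
      by (intro exI[of _ "min r r'"]) auto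
  qed (use UV in \<open>auto simp: P_def\<close>)
  moreover have "P (\<Union>K)" if K: "\<forall>U\<in>K. P U" for K
    unfolding P_def
  proof (intro conjI ballI)
    fix c assume "c \<in> \<Union>K"
    then obtain U where U: "U \<in> K" "c \<in> U" by auto
    then obtain r where "r > 0" "\<forall>y\<in>X. dist (p c) y < r \<longrightarrow> act c y \<in> U"
      using K unfolding P_def by meson
    with U show "\<exists>r>0. \<forall>y\<in>X. dist (p c) y < r \<longrightarrow> act c y \<in> \<Union>K" by blast
  qed (use K in \<open>auto simp: P_def\<close>)
  ultimately have "istopology P" by (simp add: istopology_def)
  then have "openin (topology P) = P" by (simp add: topology_inverse')
  moreover have "jump_topology = topology P"
    unfolding jump_topology_def P_def by simp
  ultimately show ?thesis by (simp add: P_def)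
qed

lemma topspace_jump_topology: "topspace jump_topology = A"
proof
  show "topspace jump_topology \<subseteq> A"
    using openin_jump_topology[of "topspace jump_topology"] by simp
  have "openin jump_topology A"
    unfolding openin_jump_topology using act_in eps_pos by blast
  then show "A \<subseteq> topspace jump_topology" by (rule openin_subset)
qed

lemma continuous_map_p: "continuous_map jump_topology (top_of_set X) p"
  unfolding continuous_map_def
proof (intro conjI allI impI)
  show "p \<in> topspace jump_topology \<rightarrow> topspace (top_of_set X)"
    by (auto simp: topspace_jump_topology p_in)
  fix U assume U: "openin (top_of_set X) U"
  show "openin jump_topology {c \<in> topspace jump_topology. p c \<in> U}"
    unfolding openin_jump_topology topspace_jump_topology
  proof (intro conjI ballI)
    fix c assume c: "c \<in> {c \<in> A. p c \<in> U}"
    then obtain r where r: "r > 0" "\<And>y. y \<in> X \<Longrightarrow> dist y (p c) < r \<Longrightarrow> y \<in> U"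
      using U unfolding openin_euclidean_subtopology_iff by blast
    have "act c y \<in> {c \<in> A. p c \<in> U}" if "y \<in> X" "dist (p c) y < min r \<epsilon>" for y
      using that c act_in[of c y] p_act[of c y] r(2)[of y] by (simp add: dist_commute)
    then show "\<exists>r>0. \<forall>y\<in>X. dist (p c) y < r \<longrightarrow> act c y \<in> {c \<in> A. p c \<in> U}"
      using r(1) eps_pos by (intro exI[of _ "min r \<epsilon>"]) simp
  qed auto
qed

lemma open_map_p: "open_map jump_topology (top_of_set X) p"
  unfolding open_map_def
proof (intro allI impI)
  fix W assume W: "openin jump_topology W"
  show "openin (top_of_set X) (p ` W)"
    unfolding openin_euclidean_subtopology_iff
  proof (intro conjI ballI)
    show "p ` W \<subseteq> X" using W p_in by (auto simp: openin_jump_topology)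
    fix x assume "x \<in> p ` W"
    then obtain c where c: "c \<in> W" "c \<in> A" "x = p c" using W by (auto simp: openin_jump_topology)
    obtain r where r: "r > 0" "\<And>y. y \<in> X \<Longrightarrow> dist (p c) y < r \<Longrightarrow> act c y \<in> W"
      using W c unfolding openin_jump_topology by blast
    have "y \<in> p ` W" if "y \<in> X" "dist y x < min r \<epsilon>" for y
    proof (rule image_eqI)
      show "y = p (act c y)" using p_act[of c y] that c by (simp add: dist_commute)
      show "act c y \<in> W" using r(2)[of y] that c by (simp add: dist_commute)
    qed
    then show "\<exists>e>0. \<forall>y\<in>X. dist y x < e \<longrightarrow> y \<in> p ` W"
      using r(1) eps_pos by (intro exI[of _ "min r \<epsilon>"]) simp
  qed
qed

definition sheet :: "'c \<Rightarrow> 'c set" where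
  "sheet c = act c ` (X \<inter> ball (p c) \<epsilon>)"

lemma openin_sheet:
  assumes c: "c \<in> A"
  shows "openin jump_topology (sheet c)"
  unfolding openin_jump_topology
proof (intro conjI ballI)
  show "sheet c \<subseteq> A" using c by (auto simp: sheet_def act_in)
  fix d assume "d \<in> sheet c"
  then obtain y where y: "y \<in> X" "dist (p c) y < \<epsilon>" "d = act c y" by (auto simp: sheet_def)
  have "act d z \<in> sheet c" if z: "z \<in> X" "dist (p d) z < \<epsilon> - dist (p c) y" for z
  proof -
    have pd: "p d = y" using p_act y c by simp
    have "dist (p c) z < \<epsilon>" using dist_triangle[of "p c" z y] z pd by simp
    moreover have "dist y z < \<epsilon>" using z(2)[unfolded pd] zero_le_dist[of "p c" y] by linarith
    ultimately have "dist (p c) z < \<epsilon>" "act d z = act c z"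
      using y c z by (auto intro!: act_act)
    then show ?thesis using z by (auto simp: sheet_def)
  qed
  then show "\<exists>r>0. \<forall>z\<in>X. dist (p d) z < r \<longrightarrow> act d z \<in> sheet c"
    using y by (intro exI[of _ "\<epsilon> - dist (p c) y"]) auto
qed

lemma homeomorphic_map_sheet:
  assumes c: "c \<in> A"
  shows "homeomorphic_map (subtopology jump_topology (sheet c))
     (subtopology (top_of_set X) (X \<inter> ball (p c) \<epsilon>)) p"
proof (rule bijective_open_imp_homeomorphic_map)
  have sub: "sheet c \<subseteq> A" using openin_sheet[OF c] by (simp add: openin_jump_topology)
  have im: "p ` sheet c = X \<inter> ball (p c) \<epsilon>"
  proof -
    have "p (act c y) = y" if "y \<in> X \<inter> ball (p c) \<epsilon>" for y using that p_act c by simp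
    then show ?thesis unfolding sheet_def image_image by simp
  qed
  show "continuous_map (subtopology jump_topology (sheet c))
     (subtopology (top_of_set X) (X \<inter> ball (p c) \<epsilon>)) p"
    by (intro continuous_map_into_subtopology continuous_map_from_subtopology continuous_map_p)
      (use im in auto)
  show "open_map (subtopology jump_topology (sheet c))
     (subtopology (top_of_set X) (X \<inter> ball (p c) \<epsilon>)) p"
    by (intro open_map_into_subtopology open_map_from_subtopology open_map_p openin_sheet c)
      (use im in auto)
  show "p ` topspace (subtopology jump_topology (sheet c)) =
     topspace (subtopology (top_of_set X) (X \<inter> ball (p c) \<epsilon>))"
    using sub im by (simp add: topspace_jump_topology Int_absorb1)
  show "inj_on p (topspace (subtopology jump_topology (sheet c)))"
    unfolding inj_on_def sheet_def using p_act c by auto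
qed

text \<open>Every ball of radius \<epsilon> is evenly covered by the sheets at the points over its
  centre \<open>x\<close>. A point \<open>d\<close> over the ball lies in the sheet of
  \<open>act d x\<close>, and \<open>act_back\<close> recovers the centre of a sheet from any of its
  points, so distinct sheets are disjoint.\<close>

lemma covering_map_jump_topology:
  assumes surj: "p ` A = X"
  shows "covering_map jump_topology (top_of_set X) p"
  unfolding covering_map_def
proof (intro conjI ballI)
  show "continuous_map jump_topology (top_of_set X) p" by (rule continuous_map_p)
  show "p ` topspace jump_topology = topspace (top_of_set X)"
    using surj by (simp add: topspace_jump_topology)
  fix x assume "x \<in> topspace (top_of_set X)"
  then have x: "x \<in> X" by simp
  let ?T = "X \<inter> ball x \<epsilon>" and ?V = "sheet ` {c \<in> A. p c = x}"
  show "\<exists>T. x \<in> T \<and> openin (top_of_set X) T \<and>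
        (\<exists>V. \<Union>V = {c \<in> topspace jump_topology. p c \<in> T} \<and>
             (\<forall>U\<in>V. openin jump_topology U) \<and> pairwise disjnt V \<and>
             (\<forall>U\<in>V. homeomorphic_map (subtopology jump_topology U) (subtopology (top_of_set X) T) p))"
  proof (intro exI[of _ ?T] exI[of _ ?V] conjI)
    show "x \<in> ?T" using x eps_pos by simp
    show "openin (top_of_set X) ?T" by auto
    show "\<Union>?V = {c \<in> topspace jump_topology. p c \<in> ?T}" (is "_ = ?R")
    proof
      show "\<Union>?V \<subseteq> ?R" by (auto simp: topspace_jump_topology sheet_def act_in p_act)
      show "?R \<subseteq> \<Union>?V"
      proof
        fix d assume "d \<in> ?R"
        then have d: "d \<in> A" "p d \<in> X" "dist x (p d) < \<epsilon>" by (auto simp: topspace_jump_topology)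
        then have c: "act d x \<in> A" "p (act d x) = x"
          using act_in[of d x] p_act[of d x] x by (simp_all add: dist_commute)
        have "act (act d x) (p d) = d" using act_back[of d x] d x by (simp add: dist_commute)
        then have "d \<in> sheet (act d x)" using c d by (force simp: sheet_def)
        then show "d \<in> \<Union>?V" using c by blast
      qed
    qed
    show "\<forall>U\<in>?V. openin jump_topology U" using openin_sheet by auto
    show "pairwise disjnt ?V"
      unfolding pairwise_image
    proof (rule pairwiseI)
      fix c c' assume c: "c \<in> {c \<in> A. p c = x}" "c' \<in> {c \<in> A. p c = x}"
      have "c = c'" if "d \<in> sheet c" "d \<in> sheet c'" for d
      proof -
        obtain y y' where y: "y \<in> X" "dist x y < \<epsilon>" "d = act c y" "y' \<in> X" "dist x y' < \<epsilon>" "d = act c' y'"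
          using c \<open>d \<in> sheet c\<close> \<open>d \<in> sheet c'\<close> unfolding sheet_def by auto
        then have "y = y'" using p_act[of c y] p_act[of c' y'] c by auto
        then show ?thesis using act_back[of c y] act_back[of c' y'] y c by auto
      qed
      then show "sheet c \<noteq> sheet c' \<longrightarrow> disjnt (sheet c) (sheet c')" by (auto simp: disjnt_def)
    qed
    show "\<forall>U\<in>?V. homeomorphic_map (subtopology jump_topology U) (subtopology (top_of_set X) ?T) p"
      using homeomorphic_map_sheet by auto
  qed
qed

section \<open>Lifts of paths as continuous paths in the covering space\<close>

lemma pathin_lift:
  assumes h: "lift_on {0..1} g h" and g: "path g"
  shows "pathin jump_topology h"
  unfolding pathin_def continuous_map_def
proof (intro conjI allI impI)
  show "h \<in> topspace (top_of_set {0..1}) \<rightarrow> topspace jump_topology"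
    using lift_onD[OF h] by (auto simp: topspace_jump_topology)
  fix W assume W: "openin jump_topology W"
  have "\<exists>e>0. \<forall>s\<in>{0..1}. dist s t < e \<longrightarrow> h s \<in> W" if t: "t \<in> {0..1}" "h t \<in> W" for t
  proof -
    obtain r where r: "r > 0" "\<And>y. y \<in> X \<Longrightarrow> dist (p (h t)) y < r \<Longrightarrow> act (h t) y \<in> W"
      using W t unfolding openin_jump_topology by blast
    obtain \<eta> where \<eta>: "\<eta> > 0"
      "\<And>s. s \<in> {0..1} \<Longrightarrow> \<bar>s - t\<bar> < \<eta> \<Longrightarrow> dist (g t) (g s) < \<epsilon> \<and> h s = act (h t) (g s)"
      using lift_onE[OF h t(1)] by blast
    obtain \<theta> where \<theta>: "\<theta> > 0" "\<And>s. s \<in> {0..1} \<Longrightarrow> dist s t < \<theta> \<Longrightarrow> dist (g s) (g t) < r"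
      using g t(1) r(1) unfolding path_def continuous_on_iff by metis
    have "h s \<in> W" if s: "s \<in> {0..1}" "dist s t < min \<eta> \<theta>" for s
      using r(2)[of "g s"] \<eta>(2)[of s] \<theta>(2)[of s] s lift_onD[OF h t(1)] lift_onD[OF h s(1)]
      by (auto simp: dist_real_def dist_commute)
    then show ?thesis using \<eta>(1) \<theta>(1) by (intro exI[of _ "min \<eta> \<theta>"]) simp
  qed
  then show "openin (top_of_set {0..1}) {t \<in> topspace (top_of_set {0..1}). h t \<in> W}"
    unfolding openin_euclidean_subtopology_iff by auto
qed

text \<open>A continuous lift stays, near \<open>t\<close>, in the open sheet at \<open>h t\<close>,
  and a point of a sheet is determined by its image under \<open>p\<close>.\<close>

lemma lift_pathin:
  assumes h: "pathin jump_topology h" and g: "\<And>t. t \<in> {0..1} \<Longrightarrow> p (h t) = g t"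
  shows "lift_on {0..1} g h"
  unfolding lift_on_def
proof (intro ballI conjI)
  fix t :: real assume t: "t \<in> {0..1}"
  show ht: "h t \<in> A" and "p (h t) = g t"
    using h t g by (auto simp: pathin_def continuous_map_def topspace_jump_topology)
  have "openin (top_of_set {0..1}) {s \<in> topspace (top_of_set {0..1}). h s \<in> sheet (h t)}"
    using h openin_sheet[OF ht] unfolding pathin_def continuous_map_def by blast
  moreover have "h t \<in> sheet (h t)"
  proof -
    have "p (h t) \<in> X \<inter> ball (p (h t)) \<epsilon>" using p_in[OF ht] eps_pos by simp
    then show ?thesis unfolding sheet_def using act_self[OF ht] by (metis image_eqI)
  qed
  moreover have "t \<in> topspace (top_of_set {0..1})" using t by simp
  ultimately obtain e where "e > 0"
    "\<forall>s\<in>{0..1}. dist s t < e \<longrightarrow> s \<in> {s \<in> topspace (top_of_set {0..1}). h s \<in> sheet (h t)}"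
    unfolding openin_euclidean_subtopology_iff by (metis (mono_tags, lifting) mem_Collect_eq)
  then have e: "e > 0" "\<And>s. s \<in> {0..1} \<Longrightarrow> dist s t < e \<Longrightarrow> h s \<in> sheet (h t)"
    by auto
  have "dist (g t) (g s) < \<epsilon> \<and> h s = act (h t) (g s)" if s: "s \<in> {0..1}" "\<bar>s - t\<bar> < e" for s
  proof -
    obtain y where y: "y \<in> X" "dist (p (h t)) y < \<epsilon>" "h s = act (h t) y"
      using e(2)[of s] s by (auto simp: sheet_def dist_real_def)
    moreover have "y = g s" "p (h t) = g t" using p_act[OF ht y(1,2)] g[OF s(1)] g[OF t] y by auto
    ultimately show ?thesis by simp
  qed
  then show "\<exists>\<eta>>0. \<forall>s\<in>{0..1}. \<bar>s - t\<bar> < \<eta> \<longrightarrow> dist (g t) (g s) < \<epsilon> \<and> h s = act (h t) (g s)"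
    using e(1) by blast
qed

lemma lifts_iff_transports:
  assumes "path g"
  shows "(\<exists>h. pathin jump_topology h \<and> h 0 = c \<and> h 1 = c' \<and> (\<forall>t\<in>{0..1}. p (h t) = g t)) \<longleftrightarrow>
     transports g c c'"
  unfolding transports_def using pathin_lift[OF _ assms] lift_pathin lift_onD(2) by metis

end

section \<open>Paths in covering spaces\<close>

lemma pathin_reverse:
  assumes "pathin T g"
  shows "pathin T (\<lambda>t. g (1 - t))"
  using continuous_map_compose[of "top_of_set {0..1}" "top_of_set {0..1}" "\<lambda>t::real. 1 - t" T g] assms
  by (auto simp: pathin_def comp_def continuous_map_in_subtopology continuous_on_op_minus)

lemma pathin_join:
  assumes g: "pathin T g" and k: "pathin T k" and eq: "g 1 = k 0"
  shows "pathin T (\<lambda>t. if t \<le> 1/2 then g (2 * t) else k (2 * t - 1))"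
  unfolding pathin_def
proof (rule continuous_map_cases_le)
  let ?I = "top_of_set {0..1::real}"
  show "continuous_map ?I euclideanreal (\<lambda>t. t)" "continuous_map ?I euclideanreal (\<lambda>t. 1/2)"
    by auto
  have "continuous_map (subtopology ?I {t \<in> topspace ?I. t \<le> 1/2}) ?I (\<lambda>t. 2 * t)"
    by (auto simp: continuous_map_in_subtopology subtopology_subtopology intro!: continuous_intros)
  from continuous_map_compose[OF this, of T g]
  show "continuous_map (subtopology ?I {t \<in> topspace ?I. t \<le> 1/2}) T (\<lambda>t. g (2 * t))"
    using g by (simp add: pathin_def comp_def)
  have "continuous_map (subtopology ?I {t \<in> topspace ?I. 1/2 \<le> t}) ?I (\<lambda>t. 2 * t - 1)"
    by (auto simp: continuous_map_in_subtopology subtopology_subtopology intro!: continuous_intros)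
  from continuous_map_compose[OF this, of T k]
  show "continuous_map (subtopology ?I {t \<in> topspace ?I. 1/2 \<le> t}) T (\<lambda>t. k (2 * t - 1))"
    using k by (simp add: pathin_def comp_def)
  show "g (2 * t) = k (2 * t - 1)" if "t \<in> topspace ?I" "t = 1/2" for t
  proof -
    have "2 * t = 1" using that by simp
    then show ?thesis using eq by simp
  qed
qed

lemma locally_path_connected_space_covering:
  assumes cov: "covering_map C X p" and X: "locally_path_connected_space X"
  shows "locally_path_connected_space C"
  unfolding locally_path_connected_space
proof (intro allI impI)
  fix V c assume V: "openin C V \<and> c \<in> V"
  then have c: "c \<in> topspace C" using openin_subset by blast
  then have "p c \<in> topspace X" using cov unfolding covering_map_def by blast
  then have "\<exists>T. p c \<in> T \<and> openin X T \<and>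
        (\<exists>V. \<Union>V = {c \<in> topspace C. p c \<in> T} \<and>
             (\<forall>U\<in>V. openin C U) \<and> pairwise disjnt V \<and>
             (\<forall>U\<in>V. homeomorphic_map (subtopology C U) (subtopology X T) p))"
    using cov unfolding covering_map_def by blast
  then obtain T \<V> where T: "p c \<in> T" "openin X T" "\<Union>\<V> = {c \<in> topspace C. p c \<in> T}"
    "\<And>U. U \<in> \<V> \<Longrightarrow> openin C U"
    "\<And>U. U \<in> \<V> \<Longrightarrow> homeomorphic_map (subtopology C U) (subtopology X T) p"
    by auto
  then obtain U where U: "U \<in> \<V>" "c \<in> U" using c by blast
  have "subtopology C U homeomorphic_space subtopology X T"
    using T(5)[OF U(1)] by (rule homeomorphic_map_imp_homeomorphic_space)
  then have "locally_path_connected_space (subtopology C U)"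
    using locally_path_connected_space_open_subset[OF X T(2)]
    by (simp only: homeomorphic_locally_path_connected_space)
  moreover have "openin (subtopology C U) (V \<inter> U)" using V by (auto simp: openin_subtopology)
  moreover have "c \<in> V \<inter> U" using V U by simp
  ultimately obtain W where W: "openin (subtopology C U) W" "path_connectedin (subtopology C U) W"
    "c \<in> W" "W \<subseteq> V \<inter> U"
    unfolding locally_path_connected_space by meson
  then have "openin C W" using T(4)[OF U(1)] openin_trans_full by blast
  then show "\<exists>U. openin C U \<and> path_connectedin C U \<and> c \<in> U \<and> U \<subseteq> V"
    using W by (auto simp: path_connectedin_subtopology)
qed

text \<open>A \<delta>-cover is only required to be connected, while the comparison of two covers
  joins two points over the base point by a path.\<close>

lemma path_connected_space_covering:
  assumes "covering_map C X p" "locally_path_connected_space X" "connected_space C"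
  shows "path_connected_space C"
  using assms locally_path_connected_space_covering path_connected_eq_connected_space by blast

text \<open>A geodesic from the centre of a ball to one of its points stays in the ball.\<close>

lemma locally_path_connected_geodesic:
  assumes geo: "geodesic_space X"
  shows "locally_path_connected_space (top_of_set X)"
  unfolding locally_path_connected_space_im_kleinen
proof (intro allI impI)
  fix V x assume V: "openin (top_of_set X) V \<and> x \<in> V"
  then obtain r where r: "r > 0" "\<And>y. y \<in> X \<Longrightarrow> dist y x < r \<Longrightarrow> y \<in> V" and x: "x \<in> X"
    unfolding openin_euclidean_subtopology_iff by blast
  have "\<exists>C. path_connectedin (top_of_set X) C \<and> C \<subseteq> V \<and> x \<in> C \<and> y \<in> C" if y: "y \<in> X \<inter> ball x r" for y
  proof (intro exI conjI)
    note g = geo_path[OF geo x, of y]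
    let ?C = "path_image (geo_path X x y)"
    show "path_connectedin (top_of_set X) ?C"
      using g y by (simp add: path_connectedin_subtopology path_connected_path_image)
    show "?C \<subseteq> V"
    proof
      fix z assume "z \<in> ?C"
      then obtain t where t: "t \<in> {0..1}" "z = geo_path X x y t" by (auto simp: path_image_def)
      have "dist x z + dist z y = dist x y" using g(6)[OF _ t(1)] y t(2) by simp
      then have "dist x z \<le> dist x y" using zero_le_dist[of z y] by linarith
      then show "z \<in> V" using r(2)[of z] g(5)[OF _ t(1)] y t by (simp add: dist_commute)
    qed
    show "x \<in> ?C" "y \<in> ?C" using g(3,4) y by (metis IntD1 pathstart_in_path_image pathfinish_in_path_image)+
  qed
  moreover have "X \<inter> ball x r \<subseteq> V" using r(2) by (auto simp: dist_commute)
  ultimately show "\<exists>U. openin (top_of_set X) U \<and> x \<in> U \<and> U \<subseteq> V \<and>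
     (\<forall>y\<in>U. \<exists>C. path_connectedin (top_of_set X) C \<and> C \<subseteq> V \<and> x \<in> C \<and> y \<in> C)"
    using x r(1) by (intro exI[of _ "X \<inter> ball x r"]) auto
qed

section \<open>The fundamental group\<close>

text \<open>The library states the unit and inverse laws of path composition with \<open>linepath\<close>, and so only for
  normed spaces.\<close>

lemma homotopic_paths_join_const:
  fixes p :: "real \<Rightarrow> 'a::topological_space"
  assumes "path p" "path_image p \<subseteq> S" "x = pathfinish p"
  shows "homotopic_paths S (p +++ (\<lambda>_. x)) p"
proof (rule homotopic_paths_sym[OF homotopic_paths_reparametrize[where f = "\<lambda>t. min 1 (2 * t)"]])
  show "continuous_on {0..1::real} (\<lambda>t. min 1 (2 * t))" by (intro continuous_intros)
  show "(p +++ (\<lambda>_. x)) t = p (min 1 (2 * t))" for t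
  proof (cases "t = 1/2")
    case True
    then show ?thesis by (simp only: joinpaths_def) simp
  qed (use assms(3) in \<open>auto simp: joinpaths_def pathfinish_def min_def\<close>)
qed (use assms in auto)

lemma homotopic_paths_const_join:
  fixes p :: "real \<Rightarrow> 'a::topological_space"
  assumes "path p" "path_image p \<subseteq> S" "x = pathstart p"
  shows "homotopic_paths S ((\<lambda>_. x) +++ p) p"
proof (rule homotopic_paths_sym[OF homotopic_paths_reparametrize[where f = "\<lambda>t. max 0 (2 * t - 1)"]])
  show "continuous_on {0..1::real} (\<lambda>t. max 0 (2 * t - 1))" by (intro continuous_intros)
  show "((\<lambda>_. x) +++ p) t = p (max 0 (2 * t - 1))" for t
  proof (cases "t = 1/2")
    case True
    then show ?thesis using assms(3) by (simp only: joinpaths_def pathstart_def) simp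
  qed (use assms(3) in \<open>auto simp: joinpaths_def pathstart_def max_def\<close>)
qed (use assms in auto)

lemma homotopic_paths_join_reversepath:
  fixes p :: "real \<Rightarrow> 'a::topological_space"
  assumes "path p" "path_image p \<subseteq> S" "x = pathstart p"
  shows "homotopic_paths S (p +++ reversepath p) (\<lambda>_. x)"
proof (rule homotopic_paths_sym)
  have range: "s * (1 - \<bar>2 * t - 1\<bar>) \<in> {0..1}" if "s \<in> {0..1}" "t \<in> {0..1}" for s t :: real
    using that by (auto intro!: mult_nonneg_nonneg mult_le_one)
  \<comment> \<open>Stage \<open>s\<close> of this homotopy runs along \<open>p\<close> up to time
    \<open>s\<close> and back again.\<close>
  have "continuous_on ({0..1} \<times> {0..1}) (\<lambda>u. p (fst u * (1 - \<bar>2 * snd u - 1\<bar>)))"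
    using assms(1) unfolding path_def
    by (rule continuous_on_compose2) (use range in \<open>auto intro!: continuous_intros\<close>)
  moreover have "p (s * (1 - \<bar>2 * t - 1\<bar>)) \<in> S" if "s \<in> {0..1}" "t \<in> {0..1}" for s t
    using range[OF that] assms(2) by (auto simp: path_image_def)
  moreover have "(p +++ reversepath p) t = p (1 * (1 - \<bar>2 * t - 1\<bar>))" if "t \<in> {0..1}" for t
    by (cases t "1/2 :: real" rule: linorder_cases)
      (auto simp: joinpaths_def reversepath_def abs_if algebra_simps)
  ultimately show "homotopic_paths S (\<lambda>_. x) (p +++ reversepath p)"
    unfolding homotopic_paths using assms(3)
    by (intro exI[of _ "\<lambda>u. p (fst u * (1 - \<bar>2 * snd u - 1\<bar>))"])
      (auto simp: pathstart_def pathfinish_def)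
qed

text \<open>The assumptions put \<open>p\<close> into its own class. They matter because functions
  that are not paths in \<open>X\<close> all have the empty class.\<close>

lemma path_class_eq_iff:
  assumes "path p" "path_image p \<subseteq> X"
  shows "path_class X p = path_class X q \<longleftrightarrow> homotopic_paths X p q"
proof
  assume "path_class X p = path_class X q"
  moreover have "p \<in> path_class X p" using assms by (simp add: path_class_def)
  ultimately have "homotopic_paths X q p" by (auto simp: path_class_def)
  then show "homotopic_paths X p q" by (rule homotopic_paths_sym)
next
  assume "homotopic_paths X p q"
  then have "homotopic_paths X p r \<longleftrightarrow> homotopic_paths X q r" for r
    by (meson homotopic_paths_sym homotopic_paths_trans)
  then show "path_class X p = path_class X q" by (simp add: path_class_def)
qed

lemma path_class_eqI: "homotopic_paths X p q \<Longrightarrow> path_class X p = path_class X q"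
  using path_class_eq_iff homotopic_paths_imp_path homotopic_paths_imp_subset by metis

lemma pathstart_const: "pathstart (\<lambda>_. x) = x"
  by (simp add: pathstart_def)

lemma pathfinish_const: "pathfinish (\<lambda>_. x) = x"
  by (simp add: pathfinish_def)

lemma homotopic_join_cancel:
  assumes "path g" "path_image g \<subseteq> X" "path k" "path_image k \<subseteq> X" "path r" "path_image r \<subseteq> X"
    and "pathfinish g = pathstart k" "pathstart r = pathfinish g"
  shows "homotopic_paths X ((g +++ k) +++ (reversepath k +++ r)) (g +++ r)"
proof -
  have "homotopic_paths X ((g +++ k) +++ (reversepath k +++ r)) (g +++ (k +++ (reversepath k +++ r)))"
    using assms by (intro homotopic_paths_sym[OF homotopic_paths_assoc]) (simp_all add: path_image_join)
  also have "homotopic_paths X (g +++ (k +++ (reversepath k +++ r))) (g +++ ((k +++ reversepath k) +++ r))"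
    using assms by (intro homotopic_paths_join homotopic_paths_assoc) simp_all
  also have "homotopic_paths X (g +++ ((k +++ reversepath k) +++ r))
      (g +++ ((\<lambda>_. pathstart k) +++ r))"
    using assms by (intro homotopic_paths_join homotopic_paths_join_reversepath) simp_all
  also have "homotopic_paths X (g +++ ((\<lambda>_. pathstart k) +++ r)) (g +++ r)"
    using assms by (intro homotopic_paths_join homotopic_paths_const_join) (simp_all add: pathstart_const)
  finally show ?thesis .
qed

text \<open>This brings the loop formed by two extensions of one path into the shape of a
  lasso.\<close>

lemma homotopic_join_regroup:
  assumes "path a" "path_image a \<subseteq> X" "path c" "path_image c \<subseteq> X" "path d" "path_image d \<subseteq> X"
    "path e" "path_image e \<subseteq> X"
    and "pathfinish a = pathstart c" "pathfinish c = pathstart d" "pathfinish d = pathstart e"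
  shows "homotopic_paths X ((a +++ c) +++ (d +++ e)) (a +++ ((c +++ d) +++ e))"
proof -
  have "homotopic_paths X ((a +++ c) +++ (d +++ e)) (a +++ (c +++ (d +++ e)))"
    using assms by (intro homotopic_paths_sym[OF homotopic_paths_assoc]) (simp_all add: path_image_join)
  also have "homotopic_paths X (a +++ (c +++ (d +++ e))) (a +++ ((c +++ d) +++ e))"
    using assms by (intro homotopic_paths_join homotopic_paths_assoc) simp_all
  finally show ?thesis .
qed

lemma loops_at_iff:
  "g \<in> loops_at X b \<longleftrightarrow> path g \<and> path_image g \<subseteq> X \<and> pathstart g = b \<and> pathfinish g = b"
  by (simp add: loops_at_def)

lemma loops_at_join: "p \<in> loops_at X b \<Longrightarrow> q \<in> loops_at X b \<Longrightarrow> p +++ q \<in> loops_at X b"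
  by (simp add: loops_at_iff path_image_join)

lemma loops_at_reversepath: "p \<in> loops_at X b \<Longrightarrow> reversepath p \<in> loops_at X b"
  by (simp add: loops_at_iff)

lemma loops_at_const: "b \<in> X \<Longrightarrow> (\<lambda>_. b) \<in> loops_at X b"
  by (auto simp: loops_at_iff path_def path_image_def pathstart_def pathfinish_def)

lemma mult_path_class:
  assumes p: "p \<in> loops_at X b" and q: "q \<in> loops_at X b"
  shows "path_class X p \<otimes>\<^bsub>fundamental_group X b\<^esub> path_class X q = path_class X (p +++ q)"
proof -
  have eq: "path_class X (p' +++ q') = path_class X (p +++ q)"
    if "p' \<in> path_class X p" "q' \<in> path_class X q" for p' q'
    using that p q unfolding path_class_def
    by (intro path_class_eqI[unfolded path_class_def] homotopic_paths_sym[OF homotopic_paths_join])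
      (auto simp: loops_at_iff)
  have "p \<in> path_class X p" "q \<in> path_class X q"
    using p q by (auto simp: path_class_def loops_at_iff)
  then have "(\<Union>p'\<in>path_class X p. \<Union>q'\<in>path_class X q. path_class X (p' +++ q')) = path_class X (p +++ q)"
    using eq by blast
  then show ?thesis by (simp add: fundamental_group_def)
qed

lemma group_fundamental_group:
  assumes b: "b \<in> X"
  shows "group (fundamental_group X b)"
proof (rule groupI)
  let ?G = "fundamental_group X b"
  have carr: "carrier ?G = path_class X ` loops_at X b" "\<one>\<^bsub>?G\<^esub> = path_class X (\<lambda>_. b)"
    by (simp_all add: fundamental_group_def)
  show "\<one>\<^bsub>?G\<^esub> \<in> carrier ?G" using loops_at_const[OF b] by (simp add: carr)
  fix P assume "P \<in> carrier ?G"
  then obtain p where p: "p \<in> loops_at X b" "P = path_class X p" by (auto simp: carr)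
  show "\<one>\<^bsub>?G\<^esub> \<otimes>\<^bsub>?G\<^esub> P = P"
    using p mult_path_class[OF loops_at_const[OF b] p(1)] homotopic_paths_const_join[of p X b]
    by (auto simp: carr loops_at_iff intro!: path_class_eqI)
  have "homotopic_paths X (reversepath p +++ p) (\<lambda>_. b)"
    using homotopic_paths_join_reversepath[of "reversepath p" X b] p by (simp add: loops_at_iff)
  then have "path_class X (reversepath p) \<otimes>\<^bsub>?G\<^esub> P = \<one>\<^bsub>?G\<^esub>"
    using mult_path_class[OF loops_at_reversepath[OF p(1)] p(1)] p
    by (simp add: carr path_class_eqI)
  then show "\<exists>Q\<in>carrier ?G. Q \<otimes>\<^bsub>?G\<^esub> P = \<one>\<^bsub>?G\<^esub>"
    using loops_at_reversepath[OF p(1)] unfolding carr by blast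
  fix Q assume "Q \<in> carrier ?G"
  then obtain q where q: "q \<in> loops_at X b" "Q = path_class X q" by (auto simp: carr)
  show "P \<otimes>\<^bsub>?G\<^esub> Q \<in> carrier ?G"
    using p q loops_at_join[OF p(1) q(1)] by (simp add: mult_path_class carr)
  fix R assume "R \<in> carrier ?G"
  then obtain r where r: "r \<in> loops_at X b" "R = path_class X r" by (auto simp: carr)
  have "homotopic_paths X (p +++ (q +++ r)) ((p +++ q) +++ r)"
    using p q r by (intro homotopic_paths_assoc) (auto simp: loops_at_iff)
  then have "path_class X (p +++ (q +++ r)) = path_class X ((p +++ q) +++ r)"
    by (rule path_class_eqI)
  then show "(P \<otimes>\<^bsub>?G\<^esub> Q) \<otimes>\<^bsub>?G\<^esub> R = P \<otimes>\<^bsub>?G\<^esub> (Q \<otimes>\<^bsub>?G\<^esub> R)"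
    using p q r by (simp add: mult_path_class loops_at_join)
qed

lemma inv_path_class:
  assumes b: "b \<in> X" and p: "p \<in> loops_at X b"
  shows "inv\<^bsub>fundamental_group X b\<^esub> (path_class X p) = path_class X (reversepath p)"
proof (rule group.inv_equality[OF group_fundamental_group[OF b]])
  have "homotopic_paths X (reversepath p +++ p) (\<lambda>_. b)"
    using homotopic_paths_join_reversepath[of "reversepath p" X b] p by (simp add: loops_at_iff)
  then show "path_class X (reversepath p) \<otimes>\<^bsub>fundamental_group X b\<^esub> path_class X p =
     \<one>\<^bsub>fundamental_group X b\<^esub>"
    using mult_path_class[OF loops_at_reversepath[OF p] p]
    by (simp add: fundamental_group_def path_class_eqI)
qed (use p loops_at_reversepath[OF p] in \<open>auto simp: fundamental_group_def\<close>)

section \<open>Generators and normality of the groups \<open>S\<^sub>\<delta>\<close>\<close>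

definition lassos :: "'a::metric_space set \<Rightarrow> 'a \<Rightarrow> real \<Rightarrow> (real \<Rightarrow> 'a) set set" where
  "lassos X b \<delta> = {path_class X (c +++ L +++ reversepath c) | c L.
          path c \<and> path_image c \<subseteq> X \<and> pathstart c = b \<and>
          L \<in> loops_at X (pathfinish c) \<and> (\<exists>x\<in>X. path_image L \<subseteq> ball x \<delta>)}"

lemma delta_subgroup_eq: "delta_subgroup X b \<delta> = generate (fundamental_group X b) (lassos X b \<delta>)"
  by (simp add: delta_subgroup_def lassos_def)

lemma lasso_in_loops_at:
  assumes "path c" "path_image c \<subseteq> X" "pathstart c = b" "L \<in> loops_at X (pathfinish c)"
  shows "c +++ L +++ reversepath c \<in> loops_at X b"
  using assms by (simp add: loops_at_iff path_image_join)

lemma lassos_subset: "lassos X b \<delta> \<subseteq> carrier (fundamental_group X b)"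
  using lasso_in_loops_at by (fastforce simp: lassos_def fundamental_group_def)

lemma delta_subgroup_mono:
  assumes b: "b \<in> X" and "\<delta> \<le> \<delta>'"
  shows "delta_subgroup X b \<delta> \<subseteq> delta_subgroup X b \<delta>'"
  unfolding delta_subgroup_eq
proof (rule group.mono_generate[OF group_fundamental_group[OF b]])
  show "lassos X b \<delta> \<subseteq> lassos X b \<delta>'"
    unfolding lassos_def using subset_ball[OF assms(2)] by blast
qed

text \<open>Conjugating a lasso by a loop \<open>k\<close> prolongs its tail \<open>c\<close> to
  \<open>k +++ c\<close> and keeps the small loop at its end, so the generating set is closed under
  conjugation. Normality is what frees the comparison of covers from the choice of their base
  points.\<close>

lemma normal_delta_subgroup:
  assumes b: "b \<in> X"
  shows "delta_subgroup X b \<delta> \<lhd> fundamental_group X b"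
  unfolding delta_subgroup_eq
proof (rule group.normal_generateI[OF group_fundamental_group[OF b] lassos_subset])
  let ?G = "fundamental_group X b"
  fix P K assume "P \<in> lassos X b \<delta>" "K \<in> carrier ?G"
  then obtain c L x k where P: "P = path_class X (c +++ L +++ reversepath c)"
    and c: "path c" "path_image c \<subseteq> X" "pathstart c = b"
    and L: "L \<in> loops_at X (pathfinish c)" "x \<in> X" "path_image L \<subseteq> ball x \<delta>"
    and K: "K = path_class X k" "k \<in> loops_at X b"
    by (auto simp: lassos_def fundamental_group_def)
  let ?l = "L +++ reversepath c"
  have k: "path k" "path_image k \<subseteq> X" "pathstart k = b" "pathfinish k = b"
    and l: "path L" "path_image L \<subseteq> X" "pathstart L = pathfinish c" "pathfinish L = pathfinish c"
    using K L by (auto simp: loops_at_iff)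
  have lp: "path ?l" "path_image ?l \<subseteq> X" "pathstart ?l = pathfinish c" "pathfinish ?l = b"
    using c l by (auto simp: path_image_join)
  have "homotopic_paths X ((k +++ (c +++ ?l)) +++ reversepath k) (((k +++ c) +++ ?l) +++ reversepath k)"
    using k c lp by (intro homotopic_paths_join homotopic_paths_assoc) simp_all
  also have "homotopic_paths X (((k +++ c) +++ ?l) +++ reversepath k) ((k +++ c) +++ (?l +++ reversepath k))"
    using k c lp by (intro homotopic_paths_sym[OF homotopic_paths_assoc]) (simp_all add: path_image_join)
  also have "homotopic_paths X ((k +++ c) +++ (?l +++ reversepath k))
      ((k +++ c) +++ (L +++ (reversepath c +++ reversepath k)))"
    using k c l by (intro homotopic_paths_join homotopic_paths_sym[OF homotopic_paths_assoc])
      (simp_all add: path_image_join)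
  finally have "homotopic_paths X ((k +++ (c +++ ?l)) +++ reversepath k)
      ((k +++ c) +++ L +++ reversepath (k +++ c))"
    using k c by (simp add: reversepath_joinpaths)
  moreover have "K \<otimes>\<^bsub>?G\<^esub> P \<otimes>\<^bsub>?G\<^esub> inv\<^bsub>?G\<^esub> K = path_class X ((k +++ (c +++ ?l)) +++ reversepath k)"
    using P K inv_path_class[OF b K(2)] lasso_in_loops_at[OF c L(1)]
    by (simp add: mult_path_class loops_at_join loops_at_reversepath)
  ultimately have "K \<otimes>\<^bsub>?G\<^esub> P \<otimes>\<^bsub>?G\<^esub> inv\<^bsub>?G\<^esub> K = path_class X ((k +++ c) +++ L +++ reversepath (k +++ c))"
    by (simp add: path_class_eqI)
  moreover have "path (k +++ c)" "path_image (k +++ c) \<subseteq> X" "pathstart (k +++ c) = b"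
    "L \<in> loops_at X (pathfinish (k +++ c))"
    using k c L by (simp_all add: path_image_join)
  ultimately show "K \<otimes>\<^bsub>?G\<^esub> P \<otimes>\<^bsub>?G\<^esub> inv\<^bsub>?G\<^esub> K \<in> lassos X b \<delta>"
    unfolding lassos_def using L by blast
qed

lemma delta_subgroup_closed:
  assumes b: "b \<in> X"
  shows "path_class X (\<lambda>_. b) \<in> delta_subgroup X b \<delta>"
    and "\<lbrakk>p \<in> loops_at X b; path_class X p \<in> delta_subgroup X b \<delta>\<rbrakk>
      \<Longrightarrow> path_class X (reversepath p) \<in> delta_subgroup X b \<delta>"
    and "\<lbrakk>p \<in> loops_at X b; q \<in> loops_at X b; path_class X p \<in> delta_subgroup X b \<delta>;
      path_class X q \<in> delta_subgroup X b \<delta>\<rbrakk> \<Longrightarrow> path_class X (p +++ q) \<in> delta_subgroup X b \<delta>"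
    and "\<lbrakk>k \<in> loops_at X b; p \<in> loops_at X b;
      path_class X ((k +++ p) +++ reversepath k) \<in> delta_subgroup X b \<delta>\<rbrakk>
      \<Longrightarrow> path_class X p \<in> delta_subgroup X b \<delta>"
proof -
  let ?G = "fundamental_group X b"
  interpret group ?G by (rule group_fundamental_group[OF b])
  interpret normal "delta_subgroup X b \<delta>" ?G by (rule normal_delta_subgroup[OF b])
  show "path_class X (\<lambda>_. b) \<in> delta_subgroup X b \<delta>"
    using one_closed by (simp add: fundamental_group_def)
  show "path_class X (reversepath p) \<in> delta_subgroup X b \<delta>"
    if "p \<in> loops_at X b" "path_class X p \<in> delta_subgroup X b \<delta>"
    using m_inv_closed[OF that(2)] inv_path_class[OF b that(1)] by simp
  show "path_class X (p +++ q) \<in> delta_subgroup X b \<delta>"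
    if "p \<in> loops_at X b" "q \<in> loops_at X b" "path_class X p \<in> delta_subgroup X b \<delta>"
      "path_class X q \<in> delta_subgroup X b \<delta>"
    using m_closed[OF that(3,4)] mult_path_class[OF that(1,2)] by simp
  show "path_class X p \<in> delta_subgroup X b \<delta>"
    if k: "k \<in> loops_at X b" and p: "p \<in> loops_at X b"
      and S: "path_class X ((k +++ p) +++ reversepath k) \<in> delta_subgroup X b \<delta>"
  proof -
    let ?K = "path_class X k" and ?P = "path_class X p"
    have car: "?K \<in> carrier ?G" "?P \<in> carrier ?G"
      using k p by (auto simp: fundamental_group_def)
    have "?K \<otimes>\<^bsub>?G\<^esub> ?P \<otimes>\<^bsub>?G\<^esub> inv\<^bsub>?G\<^esub> ?K \<in> delta_subgroup X b \<delta>"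
      using S k p by (simp add: inv_path_class[OF b] mult_path_class loops_at_join loops_at_reversepath)
    then have "inv\<^bsub>?G\<^esub> ?K \<otimes>\<^bsub>?G\<^esub> (?K \<otimes>\<^bsub>?G\<^esub> ?P \<otimes>\<^bsub>?G\<^esub> inv\<^bsub>?G\<^esub> ?K) \<otimes>\<^bsub>?G\<^esub> ?K
        \<in> delta_subgroup X b \<delta>"
      using inv_op_closed1 car by blast
    moreover have "inv\<^bsub>?G\<^esub> ?K \<otimes>\<^bsub>?G\<^esub> (?K \<otimes>\<^bsub>?G\<^esub> ?P) = ?P"
      using car by (simp flip: m_assoc)
    ultimately show ?thesis using car by (simp add: m_assoc)
  qed
qed

lemma lasso_in_delta_subgroup:
  assumes "path c" "path_image c \<subseteq> X" "pathstart c = b" "L \<in> loops_at X (pathfinish c)"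
    "x \<in> X" "path_image L \<subseteq> ball x \<delta>"
  shows "path_class X (c +++ L +++ reversepath c) \<in> delta_subgroup X b \<delta>"
  unfolding delta_subgroup_eq by (rule generate.incl) (use assms in \<open>auto simp: lassos_def\<close>)

subsection \<open>Elements of \<open>S\<^sub>\<delta>\<close> act trivially\<close>

context jump_space
begin

lemma transports_const:
  assumes "c \<in> A"
  shows "transports (\<lambda>_. p c) c c"
  using transports_small_path[of "\<lambda>_. p c" c] assms p_in act_self eps_pos
  by (auto simp: path_def path_image_def pathstart_def pathfinish_def)

lemma transports_lasso:
  assumes geo: "geodesic_space X"
    and c: "path c" "path_image c \<subseteq> X" "pathstart c = b" and L: "L \<in> loops_at X (pathfinish c)"
    and x: "x \<in> X" "path_image L \<subseteq> ball x (3 * \<epsilon> / 2)" and e: "e \<in> A" "p e = b"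
  shows "transports (c +++ L +++ reversepath c) e e"
proof -
  have l: "path L" "path_image L \<subseteq> X" "pathstart L = pathfinish c" "pathfinish L = pathfinish c"
    using L by (auto simp: loops_at_iff)
  obtain d where d: "transports c e d" using transports_ex[of c e] c e by auto
  then have dd: "d \<in> A" "p d = pathfinish c" using transports_in by auto
  obtain d' where d': "transports L d d'" using transports_ex[of L d] dd l by auto
  then have "d' = d" using transports_loop_in_ball[OF geo x(1)] l x by auto
  then have "transports (L +++ reversepath c) d e"
    using d' d l c by (intro transports_join[of L d d] transports_reversepath) simp_all
  then show ?thesis using d l c by (intro transports_join[of c e d]) (simp_all add: path_image_join)
qed

text \<open>Lassos act trivially because their small loops do, and trivial action is inherited by
  products and inverses. Elements of the group are classes of paths, so the claim is made for every
  representative \<open>g\<close> and transferred by homotopy invariance.\<close>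

lemma transports_delta_subgroup:
  assumes geo: "geodesic_space X" and b: "b \<in> X"
    and P: "P \<in> delta_subgroup X b (3 * \<epsilon> / 2)" and g: "g \<in> P" and e: "e \<in> A" "p e = b"
  shows "transports g e e"
  using P[unfolded delta_subgroup_eq] g
proof (induction arbitrary: g rule: generate.induct)
  case one
  then have "homotopic_paths X (\<lambda>_. b) g" by (simp add: fundamental_group_def path_class_def)
  then show ?case using transports_homotopic_paths transports_const[OF e(1)] e(2) by blast
next
  case (incl P)
  then obtain c L where "homotopic_paths X (c +++ L +++ reversepath c) g"
    "transports (c +++ L +++ reversepath c) e e"
    using transports_lasso[OF geo] e by (auto simp: lassos_def path_class_def)
  then show ?case using transports_homotopic_paths by blast
next
  case (inv P)
  then obtain c L x where P: "P = path_class X (c +++ L +++ reversepath c)"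
    and c: "path c" "path_image c \<subseteq> X" "pathstart c = b" "L \<in> loops_at X (pathfinish c)"
    and x: "x \<in> X" "path_image L \<subseteq> ball x (3 * \<epsilon> / 2)"
    by (auto simp: lassos_def)
  have "g \<in> path_class X (reversepath (c +++ L +++ reversepath c))"
    using inv(2) P inv_path_class[OF b lasso_in_loops_at[OF c]] by simp
  then show ?case
    using transports_homotopic_paths transports_reversepath[OF transports_lasso[OF geo c x e]]
    by (auto simp: path_class_def)
next
  case (eng P1 P2)
  have "P1 \<in> carrier (fundamental_group X b)" "P2 \<in> carrier (fundamental_group X b)"
    using eng(1,2) group.generate_in_carrier[OF group_fundamental_group[OF b] lassos_subset] by auto
  then obtain p1 p2 where P: "P1 = path_class X p1" "P2 = path_class X p2"
    "p1 \<in> loops_at X b" "p2 \<in> loops_at X b"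
    by (auto simp: fundamental_group_def)
  then have "g \<in> path_class X (p1 +++ p2)" using eng(5) mult_path_class by metis
  moreover have "p1 \<in> P1" "p2 \<in> P2" using P by (auto simp: path_class_def loops_at_iff)
  then have "transports (p1 +++ p2) e e"
    using eng(3,4) P by (intro transports_join[of p1 e e]) (auto simp: loops_at_iff)
  ultimately show ?case using transports_homotopic_paths by (auto simp: path_class_def)
qed

end

section \<open>The \<open>\<delta>\<close>-cover as a jump space\<close>

lemma geo_path_subset_ball:
  assumes "geodesic_space X" "x \<in> X" "y \<in> X" "dist x y < r"
  shows "path_image (geo_path X x y) \<subseteq> ball x r"
proof
  note g = geo_path[OF assms(1-3)]
  fix w assume "w \<in> path_image (geo_path X x y)"
  then obtain t where t: "t \<in> {0..1}" "w = geo_path X x y t" by (auto simp: path_image_def)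
  have "dist x w + dist w y = dist x y" using g(6)[OF t(1)] t(2) by simp
  then have "dist x w < r" using zero_le_dist[of w y] assms(4) by linarith
  then show "w \<in> ball x r" by simp
qed

text \<open>The ways from \<open>x\<close> to a point \<open>w\<close> of the opposite side, via
  \<open>y\<close> and via \<open>z\<close>, together have the length of the perimeter, so one of
  them is shorter than \<open>r\<close>.\<close>

lemma geo_path_opposite_subset_ball:
  assumes "geodesic_space X" "y \<in> X" "z \<in> X"
    and "dist x y + dist y z + dist x z < 2 * r"
  shows "path_image (geo_path X y z) \<subseteq> ball x r"
proof
  note g = geo_path[OF assms(1-3)]
  fix w assume "w \<in> path_image (geo_path X y z)"
  then obtain t where t: "t \<in> {0..1}" "w = geo_path X y z t" by (auto simp: path_image_def)
  have "dist y w + dist w z = dist y z" using g(6)[OF t(1)] t(2) by simp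
  moreover have "dist x w \<le> dist x y + dist y w" by (rule dist_triangle)
  moreover have "dist x w \<le> dist x z + dist w z" by (rule dist_triangle2)
  ultimately have "dist x w < r" using assms(4) by linarith
  then show "w \<in> ball x r" by simp
qed

section \<open>Classes of paths modulo \<open>S\<^sub>\<delta>\<close> and their extension along
  geodesics\<close>

definition paths_from :: "'a::topological_space set \<Rightarrow> 'a \<Rightarrow> (real \<Rightarrow> 'a) set" where
  "paths_from X b = {g. path g \<and> path_image g \<subseteq> X \<and> pathstart g = b}"

lemma paths_from_iff: "g \<in> paths_from X b \<longleftrightarrow> path g \<and> path_image g \<subseteq> X \<and> pathstart g = b"
  by (simp add: paths_from_def)

lemma paths_from_join:
  "\<lbrakk>g \<in> paths_from X b; path k; path_image k \<subseteq> X; pathstart k = pathfinish g\<rbrakk>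
    \<Longrightarrow> g +++ k \<in> paths_from X b"
  by (simp add: paths_from_iff path_image_join)

lemma pathfinish_in: "g \<in> paths_from X b \<Longrightarrow> pathfinish g \<in> X"
  using pathfinish_in_path_image by (auto simp: paths_from_iff)

definition end_point :: "(real \<Rightarrow> 'a) set \<Rightarrow> 'a::topological_space" where
  "end_point c = pathfinish (SOME g. g \<in> c)"

locale pointed_geodesic_space =
  fixes X :: "'a::metric_space set" and b :: 'a
  assumes geo: "geodesic_space X" and b_in: "b \<in> X"
begin

definition delta_rel :: "real \<Rightarrow> (real \<Rightarrow> 'a) \<Rightarrow> (real \<Rightarrow> 'a) \<Rightarrow> bool" where
  "delta_rel \<delta> g g' \<longleftrightarrow> g \<in> paths_from X b \<and> g' \<in> paths_from X b \<and> pathfinish g = pathfinish g' \<and>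
     path_class X (g +++ reversepath g') \<in> delta_subgroup X b \<delta>"

text \<open>This is the classical construction of the covering that belongs to a subgroup. Its
  points are sets of paths and so have the type that \<open>delta_cover\<close> prescribes.\<close>

definition point_of :: "real \<Rightarrow> (real \<Rightarrow> 'a) \<Rightarrow> (real \<Rightarrow> 'a) set" where
  "point_of \<delta> g = {g'. delta_rel \<delta> g g'}"

definition delta_points :: "real \<Rightarrow> (real \<Rightarrow> 'a) set set" where
  "delta_points \<delta> = point_of \<delta> ` paths_from X b"

definition extend :: "real \<Rightarrow> (real \<Rightarrow> 'a) set \<Rightarrow> 'a \<Rightarrow> (real \<Rightarrow> 'a) set" where
  "extend \<delta> c y = point_of \<delta> ((SOME g. g \<in> c) +++ geo_path X (end_point c) y)"

lemma delta_rel_homotopic: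
  assumes g: "g \<in> paths_from X b" and hom: "homotopic_paths X g g'"
  shows "delta_rel \<delta> g g'"
proof -
  have g': "g' \<in> paths_from X b" "pathfinish g = pathfinish g'"
    using g homotopic_paths_imp_path[OF hom] homotopic_paths_imp_subset[OF hom]
      homotopic_paths_imp_pathstart[OF hom] homotopic_paths_imp_pathfinish[OF hom]
    by (auto simp: paths_from_iff)
  have "homotopic_paths X (g +++ reversepath g') (g' +++ reversepath g')"
    using hom g' by (intro homotopic_paths_join) (simp_all add: paths_from_iff)
  also have "homotopic_paths X (g' +++ reversepath g') (\<lambda>_. b)"
    using g' by (intro homotopic_paths_join_reversepath) (simp_all add: paths_from_iff)
  finally have "path_class X (g +++ reversepath g') = path_class X (\<lambda>_. b)"
    by (rule path_class_eqI)
  then show ?thesis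
    using g g' delta_subgroup_closed(1)[OF b_in] by (simp add: delta_rel_def)
qed

lemma delta_rel_refl: "g \<in> paths_from X b \<Longrightarrow> delta_rel \<delta> g g"
  by (rule delta_rel_homotopic) (simp_all add: paths_from_iff)

lemma loop_of_paths:
  assumes "g \<in> paths_from X b" "g' \<in> paths_from X b" "pathfinish g = pathfinish g'"
  shows "g +++ reversepath g' \<in> loops_at X b"
  using assms by (simp add: paths_from_iff loops_at_iff path_image_join)

lemma delta_rel_sym:
  assumes "delta_rel \<delta> g g'"
  shows "delta_rel \<delta> g' g"
proof -
  have "path_class X (reversepath (g +++ reversepath g')) \<in> delta_subgroup X b \<delta>"
    by (rule delta_subgroup_closed(2)[OF b_in]) (use assms in \<open>simp_all add: delta_rel_def loop_of_paths\<close>)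
  then show ?thesis
    using assms by (simp add: delta_rel_def reversepath_joinpaths)
qed

lemma delta_rel_trans:
  assumes 1: "delta_rel \<delta> g g'" and 2: "delta_rel \<delta> g' g''"
  shows "delta_rel \<delta> g g''"
proof -
  have "homotopic_paths X ((g +++ reversepath g') +++ (reversepath (reversepath g') +++ reversepath g''))
     (g +++ reversepath g'')"
    using 1 2 by (intro homotopic_join_cancel) (simp_all add: delta_rel_def paths_from_iff)
  then have "path_class X ((g +++ reversepath g') +++ (g' +++ reversepath g'')) =
      path_class X (g +++ reversepath g'')"
    using path_class_eqI by fastforce
  moreover have "path_class X ((g +++ reversepath g') +++ (g' +++ reversepath g'')) \<in> delta_subgroup X b \<delta>"
    by (rule delta_subgroup_closed(3)[OF b_in]) (use 1 2 in \<open>simp_all add: delta_rel_def loop_of_paths\<close>)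
  ultimately show ?thesis using 1 2 by (simp add: delta_rel_def)
qed

lemma point_of_eq_iff:
  assumes "g \<in> paths_from X b"
  shows "point_of \<delta> g = point_of \<delta> g' \<longleftrightarrow> delta_rel \<delta> g g'"
proof
  assume "point_of \<delta> g = point_of \<delta> g'"
  then have "delta_rel \<delta> g' g" using delta_rel_refl[OF assms] by (auto simp: point_of_def)
  then show "delta_rel \<delta> g g'" by (rule delta_rel_sym)
next
  assume "delta_rel \<delta> g g'"
  then have "delta_rel \<delta> g k \<longleftrightarrow> delta_rel \<delta> g' k" for k
    by (meson delta_rel_sym delta_rel_trans)
  then show "point_of \<delta> g = point_of \<delta> g'" by (simp add: point_of_def)
qed

lemma delta_rel_join:
  assumes r: "delta_rel \<delta> g g'" and k: "path k" "path_image k \<subseteq> X" "pathstart k = pathfinish g"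
  shows "delta_rel \<delta> (g +++ k) (g' +++ k)"
proof -
  have g: "g \<in> paths_from X b" "g' \<in> paths_from X b" "pathfinish g = pathfinish g'"
    using r by (simp_all add: delta_rel_def)
  have "homotopic_paths X ((g +++ k) +++ (reversepath k +++ reversepath g')) (g +++ reversepath g')"
    using g k by (intro homotopic_join_cancel) (simp_all add: paths_from_iff)
  then have "path_class X ((g +++ k) +++ reversepath (g' +++ k)) = path_class X (g +++ reversepath g')"
    using g k by (simp add: path_class_eqI reversepath_joinpaths)
  then show ?thesis
    using r g k by (simp add: delta_rel_def paths_from_join)
qed

text \<open>The two extensions of \<open>g\<close> differ by a lasso with tail \<open>g\<close>,
  whose loop runs along \<open>k\<close> and back along \<open>k'\<close> inside the ball. Thus, up
  to \<open>S\<^sub>\<delta>\<close>, only the end point of a small extension matters.\<close>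

lemma delta_rel_small:
  assumes g: "g \<in> paths_from X b" and z: "z \<in> X"
    and k: "path k" "path_image k \<subseteq> X" "path_image k \<subseteq> ball z \<delta>" "pathstart k = pathfinish g"
    and k': "path k'" "path_image k' \<subseteq> X" "path_image k' \<subseteq> ball z \<delta>" "pathstart k' = pathfinish g"
    and fin: "pathfinish k = pathfinish k'"
  shows "delta_rel \<delta> (g +++ k) (g +++ k')"
proof -
  let ?L = "k +++ reversepath k'"
  have "?L \<in> loops_at X (pathfinish g)" "path_image ?L \<subseteq> ball z \<delta>"
    using k k' fin by (simp_all add: loops_at_iff path_image_join)
  then have S: "path_class X (g +++ ?L +++ reversepath g) \<in> delta_subgroup X b \<delta>"
    using g z by (intro lasso_in_delta_subgroup) (simp_all add: paths_from_iff)
  have "homotopic_paths X ((g +++ k) +++ (reversepath k' +++ reversepath g)) (g +++ ?L +++ reversepath g)"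
    using g k k' fin by (intro homotopic_join_regroup) (simp_all add: paths_from_iff)
  then have "path_class X ((g +++ k) +++ reversepath (g +++ k')) = path_class X (g +++ ?L +++ reversepath g)"
    using g k k' fin by (simp add: path_class_eqI reversepath_joinpaths)
  then show ?thesis
    using S g k k' fin by (simp add: delta_rel_def paths_from_join)
qed

lemma end_point_point_of:
  assumes "g \<in> paths_from X b"
  shows "end_point (point_of \<delta> g) = pathfinish g" "delta_rel \<delta> g (SOME g'. g' \<in> point_of \<delta> g)"
proof -
  have "g \<in> point_of \<delta> g" using delta_rel_refl[OF assms] by (simp add: point_of_def)
  then have "(SOME g'. g' \<in> point_of \<delta> g) \<in> point_of \<delta> g"
    by (rule someI[of "\<lambda>g'. g' \<in> point_of \<delta> g"])
  then show "delta_rel \<delta> g (SOME g'. g' \<in> point_of \<delta> g)" by (simp add: point_of_def)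
  then show "end_point (point_of \<delta> g) = pathfinish g" by (simp add: end_point_def delta_rel_def)
qed

lemma extend_point_of:
  assumes g: "g \<in> paths_from X b" and y: "y \<in> X"
  shows "extend \<delta> (point_of \<delta> g) y = point_of \<delta> (g +++ geo_path X (pathfinish g) y)"
proof -
  note k = geo_path[OF geo pathfinish_in[OF g] y]
  have "delta_rel \<delta> (g +++ geo_path X (pathfinish g) y)
      ((SOME g'. g' \<in> point_of \<delta> g) +++ geo_path X (pathfinish g) y)"
    using delta_rel_join[OF end_point_point_of(2)[OF g]] k by simp
  then have "point_of \<delta> (g +++ geo_path X (pathfinish g) y) =
      point_of \<delta> ((SOME g'. g' \<in> point_of \<delta> g) +++ geo_path X (pathfinish g) y)"
    using point_of_eq_iff paths_from_join[OF g k(1-3)] by blast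
  then show ?thesis by (simp add: extend_def end_point_point_of(1)[OF g])
qed

lemma jump_space_delta:
  assumes \<delta>: "\<delta> > 0"
  shows "jump_space X (2 * \<delta> / 3) (delta_points \<delta>) end_point (extend \<delta>)"
proof
  show "2 * \<delta> / 3 > 0" using \<delta> by simp
  fix c assume "c \<in> delta_points \<delta>"
  then obtain g where g: "g \<in> paths_from X b" "c = point_of \<delta> g" by (auto simp: delta_points_def)
  let ?x = "pathfinish g"
  have e: "end_point c = ?x" and x: "?x \<in> X" using g end_point_point_of pathfinish_in by auto
  show "end_point c \<in> X" using e x by simp
  note gp = geo_path[OF geo x]
  have ext: "extend \<delta> c y = point_of \<delta> (g +++ geo_path X ?x y)"
    "g +++ geo_path X ?x y \<in> paths_from X b" if "y \<in> X" for y
    using extend_point_of[OF g(1) that] g(2) paths_from_join[OF g(1)] gp[OF that] by auto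
  show "extend \<delta> c y \<in> delta_points \<delta>" "end_point (extend \<delta> c y) = y" if "y \<in> X" for y
    using ext[OF that] end_point_point_of(1)[OF ext(2)[OF that], of \<delta>] gp[OF that]
    by (auto simp: delta_points_def)
  \<comment> \<open>\<open>extend\<close> appends a geodesic even when the end point is kept; it is
    removed by comparison with the constant path.\<close>
  have const: "homotopic_paths X (g +++ (\<lambda>_. ?x)) g"
    using g by (intro homotopic_paths_join_const) (simp_all add: paths_from_iff)
  have "delta_rel \<delta> (g +++ geo_path X ?x ?x) (g +++ (\<lambda>_. ?x))"
    using gp[OF x] geo_path_subset_ball[OF geo x x, of \<delta>] x \<delta>
    by (intro delta_rel_small[OF g(1) x])
      (auto simp: path_def path_image_def pathstart_const pathfinish_const)
  moreover have "delta_rel \<delta> (g +++ (\<lambda>_. ?x)) g"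
    using delta_rel_sym[OF delta_rel_homotopic[OF g(1) homotopic_paths_sym[OF const]]] .
  ultimately have "delta_rel \<delta> (g +++ geo_path X ?x ?x) g" by (rule delta_rel_trans)
  then show "extend \<delta> c (end_point c) = c"
    using ext[OF x] e g point_of_eq_iff[OF ext(2)[OF x]] by simp
  fix y z assume y: "y \<in> X" and z: "z \<in> X" and d: "dist (end_point c) y < 2 * \<delta> / 3"
    "dist y z < 2 * \<delta> / 3" "dist (end_point c) z < 2 * \<delta> / 3"
  note d = d[unfolded e]
  let ?xy = "geo_path X ?x y" and ?yz = "geo_path X y z" and ?xz = "geo_path X ?x z"
  note yz = geo_path[OF geo y z]
  have "homotopic_paths X ((g +++ ?xy) +++ ?yz) (g +++ (?xy +++ ?yz))"
    using g gp[OF y] yz by (intro homotopic_paths_sym[OF homotopic_paths_assoc]) (simp_all add: paths_from_iff)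
  then have "delta_rel \<delta> ((g +++ ?xy) +++ ?yz) (g +++ (?xy +++ ?yz))"
    using paths_from_join[OF ext(2)[OF y]] yz gp[OF y] by (intro delta_rel_homotopic) auto
  moreover have "delta_rel \<delta> (g +++ (?xy +++ ?yz)) (g +++ ?xz)"
  proof (rule delta_rel_small[OF g(1) x])
    have "path_image ?xy \<subseteq> ball ?x \<delta>" using geo_path_subset_ball[OF geo x y] d \<delta> by auto
    moreover have "path_image ?yz \<subseteq> ball ?x \<delta>"
      using geo_path_opposite_subset_ball[OF geo y z] d by auto
    ultimately show "path_image (?xy +++ ?yz) \<subseteq> ball ?x \<delta>"
      using gp[OF y] yz by (simp add: path_image_join)
    show "path_image ?xz \<subseteq> ball ?x \<delta>" using geo_path_subset_ball[OF geo x z] d \<delta> by auto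
  qed (use gp[OF y] gp[OF z] yz in \<open>simp_all add: path_image_join\<close>)
  ultimately have "delta_rel \<delta> ((g +++ ?xy) +++ ?yz) (g +++ ?xz)" by (rule delta_rel_trans)
  moreover have "extend \<delta> (extend \<delta> c y) z = point_of \<delta> ((g +++ ?xy) +++ ?yz)"
    using extend_point_of[OF ext(2)[OF y] z] ext(1)[OF y] gp[OF y] by simp
  ultimately show "extend \<delta> (extend \<delta> c y) z = extend \<delta> c z"
    using ext[OF z] point_of_eq_iff paths_from_join[OF ext(2)[OF y] yz(1-2)] yz gp[OF y] by simp
qed

definition base_point :: "real \<Rightarrow> (real \<Rightarrow> 'a) set" where
  "base_point \<delta> = point_of \<delta> (\<lambda>_. b)"

lemma const_in_paths_from: "(\<lambda>_. b) \<in> paths_from X b"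
  using b_in by (auto simp: paths_from_iff path_def path_image_def pathstart_def)

lemma base_point: "base_point \<delta> \<in> delta_points \<delta>" "end_point (base_point \<delta>) = b"
  unfolding base_point_def delta_points_def
  using const_in_paths_from end_point_point_of(1)[OF const_in_paths_from] by (auto simp: pathfinish_const)

lemma point_of_eq_base_point:
  assumes g: "g \<in> loops_at X b"
  shows "point_of \<delta> g = base_point \<delta> \<longleftrightarrow> path_class X g \<in> delta_subgroup X b \<delta>"
proof -
  have gp: "g \<in> paths_from X b" using g by (simp add: loops_at_iff paths_from_iff)
  have "reversepath (\<lambda>_. b) = (\<lambda>_. b)" by (simp add: reversepath_def)
  moreover have "homotopic_paths X (g +++ (\<lambda>_. b)) g"
    using g by (intro homotopic_paths_join_const) (simp_all add: loops_at_iff)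
  ultimately have "path_class X (g +++ reversepath (\<lambda>_. b)) = path_class X g"
    by (simp add: path_class_eqI)
  then show ?thesis
    using g gp const_in_paths_from point_of_eq_iff[OF gp, of \<delta> "\<lambda>_. b"]
    by (simp add: base_point_def delta_rel_def loops_at_iff pathfinish_const)
qed

text \<open>The parameters \<open>u\<close> and \<open>v\<close> are linearly homotopic in the unit
  interval. This serves to split an initial piece of \<open>g\<close> at a time \<open>t\<close>,
  also when \<open>t\<close> lies beyond its end and the second part runs backwards.\<close>

lemma homotopic_paths_reparametrized:
  fixes u v :: "real \<Rightarrow> real"
  assumes g: "path g" "path_image g \<subseteq> X"
    and u: "path u" "path_image u \<subseteq> {0..1}" and v: "path v" "path_image v \<subseteq> {0..1}"
    and ends: "pathstart u = pathstart v" "pathfinish u = pathfinish v"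
  shows "homotopic_paths X (g \<circ> u) (g \<circ> v)"
proof (rule homotopic_paths_continuous_image)
  have "closed_segment (u t) (v t) \<subseteq> {0..1}" if "t \<in> {0..1}" for t
    using that u(2) v(2) unfolding path_image_def by (intro closed_segment_subset) blast+
  then show "homotopic_paths {0..1} u v" using u v ends by (intro homotopic_paths_linear) auto
qed (use g in \<open>auto simp: path_def path_image_def\<close>)

text \<open>The lift of \<open>g\<close> at time \<open>t\<close> is the class of the initial piece
  of \<open>g\<close> up to \<open>t\<close>.\<close>

lemma transports_delta:
  assumes \<delta>: "\<delta> > 0" and g: "g \<in> paths_from X b"
  shows "jump_space.transports (2 * \<delta> / 3) (delta_points \<delta>) end_point (extend \<delta>) g
    (base_point \<delta>) (point_of \<delta> g)"
proof -
  interpret jump_space X "2 * \<delta> / 3" "delta_points \<delta>" end_point "extend \<delta>"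
    by (rule jump_space_delta[OF \<delta>])
  define h where "h t = point_of \<delta> (g \<circ> linepath 0 t)" for t
  have pg: "path g" "path_image g \<subseteq> X" "pathstart g = b" using g by (auto simp: paths_from_iff)
  have seg: "path (g \<circ> linepath s t)" "path_image (g \<circ> linepath s t) \<subseteq> X"
    "pathstart (g \<circ> linepath s t) = g s" "pathfinish (g \<circ> linepath s t) = g t"
    "closed_segment s t \<subseteq> {0..1}"
    if "s \<in> {0..1}" "t \<in> {0..1}" for s t
  proof -
    show *: "closed_segment s t \<subseteq> {0..1}" using that by (intro closed_segment_subset) auto
    then have "continuous_on (path_image (linepath s t)) g"
      using pg(1) continuous_on_subset by (auto simp: path_def)
    then show "path (g \<circ> linepath s t)" by (rule path_continuous_image[OF path_linepath])
    show "path_image (g \<circ> linepath s t) \<subseteq> X"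
      using * pg(2) unfolding path_image_compose path_image_linepath by (auto simp: path_image_def)
  qed (simp_all add: pathstart_compose pathfinish_compose)
  have sub: "g \<circ> linepath 0 t \<in> paths_from X b" "pathfinish (g \<circ> linepath 0 t) = g t"
    if "t \<in> {0..1}" for t
    using seg[of 0 t] that pg(3) by (auto simp: paths_from_iff pathstart_def)
  have X: "g t \<in> X" if "t \<in> {0..1}" for t using that pg by (auto simp: path_image_def)
  have "lift_on {0..1} g h"
    unfolding lift_on_def
  proof (intro ballI conjI)
    fix t :: real assume t: "t \<in> {0..1}"
    show "h t \<in> delta_points \<delta>" "end_point (h t) = g t"
      using sub[OF t] end_point_point_of(1)[OF sub(1)[OF t]] by (auto simp: h_def delta_points_def)
    obtain \<eta> where \<eta>: "\<eta> > 0" "\<And>s. s \<in> {0..1} \<Longrightarrow> dist s t < \<eta> \<Longrightarrow> dist (g s) (g t) < 2 * \<delta> / 3"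
      using pg(1) t eps_pos unfolding path_def continuous_on_iff by metis
    have "dist (g t) (g s) < 2 * \<delta> / 3 \<and> h s = extend \<delta> (h t) (g s)"
      if s: "s \<in> {0..1}" "\<bar>s - t\<bar> < \<eta>" for s
    proof
      show d: "dist (g t) (g s) < 2 * \<delta> / 3"
        using \<eta>(2)[OF s(1)] s(2) by (simp add: dist_real_def dist_commute)
      note gp = geo_path[OF geo X[OF t] X[OF s(1)]]
      have ball: "path_image (g \<circ> linepath t s) \<subseteq> ball (g t) \<delta>"
      proof
        fix w assume "w \<in> path_image (g \<circ> linepath t s)"
        then obtain u where u: "u \<in> closed_segment t s" "w = g u"
          by (auto simp: path_image_compose)
        have "u \<in> {0..1}" "dist u t < \<eta>"
          using u(1) s t by (auto simp: closed_segment_eq_real_ivl dist_real_def split: if_splits)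
        then have "dist (g u) (g t) < 2 * \<delta> / 3" by (rule \<eta>(2))
        then show "w \<in> ball (g t) \<delta>" using u \<delta> by (simp add: dist_commute)
      qed
      have "homotopic_paths X (g \<circ> linepath 0 s) (g \<circ> (linepath 0 t +++ linepath t s))"
        using seg(5)[of 0 s] seg(5)[of 0 t] seg(5)[of t s] s(1) t
        by (intro homotopic_paths_reparametrized[OF pg(1,2)]) (auto simp: path_image_join)
      then have "homotopic_paths X (g \<circ> linepath 0 s) ((g \<circ> linepath 0 t) +++ (g \<circ> linepath t s))"
        by (simp add: path_compose_join)
      then have 1: "delta_rel \<delta> (g \<circ> linepath 0 s) ((g \<circ> linepath 0 t) +++ (g \<circ> linepath t s))"
        by (rule delta_rel_homotopic[OF sub(1)[OF s(1)]])
      \<comment> \<open>The short piece of \<open>g\<close> between \<open>t\<close> and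
        \<open>s\<close> and the geodesic with the same ends both lie in the ball of radius \<delta>
        around \<open>g t\<close>, so one may replace the other.\<close>
      have 2: "delta_rel \<delta> ((g \<circ> linepath 0 t) +++ (g \<circ> linepath t s))
          ((g \<circ> linepath 0 t) +++ geo_path X (g t) (g s))"
        using geo_path_subset_ball[OF geo X[OF t] X[OF s(1)], of \<delta>] d \<delta>
        by (intro delta_rel_small[OF sub(1)[OF t] X[OF t]])
          (simp_all add: gp seg[OF t s(1)] sub[OF t] ball)
      have "h s = point_of \<delta> ((g \<circ> linepath 0 t) +++ geo_path X (g t) (g s))"
        unfolding h_def using point_of_eq_iff[OF sub(1)[OF s(1)]] delta_rel_trans[OF 1 2] by simp
      then show "h s = extend \<delta> (h t) (g s)"
        unfolding h_def using extend_point_of[OF sub(1)[OF t] X[OF s(1)]] sub(2)[OF t] by simp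
    qed
    then show "\<exists>\<eta>>0. \<forall>s\<in>{0..1}. \<bar>s - t\<bar> < \<eta> \<longrightarrow>
        dist (g t) (g s) < 2 * \<delta> / 3 \<and> h s = extend \<delta> (h t) (g s)"
      using \<eta>(1) by blast
  qed
  moreover have "h 0 = base_point \<delta>"
  proof -
    have "g \<circ> linepath 0 0 = (\<lambda>_. b)" using pg(3) by (simp add: linepath_refl pathstart_def comp_def)
    then show ?thesis by (simp add: h_def base_point_def)
  qed
  moreover have "h 1 = point_of \<delta> g" by (simp add: h_def linepath_def comp_def)
  ultimately show ?thesis unfolding transports_def by blast
qed

text \<open>This is the existence that gives the choice in \<open>delta_cover\<close> its meaning.
  The lift of a loop from the base point ends at the class of the loop, which is the base point
  exactly when the loop represents an element of \<open>S\<^sub>\<delta>\<close>.\<close>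

lemma is_delta_cover_jump_topology:
  assumes \<delta>: "\<delta> > 0"
  shows "is_delta_cover X b \<delta>
    (jump_space.jump_topology X (delta_points \<delta>) end_point (extend \<delta>)) end_point (base_point \<delta>)"
proof -
  interpret jump_space X "2 * \<delta> / 3" "delta_points \<delta>" end_point "extend \<delta>"
    by (rule jump_space_delta[OF \<delta>])
  have surj: "end_point ` delta_points \<delta> = X"
  proof
    show "end_point ` delta_points \<delta> \<subseteq> X" using p_in by auto
    show "X \<subseteq> end_point ` delta_points \<delta>"
    proof
      fix x assume x: "x \<in> X"
      note g = geo_path[OF geo b_in x]
      have "geo_path X b x \<in> paths_from X b" using g by (simp add: paths_from_iff)
      then show "x \<in> end_point ` delta_points \<delta>"
        using end_point_point_of(1)[of "geo_path X b x" \<delta>] g(4) by (metis delta_points_def image_eqI)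
    qed
  qed
  have "path_component_of jump_topology (base_point \<delta>) c" if c: "c \<in> delta_points \<delta>" for c
  proof -
    obtain g where g: "g \<in> paths_from X b" "c = point_of \<delta> g" using c by (auto simp: delta_points_def)
    have "transports g (base_point \<delta>) c" unfolding g(2) by (rule transports_delta[OF \<delta> g(1)])
    moreover have "path g" using g(1) by (simp add: paths_from_iff)
    ultimately obtain h where "pathin jump_topology h" "h 0 = base_point \<delta>" "h 1 = c"
      using lifts_iff_transports by metis
    then show ?thesis unfolding path_component_of_def by blast
  qed
  then have "path_connected_space jump_topology"
    unfolding path_connected_space_iff_path_component topspace_jump_topology
    by (meson path_component_of_sym path_component_of_trans)
  then have conn: "connected_space jump_topology" by (rule path_connected_imp_connected_space)
  have "(\<exists>h. pathin jump_topology h \<and> h 0 = base_point \<delta> \<and> h 1 = base_point \<delta> \<and>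
      (\<forall>t\<in>{0..1}. end_point (h t) = g t)) \<longleftrightarrow> path_class X g \<in> delta_subgroup X b \<delta>"
    if g: "g \<in> loops_at X b" for g
  proof -
    have pg: "g \<in> paths_from X b" "path g" using g by (auto simp: loops_at_iff paths_from_iff)
    have "transports g (base_point \<delta>) (base_point \<delta>) \<longleftrightarrow> point_of \<delta> g = base_point \<delta>"
      using transports_delta[OF \<delta> pg(1)] transports_unique by metis
    then show ?thesis using lifts_iff_transports[OF pg(2)] point_of_eq_base_point[OF g] by simp
  qed
  then show ?thesis
    unfolding is_delta_cover_def
    using covering_map_jump_topology[OF surj] conn base_point by (auto simp: topspace_jump_topology)
qed

subsection \<open>The covering spectrum in terms of the groups \<open>S\<^sub>\<delta>\<close>\<close>

text \<open>An equivalence need not respect base points. A path \<open>k\<close> from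
  \<open>f\<close> to \<open>\<phi> e\<close> projects to a loop, and the conjugate of
  \<open>g\<close> by this loop lifts to a closed path at \<open>f\<close>; normality then gives the
  claim for \<open>g\<close> itself.\<close>

lemma equivalent_covers_subset:
  assumes C: "is_delta_cover X b \<delta> C p e" and D: "is_delta_cover X b \<delta>' D q f"
    and eq: "equivalent_covers C p D q"
  shows "delta_subgroup X b \<delta> \<subseteq> delta_subgroup X b \<delta>'"
proof
  fix P assume P: "P \<in> delta_subgroup X b \<delta>"
  then have "P \<in> carrier (fundamental_group X b)"
    using group.generate_in_carrier[OF group_fundamental_group[OF b_in] lassos_subset]
    by (auto simp: delta_subgroup_eq)
  then obtain g where g: "g \<in> loops_at X b" "P = path_class X g" by (auto simp: fundamental_group_def)
  obtain \<phi> where \<phi>: "homeomorphic_map C D \<phi>" "\<And>x. x \<in> topspace C \<Longrightarrow> q (\<phi> x) = p x"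
    using eq by (auto simp: equivalent_covers_def)
  obtain h where h: "pathin C h" "h 0 = e" "h 1 = e" "\<And>t. t \<in> {0..1} \<Longrightarrow> p (h t) = g t"
    using C g P unfolding is_delta_cover_def by blast
  have hC: "h t \<in> topspace C" if "t \<in> {0..1}" for t
    using path_image_subset_topspace[OF h(1)] that by auto
  have \<phi>h: "pathin D (\<phi> \<circ> h)"
    using h(1) \<phi>(1) by (intro pathin_compose) (auto simp: homeomorphic_imp_continuous_map)
  have qh: "q ((\<phi> \<circ> h) t) = g t" if "t \<in> {0..1}" for t using \<phi>(2)[OF hC[OF that]] h(4)[OF that] by simp
  have e: "e \<in> topspace C" "p e = b" and f: "f \<in> topspace D" "q f = b"
    using C D by (auto simp: is_delta_cover_def)
  have \<phi>e: "\<phi> e \<in> topspace D" "q (\<phi> e) = b"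
    using \<phi>(2)[OF e(1)] e homeomorphic_imp_surjective_map[OF \<phi>(1)] by auto
  have "path_connected_space D"
    by (rule path_connected_space_covering[OF _ locally_path_connected_geodesic[OF geo]])
      (use D in \<open>auto simp only: is_delta_cover_def\<close>)
  then obtain k where k: "pathin D k" "k 0 = f" "k 1 = \<phi> e"
    using f \<phi>e unfolding path_connected_space_def by blast
  \<comment> \<open>The path \<open>n\<close> runs along \<open>k\<close>, then along the image of
    the lift of \<open>g\<close>, and back along \<open>k\<close>, with the same bracketing as the
    join of loops below.\<close>
  define m where "m t = (if t \<le> 1/2 then k (2 * t) else (\<phi> \<circ> h) (2 * t - 1))" for t :: real
  define n where "n t = (if t \<le> 1/2 then m (2 * t) else k (1 - (2 * t - 1)))" for t :: real
  have m: "pathin D m" "m 0 = f" "m 1 = \<phi> e"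
    unfolding m_def using pathin_join[OF k(1) \<phi>h] h k by auto
  have n: "pathin D n" "n 0 = f" "n 1 = f"
    unfolding n_def using pathin_join[OF m(1) pathin_reverse[OF k(1)]] m k by auto
  have qk: "q \<circ> k \<in> loops_at X b"
  proof -
    have "continuous_map D (top_of_set X) q" using D by (simp add: is_delta_cover_def covering_map_def)
    then have "pathin (top_of_set X) (q \<circ> k)" by (rule pathin_compose[OF k(1)])
    then show ?thesis
      using k f \<phi>e
      by (auto simp: loops_at_iff pathin_canon_iff path_image_def pathstart_def pathfinish_def)
  qed
  have "q (n t) = (((q \<circ> k) +++ g) +++ reversepath (q \<circ> k)) t" if "t \<in> {0..1}" for t
    using that qh[of "4 * t - 1"]
    by (auto simp: n_def m_def joinpaths_def reversepath_def algebra_simps)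
  moreover have "((q \<circ> k) +++ g) +++ reversepath (q \<circ> k) \<in> loops_at X b"
    using g qk by (intro loops_at_join loops_at_reversepath)
  ultimately have "path_class X (((q \<circ> k) +++ g) +++ reversepath (q \<circ> k)) \<in> delta_subgroup X b \<delta>'"
    using D n unfolding is_delta_cover_def by blast
  then show "P \<in> delta_subgroup X b \<delta>'"
    using delta_subgroup_closed(4)[OF b_in qk g(1)] g(2) by simp
qed

lemma equivalent_covers_sym:
  assumes "equivalent_covers C p D q"
  shows "equivalent_covers D q C p"
proof -
  obtain h where h: "homeomorphic_map C D h" "\<And>x. x \<in> topspace C \<Longrightarrow> q (h x) = p x"
    using assms by (auto simp: equivalent_covers_def)
  then obtain h' where h': "homeomorphic_maps C D h h'" by (auto simp: homeomorphic_map_maps)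
  then have "homeomorphic_map D C h'" using homeomorphic_maps_map by blast
  moreover have "p (h' y) = q y" if "y \<in> topspace D" for y
  proof -
    have "h' y \<in> topspace C" "h (h' y) = y"
      using h' that by (auto simp: homeomorphic_maps_def continuous_map_def)
    then show ?thesis using h(2)[of "h' y"] by simp
  qed
  ultimately show ?thesis by (auto simp: equivalent_covers_def)
qed

lemma equivalent_covers_refl: "equivalent_covers C p C p"
  unfolding equivalent_covers_def by (rule exI[of _ id]) simp

lemma is_delta_cover_delta_cover:
  assumes "\<delta> > 0" "delta_cover X b \<delta> = (C, p, e)"
  shows "is_delta_cover X b \<delta> C p e"
proof -
  let ?P = "\<lambda>z :: (real \<Rightarrow> 'a) set topology \<times> ((real \<Rightarrow> 'a) set \<Rightarrow> 'a) \<times> (real \<Rightarrow> 'a) set.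
     case z of (C, p, e) \<Rightarrow> is_delta_cover X b \<delta> C p e"
  have "?P (jump_space.jump_topology X (delta_points \<delta>) end_point (extend \<delta>), end_point, base_point \<delta>)"
    using is_delta_cover_jump_topology[OF assms(1)] by (simp only: prod.case)
  then have "?P (SOME z. ?P z)" by (rule someI[of ?P])
  then show ?thesis unfolding delta_cover_def[symmetric] assms(2) by (simp only: prod.case)
qed

text \<open>If the groups agree, then both covers are chosen by the same predicate and are literally
  equal. If the covers are equivalent, each group contains the other.\<close>

lemma covering_spectrum_iff:
  "\<delta> \<in> covering_spectrum X b \<longleftrightarrow>
     \<delta> > 0 \<and> (\<forall>\<delta>'>\<delta>. delta_subgroup X b \<delta> \<noteq> delta_subgroup X b \<delta>')"
proof -
  have "(case delta_cover X b \<delta> of (C, p, _) \<Rightarrow> case delta_cover X b \<delta>' of (D, q, _) \<Rightarrow>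
      equivalent_covers C p D q) \<longleftrightarrow> delta_subgroup X b \<delta> = delta_subgroup X b \<delta>'"
    if pos: "\<delta> > 0" "\<delta>' > 0" for \<delta>'
  proof -
    obtain C p e where C: "delta_cover X b \<delta> = (C, p, e)" by (metis prod_cases3)
    obtain D q f where D: "delta_cover X b \<delta>' = (D, q, f)" by (metis prod_cases3)
    note c = is_delta_cover_delta_cover[OF pos(1) C] and d = is_delta_cover_delta_cover[OF pos(2) D]
    have "equivalent_covers C p D q \<longleftrightarrow> delta_subgroup X b \<delta> = delta_subgroup X b \<delta>'"
    proof
      assume "equivalent_covers C p D q"
      then show "delta_subgroup X b \<delta> = delta_subgroup X b \<delta>'"
        using equivalent_covers_subset[OF c d] equivalent_covers_subset[OF d c]
          equivalent_covers_sym by blast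
    next
      assume "delta_subgroup X b \<delta> = delta_subgroup X b \<delta>'"
      then have "delta_cover X b \<delta> = delta_cover X b \<delta>'"
        by (simp add: delta_cover_def is_delta_cover_def)
      then show "equivalent_covers C p D q" using C D equivalent_covers_refl by simp
    qed
    then show ?thesis using C D by simp
  qed
  then have *: "(case delta_cover X b \<delta> of (C, p, _) \<Rightarrow> case delta_cover X b \<delta>' of (D, q, _) \<Rightarrow>
      \<not> equivalent_covers C p D q) \<longleftrightarrow> delta_subgroup X b \<delta> \<noteq> delta_subgroup X b \<delta>'"
    if "\<delta> > 0" "\<delta>' > \<delta>" for \<delta>'
    using that by (simp add: case_prod_beta)
  show ?thesis
    unfolding covering_spectrum_def mem_Collect_eq by (intro conj_cong all_cong *) (rule refl)
qed

end

section \<open>Homotopy classes of chains as a jump space\<close>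

lemma eps_chain_snoc:
  "xs \<noteq> [] \<Longrightarrow> eps_chain X \<epsilon> (xs @ [y]) \<longleftrightarrow> eps_chain X \<epsilon> xs \<and> y \<in> X \<and> dist (last xs) y < \<epsilon>"
  by (auto simp: eps_chain_def successively_append_iff)

lemma eps_chain_mono: "eps_chain X \<epsilon> xs \<Longrightarrow> \<epsilon> \<le> \<delta> \<Longrightarrow> eps_chain X \<delta> xs"
  unfolding eps_chain_def by (auto elim!: successively_mono)

lemma eps_step_sym: "eps_step X \<epsilon> xs ys \<Longrightarrow> eps_step X \<epsilon> ys xs"
  unfolding eps_step_def by metis

lemma eps_stepD:
  assumes "eps_step X \<epsilon> xs ys"
  shows "eps_chain X \<epsilon> xs" "eps_chain X \<epsilon> ys" "hd xs = hd ys" "last xs = last ys"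
  using assms unfolding eps_step_def by blast+

lemma eps_step_snoc:
  assumes "eps_step X \<epsilon> xs ys" "y \<in> X" "dist (last xs) y < \<epsilon>"
  shows "eps_step X \<epsilon> (xs @ [y]) (ys @ [y])"
proof -
  have ne: "xs \<noteq> []" "ys \<noteq> []" and ch: "eps_chain X \<epsilon> xs" "eps_chain X \<epsilon> ys"
    "hd xs = hd ys" "last xs = last ys"
    using assms(1) by (auto simp: eps_step_def eps_chain_def)
  obtain us z vs where "xs = us @ vs \<and> ys = us @ z # vs \<or> xs = us @ z # vs \<and> ys = us @ vs"
    using assms(1) by (auto simp: eps_step_def)
  then have "xs @ [y] = us @ (vs @ [y]) \<and> ys @ [y] = us @ z # (vs @ [y]) \<or>
     xs @ [y] = us @ z # (vs @ [y]) \<and> ys @ [y] = us @ (vs @ [y])" by auto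
  then have "\<exists>us z vs. xs @ [y] = us @ vs \<and> ys @ [y] = us @ z # vs \<or>
     xs @ [y] = us @ z # vs \<and> ys @ [y] = us @ vs" by blast
  moreover have "eps_chain X \<epsilon> (xs @ [y])" "eps_chain X \<epsilon> (ys @ [y])" "hd (xs @ [y]) = hd (ys @ [y])"
    using ne ch assms(2,3) by (auto simp: eps_chain_snoc)
  ultimately show ?thesis unfolding eps_step_def by simp
qed

lemma eps_homotopic_refl: "eps_chain X \<epsilon> xs \<Longrightarrow> eps_homotopic X \<epsilon> xs xs"
  by (simp add: eps_homotopic_def)

lemma eps_homotopic_trans:
  "eps_homotopic X \<epsilon> xs ys \<Longrightarrow> eps_homotopic X \<epsilon> ys zs \<Longrightarrow> eps_homotopic X \<epsilon> xs zs"
  by (auto simp: eps_homotopic_def)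

lemma eps_homotopic_step: "eps_step X \<epsilon> xs ys \<Longrightarrow> eps_homotopic X \<epsilon> xs ys"
  by (simp add: eps_homotopic_def eps_stepD(1) r_into_rtranclp)

lemma eps_homotopicD:
  assumes "eps_homotopic X \<epsilon> xs ys"
  shows "eps_chain X \<epsilon> ys" "hd xs = hd ys" "last xs = last ys" "eps_homotopic X \<epsilon> ys xs"
proof -
  have "(eps_step X \<epsilon>)\<^sup>*\<^sup>* xs ys" "eps_chain X \<epsilon> xs" using assms by (auto simp: eps_homotopic_def)
  then have "eps_chain X \<epsilon> ys \<and> hd xs = hd ys \<and> last xs = last ys \<and> eps_homotopic X \<epsilon> ys xs"
  proof induction
    case (step y z)
    then have "eps_homotopic X \<epsilon> z y" using eps_homotopic_step eps_step_sym by blast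
    then show ?case using step eps_homotopic_trans eps_stepD[OF step(2)] by metis
  qed (simp add: eps_homotopic_refl)
  then show "eps_chain X \<epsilon> ys" "hd xs = hd ys" "last xs = last ys" "eps_homotopic X \<epsilon> ys xs"
    by auto
qed

lemma eps_homotopic_snoc:
  assumes "eps_homotopic X \<epsilon> xs ys" "y \<in> X" "dist (last xs) y < \<epsilon>"
  shows "eps_homotopic X \<epsilon> (xs @ [y]) (ys @ [y])"
proof -
  have ch: "(eps_step X \<epsilon>)\<^sup>*\<^sup>* xs ys" "eps_chain X \<epsilon> xs" "xs \<noteq> []"
    using assms(1) by (auto simp: eps_homotopic_def eps_chain_def)
  from ch(1) have "(eps_step X \<epsilon>)\<^sup>*\<^sup>* (xs @ [y]) (ys @ [y]) \<and> last xs = last ys"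
  proof induction
    case (step y' z)
    then have "eps_step X \<epsilon> (y' @ [y]) (z @ [y])" using assms by (intro eps_step_snoc) auto
    then show ?case using step eps_stepD(4)[OF step(2)] by (auto intro: rtranclp.rtrancl_into_rtrancl)
  qed simp
  then show ?thesis using ch assms by (simp add: eps_homotopic_def eps_chain_snoc)
qed

definition chain_class :: "'a::metric_space set \<Rightarrow> real \<Rightarrow> 'a list \<Rightarrow> 'a list set" where
  "chain_class X \<epsilon> xs = {ys. eps_homotopic X \<epsilon> xs ys}"

definition chain_classes :: "'a::metric_space set \<Rightarrow> 'a \<Rightarrow> real \<Rightarrow> 'a list set set" where
  "chain_classes X b \<epsilon> = chain_class X \<epsilon> ` {xs. eps_chain X \<epsilon> xs \<and> hd xs = b}"

definition chain_end :: "'a list set \<Rightarrow> 'a" where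
  "chain_end c = last (SOME xs. xs \<in> c)"

definition chain_extend :: "'a::metric_space set \<Rightarrow> real \<Rightarrow> 'a list set \<Rightarrow> 'a \<Rightarrow> 'a list set" where
  "chain_extend X \<epsilon> c y = chain_class X \<epsilon> ((SOME xs. xs \<in> c) @ [y])"

lemma chain_class_eq_iff:
  assumes "eps_chain X \<epsilon> xs"
  shows "chain_class X \<epsilon> xs = chain_class X \<epsilon> ys \<longleftrightarrow> eps_homotopic X \<epsilon> xs ys"
proof
  assume "chain_class X \<epsilon> xs = chain_class X \<epsilon> ys"
  moreover have "xs \<in> chain_class X \<epsilon> xs" using assms by (simp add: chain_class_def eps_homotopic_refl)
  ultimately have "eps_homotopic X \<epsilon> ys xs" by (auto simp: chain_class_def)
  then show "eps_homotopic X \<epsilon> xs ys" by (rule eps_homotopicD)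
next
  assume "eps_homotopic X \<epsilon> xs ys"
  then have "eps_homotopic X \<epsilon> xs zs \<longleftrightarrow> eps_homotopic X \<epsilon> ys zs" for zs
    by (meson eps_homotopicD(4) eps_homotopic_trans)
  then show "chain_class X \<epsilon> xs = chain_class X \<epsilon> ys" by (simp add: chain_class_def)
qed

lemma chain_end_class:
  assumes "eps_chain X \<epsilon> xs"
  shows "chain_end (chain_class X \<epsilon> xs) = last xs"
    and "eps_homotopic X \<epsilon> xs (SOME ys. ys \<in> chain_class X \<epsilon> xs)"
proof -
  have "xs \<in> chain_class X \<epsilon> xs" using assms by (simp add: chain_class_def eps_homotopic_refl)
  then have "(SOME ys. ys \<in> chain_class X \<epsilon> xs) \<in> chain_class X \<epsilon> xs"
    by (rule someI[of "\<lambda>ys. ys \<in> chain_class X \<epsilon> xs"])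
  then show *: "eps_homotopic X \<epsilon> xs (SOME ys. ys \<in> chain_class X \<epsilon> xs)"
    by (simp add: chain_class_def)
  show "chain_end (chain_class X \<epsilon> xs) = last xs"
    using eps_homotopicD(3)[OF *] by (simp add: chain_end_def)
qed

lemma chain_extend_class:
  assumes "eps_chain X \<epsilon> xs" "y \<in> X" "dist (last xs) y < \<epsilon>"
  shows "chain_extend X \<epsilon> (chain_class X \<epsilon> xs) y = chain_class X \<epsilon> (xs @ [y])"
proof -
  have "xs \<noteq> []" using assms by (auto simp: eps_chain_def)
  then have "eps_chain X \<epsilon> (xs @ [y])" using assms by (simp add: eps_chain_snoc)
  then show ?thesis
    using eps_homotopic_snoc[OF chain_end_class(2)[OF assms(1)] assms(2,3)]
      chain_class_eq_iff unfolding chain_extend_def by blast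
qed

text \<open>The two laws are elementary steps at the end of a chain: removing a repeated last point,
  and removing the point before the last one.\<close>

lemma jump_space_chain:
  assumes "\<epsilon> > 0"
  shows "jump_space X \<epsilon> (chain_classes X b \<epsilon>) chain_end (chain_extend X \<epsilon>)"
proof
  show "\<epsilon> > 0" by fact
  fix c assume "c \<in> chain_classes X b \<epsilon>"
  then obtain xs where xs: "c = chain_class X \<epsilon> xs" "eps_chain X \<epsilon> xs" "hd xs = b"
    by (auto simp: chain_classes_def)
  then have ne: "xs \<noteq> []" by (auto simp: eps_chain_def)
  have e: "chain_end c = last xs" using xs chain_end_class by simp
  show "chain_end c \<in> X" using e xs ne last_in_set[OF ne] by (auto simp: eps_chain_def)
  have ext: "eps_chain X \<epsilon> (xs @ [y])" "chain_extend X \<epsilon> c y = chain_class X \<epsilon> (xs @ [y])"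
    if "y \<in> X" "dist (chain_end c) y < \<epsilon>" for y
    using that xs ne e by (auto simp: eps_chain_snoc chain_extend_class)
  show "chain_extend X \<epsilon> c y \<in> chain_classes X b \<epsilon>" "chain_end (chain_extend X \<epsilon> c y) = y"
    if "y \<in> X" "dist (chain_end c) y < \<epsilon>" for y
    using ext[OF that] xs ne chain_end_class(1)[OF ext(1)[OF that]]
    by (auto simp: chain_classes_def)
  have self: "last xs \<in> X" "dist (chain_end c) (last xs) < \<epsilon>"
    using e \<open>chain_end c \<in> X\<close> assms by auto
  have "eps_step X \<epsilon> (xs @ [last xs]) xs"
    unfolding eps_step_def
    using ext(1)[OF self] xs(2) ne
    by (intro conjI exI[of _ xs] exI[of _ "last xs"] exI[of _ "[]"]) auto
  then show "chain_extend X \<epsilon> c (chain_end c) = c"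
    using ext[OF self] chain_class_eq_iff eps_homotopic_step xs(1) e by metis
  fix y z assume y: "y \<in> X" "dist (chain_end c) y < \<epsilon>" and z: "z \<in> X" "dist (chain_end c) z < \<epsilon>"
    and yz: "dist y z < \<epsilon>"
  have ch: "eps_chain X \<epsilon> ((xs @ [y]) @ [z])" using ext(1)[OF y] z yz by (simp add: eps_chain_def successively_append_iff)
  have "eps_step X \<epsilon> ((xs @ [y]) @ [z]) (xs @ [z])"
    unfolding eps_step_def using ch ext(1)[OF z] ne
    by (intro conjI exI[of _ xs] exI[of _ y] exI[of _ "[z]"]) auto
  then have "chain_class X \<epsilon> ((xs @ [y]) @ [z]) = chain_class X \<epsilon> (xs @ [z])"
    using chain_class_eq_iff[OF ch] eps_homotopic_step by blast
  then show "chain_extend X \<epsilon> (chain_extend X \<epsilon> c y) z = chain_extend X \<epsilon> c z"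
    using ext[OF y] ext[OF z] chain_extend_class[OF ext(1)[OF y] z(1)] yz by simp
qed

lemma run_chain_class:
  assumes "eps_chain X \<epsilon> (b # ys)"
  shows "foldl (chain_extend X \<epsilon>) (chain_class X \<epsilon> [b]) ys = chain_class X \<epsilon> (b # ys)"
  using assms
proof (induction ys rule: rev_induct)
  case (snoc y ys)
  then have "eps_chain X \<epsilon> (b # ys)" "y \<in> X" "dist (last (b # ys)) y < \<epsilon>"
    using eps_chain_snoc[of "b # ys" X \<epsilon> y] by auto
  then show ?case using snoc.IH chain_extend_class[of X \<epsilon> "b # ys" y] by simp
qed simp

lemma base_class:
  assumes "b \<in> X"
  shows "chain_class X \<epsilon> [b] \<in> chain_classes X b \<epsilon>" "chain_end (chain_class X \<epsilon> [b]) = b"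
  using assms chain_end_class(1)[of X \<epsilon> "[b]"] by (auto simp: chain_classes_def eps_chain_def)

text \<open>Running along a chain from the class of \<open>[b]\<close> leads to the class of that
  chain. So in this jump space, trivial action at a single point already detects null loops.\<close>

lemma eps_null_iff_run:
  assumes "eps_chain X \<epsilon> (b # ys)"
  shows "eps_null X b \<epsilon> (b # ys) \<longleftrightarrow>
     foldl (chain_extend X \<epsilon>) (chain_class X \<epsilon> [b]) ys = chain_class X \<epsilon> [b]"
  unfolding eps_null_def run_chain_class[OF assms] using chain_class_eq_iff[OF assms] by simp

section \<open>Null loops of chains and the groups \<open>S\<^sub>\<delta>\<close>\<close>

text \<open>The list omits the starting point \<open>b\<close>. The joins are nested to the left, as
  in a run along the chain, so that appending a point appends one geodesic.\<close>

definition realize :: "'a::metric_space set \<Rightarrow> 'a \<Rightarrow> 'a list \<Rightarrow> real \<Rightarrow> 'a" where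
  "realize X b ys = foldl (\<lambda>g y. g +++ geo_path X (pathfinish g) y) (\<lambda>_. b) ys"

lemma (in pointed_geodesic_space) realize:
  assumes "set ys \<subseteq> X"
  shows "realize X b ys \<in> paths_from X b" "pathfinish (realize X b ys) = last (b # ys)"
    "point_of \<delta> (realize X b ys) = foldl (extend \<delta>) (base_point \<delta>) ys"
proof -
  have "realize X b ys \<in> paths_from X b \<and> pathfinish (realize X b ys) = last (b # ys) \<and>
    point_of \<delta> (realize X b ys) = foldl (extend \<delta>) (base_point \<delta>) ys"
    using assms
  proof (induction ys rule: rev_induct)
    case Nil
    then show ?case
      using const_in_paths_from by (simp add: realize_def base_point_def pathfinish_const)
  next
    case (snoc y ys)
    let ?g = "realize X b ys"
    have g: "?g \<in> paths_from X b" "pathfinish ?g = last (b # ys)"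
      "point_of \<delta> ?g = foldl (extend \<delta>) (base_point \<delta>) ys" and y: "y \<in> X"
      using snoc by auto
    note k = geo_path[OF geo pathfinish_in[OF g(1)] y]
    have "realize X b (ys @ [y]) = ?g +++ geo_path X (pathfinish ?g) y" by (simp add: realize_def)
    then show ?case
      using paths_from_join[OF g(1) k(1-3)] k extend_point_of[OF g(1) y, of \<delta>] g(3) by simp
  qed
  then show "realize X b ys \<in> paths_from X b" "pathfinish (realize X b ys) = last (b # ys)"
    "point_of \<delta> (realize X b ys) = foldl (extend \<delta>) (base_point \<delta>) ys" by auto
qed

context jump_space
begin

text \<open>A geodesic between consecutive points stays within \<epsilon> of its start, so transport
  along it is a single jump.\<close>

lemma transports_realize:
  assumes geo: "geodesic_space X" and c: "c \<in> A"
    and ys: "set ys \<subseteq> X" "successively (\<lambda>x y. dist x y < \<epsilon>) (p c # ys)"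
  shows "transports (realize X (p c) ys) c (foldl act c ys)"
proof -
  interpret pointed_geodesic_space X "p c" by standard (use geo p_in c in auto)
  show ?thesis
    using ys
  proof (induction ys rule: rev_induct)
    case Nil
    then show ?case using transports_const[OF c] by (simp add: realize_def)
  next
    case (snoc y ys)
    let ?g = "realize X (p c) ys" and ?d = "foldl act c ys"
    have s: "set ys \<subseteq> X" "y \<in> X" "successively (\<lambda>x y. dist x y < \<epsilon>) (p c # ys)"
      "dist (last (p c # ys)) y < \<epsilon>"
      using snoc.prems successively_append_iff[of "\<lambda>x y. dist x y < \<epsilon>" "p c # ys" "[y]"] by auto
    note d = run_chain[OF c s(1,3)]
    have g: "path ?g" "path_image ?g \<subseteq> X" "pathfinish ?g = p ?d"
      using realize[OF s(1)] d by (auto simp: paths_from_iff)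
    note k = geo_path[OF geo p_in[OF d(1)] s(2)]
    have "dist (p ?d) (geo_path X (p ?d) y t) < \<epsilon>" if "t \<in> {0..1}" for t
      using k(6)[OF that] s(4)[folded d(2)] zero_le_dist[of "geo_path X (p ?d) y t" y] by linarith
    then have "transports (geo_path X (p ?d) y) ?d (act ?d y)"
      using transports_small_path[of "geo_path X (p ?d) y" ?d] k d by simp
    then have "transports (?g +++ geo_path X (p ?d) y) c (act ?d y)"
      using snoc.IH s g k by (intro transports_join[of ?g c ?d]) auto
    then show ?case using g(3) by (simp add: realize_def)
  qed
qed

text \<open>On a short interval around \<open>x\<close> the local condition describes only jumps
  that start at \<open>x\<close>. The chain therefore goes from \<open>g a\<close> back to
  \<open>g x\<close>, undoing one such jump, and on to \<open>g b\<close>.\<close>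

lemma lift_follows_chain:
  assumes h: "lift_on {0..1} g h"
  obtains ys where "set ys \<subseteq> X" "successively (\<lambda>x y. dist x y < \<epsilon>) (g 0 # ys)"
    "last (g 0 # ys) = g 1" "foldl act (h 0) ys = h 1"
proof -
  define P where "P a b \<longleftrightarrow> (0 \<le> a \<longrightarrow> b \<le> 1 \<longrightarrow> (\<exists>ys. set ys \<subseteq> X \<and>
    successively (\<lambda>x y. dist x y < \<epsilon>) (g a # ys) \<and> last (g a # ys) = g b \<and> foldl act (h a) ys = h b))"
    for a b :: real
  have "(0::real) \<le> 1" by simp
  then have "P 0 1"
  proof (induction rule: Bolzano[where P = P])
    case (trans a b c)
    show ?case unfolding P_def
    proof (intro impI)
      assume "0 \<le> a" "c \<le> 1"
      then obtain ys zs where ys: "set ys \<subseteq> X" "successively (\<lambda>x y. dist x y < \<epsilon>) (g a # ys)"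
          "last (g a # ys) = g b" "foldl act (h a) ys = h b"
        and zs: "set zs \<subseteq> X" "successively (\<lambda>x y. dist x y < \<epsilon>) (g b # zs)"
          "last (g b # zs) = g c" "foldl act (h b) zs = h c"
        using trans unfolding P_def by (meson order_trans)
      have "successively (\<lambda>x y. dist x y < \<epsilon>) ((g a # ys) @ zs)"
        using ys zs unfolding successively_append_iff by (cases zs) auto
      moreover have "last (g a # ys @ zs) = g c" using ys(3) zs(3) by (cases zs) auto
      ultimately show "\<exists>ys. set ys \<subseteq> X \<and> successively (\<lambda>x y. dist x y < \<epsilon>) (g a # ys) \<and>
          last (g a # ys) = g c \<and> foldl act (h a) ys = h c"
        using ys zs by (intro exI[of _ "ys @ zs"]) simp
    qed
  next
    case (local x)
    then have x: "x \<in> {0..1}" by simp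
    obtain \<eta> where \<eta>: "\<eta> > 0"
      "\<And>s. s \<in> {0..1} \<Longrightarrow> \<bar>s - x\<bar> < \<eta> \<Longrightarrow> dist (g x) (g s) < \<epsilon> \<and> h s = act (h x) (g s)"
      using lift_onE[OF h x] by blast
    have "P a b" if ab: "a \<le> x \<and> x \<le> b \<and> b - a < \<eta>" for a b
      unfolding P_def
    proof (intro impI)
      assume "0 \<le> a" "b \<le> 1"
      then have a: "a \<in> {0..1}" "\<bar>a - x\<bar> < \<eta>" and b: "b \<in> {0..1}" "\<bar>b - x\<bar> < \<eta>" using ab by auto
      note hx = lift_onD[OF h x] and A = \<eta>(2)[OF a] and B = \<eta>(2)[OF b]
      have "act (h a) (g x) = h x"
        using act_back[of "h x" "g a"] hx A lift_onD[OF h a(1)] by auto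
      then show "\<exists>ys. set ys \<subseteq> X \<and> successively (\<lambda>x y. dist x y < \<epsilon>) (g a # ys) \<and>
          last (g a # ys) = g b \<and> foldl act (h a) ys = h b"
        using A B hx lift_onD[OF h b(1)] by (intro exI[of _ "[g x, g b]"]) (simp add: dist_commute)
    qed
    then show ?case using \<eta>(1) by blast
  qed
  then show thesis using that unfolding P_def by auto
qed

end

context pointed_geodesic_space
begin

lemma realize_in_delta_subgroup_iff:
  assumes \<epsilon>: "\<epsilon> > 0" and ys: "eps_chain X \<epsilon> (b # ys)" "last (b # ys) = b"
  shows "path_class X (realize X b ys) \<in> delta_subgroup X b (3 * \<epsilon> / 2) \<longleftrightarrow> eps_null X b \<epsilon> (b # ys)"
proof
  have sX: "set ys \<subseteq> X" and suc: "successively (\<lambda>x y. dist x y < \<epsilon>) (b # ys)"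
    using ys by (auto simp: eps_chain_def)
  note r = realize[OF sX]
  have loop: "realize X b ys \<in> loops_at X b" using r(1,2) ys(2) by (simp add: paths_from_iff loops_at_iff)
  show "eps_null X b \<epsilon> (b # ys)" if S: "path_class X (realize X b ys) \<in> delta_subgroup X b (3 * \<epsilon> / 2)"
  proof -
    interpret jump_space X \<epsilon> "chain_classes X b \<epsilon>" chain_end "chain_extend X \<epsilon>"
      by (rule jump_space_chain[OF \<epsilon>])
    let ?e = "chain_class X \<epsilon> [b]"
    note e = base_class[OF b_in, of \<epsilon>]
    \<comment> \<open>Transport along the realized loop is trivial, as its class lies in
      \<open>S\<^sub>\<delta>\<close>, and it is also the run along the chain.\<close>
    have "realize X b ys \<in> path_class X (realize X b ys)"
      using loop by (simp add: path_class_def loops_at_iff)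
    then have "transports (realize X b ys) ?e ?e"
      using transports_delta_subgroup[OF geo b_in S _ e] by blast
    moreover have "transports (realize X b ys) ?e (foldl (chain_extend X \<epsilon>) ?e ys)"
      using transports_realize[OF geo e(1) sX] e(2) suc by simp
    ultimately show ?thesis
      using transports_unique eps_null_iff_run[OF ys(1)] by metis
  qed
  show "path_class X (realize X b ys) \<in> delta_subgroup X b (3 * \<epsilon> / 2)" if null: "eps_null X b \<epsilon> (b # ys)"
  proof -
    let ?\<delta> = "3 * \<epsilon> / 2"
    have *: "2 * ?\<delta> / 3 = \<epsilon>" by simp
    interpret jump_space X \<epsilon> "delta_points ?\<delta>" end_point "extend ?\<delta>"
      using jump_space_delta[of ?\<delta>] \<epsilon> unfolding * by simp
    note e = base_point[of ?\<delta>]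
    have "foldl (extend ?\<delta>) (base_point ?\<delta>) (b # ys) = foldl (extend ?\<delta>) (base_point ?\<delta>) [b]"
      using null e by (intro run_eps_homotopic) (auto simp: eps_null_def)
    then have "foldl (extend ?\<delta>) (base_point ?\<delta>) ys = base_point ?\<delta>"
      using act_self[OF e(1)] e(2) by simp
    then show ?thesis using point_of_eq_base_point[OF loop] r(3) by simp
  qed
qed

lemma delta_rel_mono: "delta_rel \<delta> g g' \<Longrightarrow> \<delta> \<le> \<delta>' \<Longrightarrow> delta_rel \<delta>' g g'"
  using delta_subgroup_mono[OF b_in] by (auto simp: delta_rel_def)

text \<open>One chain serves all \<delta> from 3\<epsilon>/2 on: it represents the same point as
  \<open>g\<close> for the smallest of these values, and the relation persists because the groups
  increase with \<delta>. Later one chain has to be tested at two scales.\<close>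

lemma loop_approximation:
  assumes \<epsilon>: "\<epsilon> > 0" and g: "g \<in> loops_at X b"
  obtains ys where "eps_chain X \<epsilon> (b # ys)" "last (b # ys) = b"
    "\<And>\<delta>. \<delta> \<ge> 3 * \<epsilon> / 2 \<Longrightarrow>
      path_class X (realize X b ys) \<in> delta_subgroup X b \<delta> \<longleftrightarrow> path_class X g \<in> delta_subgroup X b \<delta>"
proof -
  let ?\<delta> = "3 * \<epsilon> / 2"
  have *: "2 * ?\<delta> / 3 = \<epsilon>" by simp
  interpret jump_space X \<epsilon> "delta_points ?\<delta>" end_point "extend ?\<delta>"
    using jump_space_delta[of ?\<delta>] \<epsilon> unfolding * by simp
  have gp: "g \<in> paths_from X b" and g01: "g 0 = b" "g 1 = b"
    using g by (auto simp: loops_at_iff paths_from_iff pathstart_def pathfinish_def)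
  obtain h where h: "lift_on {0..1} g h" "h 0 = base_point ?\<delta>" "h 1 = point_of ?\<delta> g"
    using transports_delta[of ?\<delta> g] \<epsilon> gp unfolding * transports_def by auto
  obtain ys where ys: "set ys \<subseteq> X" "successively (\<lambda>x y. dist x y < \<epsilon>) (g 0 # ys)"
    "last (g 0 # ys) = g 1" "foldl (extend ?\<delta>) (h 0) ys = h 1"
    using lift_follows_chain[OF h(1)] by metis
  note r = realize[OF ys(1)]
  have loop: "realize X b ys \<in> loops_at X b"
    using r(1,2) ys(3) g01 by (simp add: paths_from_iff loops_at_iff)
  have "point_of ?\<delta> (realize X b ys) = point_of ?\<delta> g" using r(3) ys(4) h by simp
  then have rel: "delta_rel ?\<delta> (realize X b ys) g" using point_of_eq_iff[OF r(1)] by blast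
  have "path_class X (realize X b ys) \<in> delta_subgroup X b \<delta> \<longleftrightarrow> path_class X g \<in> delta_subgroup X b \<delta>"
    if "\<delta> \<ge> ?\<delta>" for \<delta>
  proof -
    have "point_of \<delta> (realize X b ys) = point_of \<delta> g"
      using point_of_eq_iff[OF r(1)] delta_rel_mono[OF rel that] by blast
    then show ?thesis using point_of_eq_base_point[OF loop] point_of_eq_base_point[OF g] by metis
  qed
  moreover have "eps_chain X \<epsilon> (b # ys)" "last (b # ys) = b"
    using ys g01 b_in by (auto simp: eps_chain_def)
  ultimately show thesis using that by blast
qed

end

section \<open>Compactness\<close>

context jump_space
begin

text \<open>The runs along two nearby chains stay one short jump apart. The jump from the current
  point of \<open>xs'\<close> to the next point of either chain is shorter than \<epsilon>/8 +
  \<epsilon>/2 + \<epsilon>/8 < \<epsilon>, so each cell between the chains divides into permitted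
  triangles.\<close>

lemma run_parallel:
  assumes "list_all2 (\<lambda>x' x. dist x' x < \<epsilon> / 8) xs' xs"
    and "c \<in> A" "a \<in> X" "dist (p c) a < \<epsilon> / 8" "set xs \<subseteq> X" "set xs' \<subseteq> X"
    and "successively (\<lambda>x y. dist x y \<le> \<epsilon> / 2) (a # xs)"
  shows "foldl act c xs' \<in> A" "p (foldl act c xs') = last (p c # xs')"
    "dist (last (p c # xs')) (last (a # xs)) < \<epsilon> / 8"
    "act (foldl act c xs') (last (a # xs)) = foldl act (act c a) xs"
proof -
  have "foldl act c xs' \<in> A \<and> p (foldl act c xs') = last (p c # xs') \<and>
    dist (last (p c # xs')) (last (a # xs)) < \<epsilon> / 8 \<and>
    act (foldl act c xs') (last (a # xs)) = foldl act (act c a) xs"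
    using assms
  proof (induction arbitrary: c a rule: list_all2_induct)
    case (Cons x' xs' x xs)
    have d: "dist (p c) a < \<epsilon> / 8" "dist x' x < \<epsilon> / 8" "dist a x \<le> \<epsilon> / 2" using Cons by auto
    have X: "x \<in> X" "x' \<in> X" "c \<in> A" "a \<in> X" using Cons.prems by auto
    have d1: "dist (p c) x < \<epsilon>" using dist_triangle[of "p c" x a] d eps_pos by linarith
    have d2: "dist (p c) x' < \<epsilon>"
      using dist_triangle[of "p c" x' x] dist_triangle[of "p c" x a] d dist_commute[of x' x] eps_pos
      by linarith
    have c': "act c x' \<in> A" "p (act c x') = x'" using act_in p_act X d2 by auto
    have "foldl act (act c x') xs' \<in> A \<and> p (foldl act (act c x') xs') = last (p (act c x') # xs') \<and>
      dist (last (p (act c x') # xs')) (last (x # xs)) < \<epsilon> / 8 \<and>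
      act (foldl act (act c x') xs') (last (x # xs)) = foldl act (act (act c x') x) xs"
      by (rule Cons.IH) (use Cons.prems X c' d in auto)
    moreover have "act (act c x') x = act (act c a) x"
      using X d d1 d2 eps_pos by (intro act_shift) auto
    ultimately show ?case using c' by simp
  qed (auto simp: act_self)
  then show "foldl act c xs' \<in> A" "p (foldl act c xs') = last (p c # xs')"
    "dist (last (p c # xs')) (last (a # xs)) < \<epsilon> / 8"
    "act (foldl act c xs') (last (a # xs)) = foldl act (act c a) xs" by auto
qed

text \<open>For closed chains the connecting jump at the end is the one at the start. Undoing it
  carries triviality over to the nearby chain.\<close>

lemma run_loop_parallel:
  assumes "list_all2 (\<lambda>x' x. dist x' x < \<epsilon> / 8) xs' xs"
    and "c \<in> A" "a \<in> X" "dist (p c) a < \<epsilon> / 8" "set xs \<subseteq> X" "set xs' \<subseteq> X"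
    and "successively (\<lambda>x y. dist x y \<le> \<epsilon> / 2) (a # xs)"
    and last: "last (a # xs) = a" "last (p c # xs') = p c"
    and triv: "foldl act (act c a) xs = act c a"
  shows "foldl act c xs' = c"
proof -
  note r = run_parallel[OF assms(1-7)]
  have "act (act (foldl act c xs') a) (p c) = foldl act c xs'"
    using act_back[of "foldl act c xs'" a] r last assms(3) eps_pos by auto
  moreover have "act (act c a) (p c) = c"
    using act_back[of c a] assms(2-4) eps_pos by auto
  ultimately show ?thesis using r(4) last triv by simp
qed


text \<open>Since \<delta> is at most 2\<epsilon>, both halves of a jump shorter than \<delta> are
  permitted jumps. The assumption \<open>triv\<close> is the triangle law of the new jumps, and
  \<open>act_self\<close> survives because the midpoint of \<open>x\<close> and \<open>x\<close> is
  \<open>x\<close>.\<close>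

lemma jump_space_midpoint:
  assumes \<delta>: "0 < \<delta>" "\<delta> \<le> 2 * \<epsilon>"
    and m: "\<And>x y. x \<in> X \<Longrightarrow> y \<in> X \<Longrightarrow> m x y \<in> X \<and> dist x (m x y) = dist x y / 2 \<and> dist (m x y) y = dist x y / 2"
    and triv: "\<And>c y z. \<lbrakk>c \<in> A; y \<in> X; z \<in> X; dist (p c) y < \<delta>; dist y z < \<delta>; dist (p c) z < \<delta>\<rbrakk>
      \<Longrightarrow> act (act (act (act c (m (p c) y)) y) (m y z)) z = act (act c (m (p c) z)) z"
  shows "jump_space X \<delta> A p (\<lambda>c y. act (act c (m (p c) y)) y)"
proof -
  have *: "act (act c (m (p c) y)) y \<in> A" "p (act (act c (m (p c) y)) y) = y"
    if "c \<in> A" "y \<in> X" "dist (p c) y < \<delta>" for c y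
  proof -
    have "m (p c) y \<in> X" "dist (p c) (m (p c) y) < \<epsilon>" "dist (m (p c) y) y < \<epsilon>"
      using m[of "p c" y] p_in that \<delta> by auto
    then show "act (act c (m (p c) y)) y \<in> A" "p (act (act c (m (p c) y)) y) = y"
      using that act_in p_act by auto
  qed
  show ?thesis
  proof
    fix c assume c: "c \<in> A"
    have "m (p c) (p c) = p c" using m[of "p c" "p c"] p_in[OF c] by simp
    then show "act (act c (m (p c) (p c))) (p c) = c" using act_self c by simp
    fix y z assume y: "y \<in> X" "z \<in> X" "dist (p c) y < \<delta>" "dist y z < \<delta>" "dist (p c) z < \<delta>"
    then show "act (act (act (act c (m (p c) y)) y) (m (p (act (act c (m (p c) y)) y)) z)) z =
        act (act c (m (p c) z)) z"
      using triv[OF c y] *(2)[OF c y(1,3)] by simp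
  qed (use \<delta> p_in * in auto)
qed

text \<open>Jumps made through midpoints form a jump space for \<open>\<delta>\<close>, on which \<open>\<delta>\<close>-null loops are trivial, and they
  agree with the given jumps where these are defined.\<close>

lemma run_null_of_midpoint:
  assumes \<delta>: "\<epsilon> \<le> \<delta>" "\<delta> \<le> 2 * \<epsilon>"
    and m: "\<And>x y. x \<in> X \<Longrightarrow> y \<in> X \<Longrightarrow> m x y \<in> X \<and> dist x (m x y) = dist x y / 2 \<and> dist (m x y) y = dist x y / 2"
    and triv: "\<And>c y z. \<lbrakk>c \<in> A; y \<in> X; z \<in> X; dist (p c) y < \<delta>; dist y z < \<delta>; dist (p c) z < \<delta>\<rbrakk>
      \<Longrightarrow> act (act (act (act c (m (p c) y)) y) (m y z)) z = act (act c (m (p c) z)) z"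
    and c: "c \<in> A" and ys: "eps_chain X \<epsilon> (p c # ys)" and null: "eps_null X (p c) \<delta> (p c # ys)"
  shows "foldl act c ys = c"
proof -
  define act' where "act' c y = act (act c (m (p c) y)) y" for c y
  have "0 < \<delta>" using \<delta>(1) eps_pos by simp
  then interpret M: jump_space X \<delta> A p act'
    using jump_space_midpoint[OF _ \<delta>(2) m triv] unfolding act'_def by blast
  have "foldl act' c (p c # ys) = foldl act' c [p c]"
    using null c by (intro M.run_eps_homotopic) (auto simp: eps_null_def)
  then have "foldl act' c ys = c" using M.act_self[OF c] by simp
  moreover have "foldl act' c ys = foldl act c ys"
    if "c \<in> A" "set ys \<subseteq> X" "successively (\<lambda>x y. dist x y < \<epsilon>) (p c # ys)" for c ys
    using that
  proof (induction ys arbitrary: c)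
    case (Cons y ys)
    have d: "dist (p c) y < \<epsilon>" "y \<in> X" using Cons.prems by auto
    have "m (p c) y \<in> X" "dist (p c) (m (p c) y) < \<epsilon>" "dist (m (p c) y) y < \<epsilon>"
      using m[of "p c" y] p_in[OF Cons.prems(1)] d eps_pos by auto
    then have "act' c y = act c y" unfolding act'_def using d Cons.prems by (intro act_act) auto
    moreover have "foldl act' (act c y) ys = foldl act (act c y) ys"
      using Cons.prems act_in p_act d by (intro Cons.IH) auto
    ultimately show ?case by simp
  qed simp
  ultimately show ?thesis using c ys by (auto simp: eps_chain_def)
qed


lemma run_hexagon:
  assumes c: "c \<in> A" and \<eta>: "\<eta> < \<epsilon>"
    and X: "u \<in> X" "y \<in> X" "v \<in> X" "z \<in> X" "w \<in> X"
    and suc: "successively (\<lambda>x y. dist x y \<le> \<eta> / 2) [p c, u, y, v, z, w, p c]"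
  shows "foldl act c [u, y, v, z, w, p c] = c"
proof -
  have d: "dist (p c) u \<le> \<eta> / 2" "dist u y \<le> \<eta> / 2" "dist y v \<le> \<eta> / 2" "dist v z \<le> \<eta> / 2"
    "dist z w \<le> \<eta> / 2" "dist w (p c) \<le> \<eta> / 2"
    using suc by auto
  then have d': "dist (p c) u < \<epsilon>" "dist u y < \<epsilon>" "dist y v < \<epsilon>" "dist v z < \<epsilon>"
    "dist z w < \<epsilon>" "dist w (p c) < \<epsilon>"
    using \<eta> zero_le_dist[of "p c" u] eps_pos by linarith+
  have e: "dist (p c) y < \<epsilon>" "dist y z < \<epsilon>" "dist z (p c) < \<epsilon>"
    using dist_triangle[of "p c" y u] dist_triangle[of y z v] dist_triangle[of z "p c" w] d \<eta>
    by linarith+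
  have cy: "act c y \<in> A" "p (act c y) = y" and cz: "act c z \<in> A" "p (act c z) = z"
    using act_in p_act c X e by (auto simp: dist_commute)
  have "act (act c u) y = act c y" using c X d' e by (intro act_act) auto
  moreover have "act (act (act c y) v) z = act (act c y) z" using cy X d' e by (intro act_act) auto
  moreover have "act (act c y) z = act c z" using c X e by (intro act_act) (auto simp: dist_commute)
  moreover have "act (act (act c z) w) (p c) = act (act c z) (p c)"
    using cz X d' e p_in[OF c] by (intro act_act) auto
  moreover have "act (act c z) (p c) = c" using c X e by (intro act_back) (auto simp: dist_commute)
  ultimately show ?thesis by simp
qed

text \<open>This moves a loop at a distant point to the base point: the tail \<open>ts\<close> leads
  there, and \<open>rev (p e # ts)\<close> leads back after repeating the point it starts
  from.\<close>

lemma run_conjugate: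
  assumes e: "e \<in> A" and ts: "set ts \<subseteq> X" "successively (\<lambda>x y. dist x y < \<epsilon>) (p e # ts)"
    and hs: "set hs \<subseteq> X" "successively (\<lambda>x y. dist x y < \<epsilon>) (last (p e # ts) # hs)"
    and last: "last (last (p e # ts) # hs) = last (p e # ts)"
  shows "foldl act e (ts @ hs @ rev (p e # ts)) = e \<longleftrightarrow>
    foldl act (foldl act e ts) hs = foldl act e ts"
proof
  note c = run_chain[OF e ts]
  let ?c = "foldl act e ts" let ?d = "foldl act ?c hs"
  show "foldl act e (ts @ hs @ rev (p e # ts)) = e" if "?d = ?c"
    using that run_back[OF e ts] by simp
  assume eq: "foldl act e (ts @ hs @ rev (p e # ts)) = e"
  have d: "?d \<in> A" "p ?d = last (p e # ts)"
    using run_chain[OF c(1) hs(1)] hs(2) last c(2) by auto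
  have sym: "(\<lambda>x y. dist y x < \<epsilon>) = (\<lambda>x y. dist x y < \<epsilon>)" by (simp add: dist_commute)
  have suc: "successively (\<lambda>x y. dist x y < \<epsilon>) (rev (p e # ts))"
    using ts(2) by (simp only: successively_rev sym)
  have ne: "rev (p e # ts) = last (p e # ts) # tl (rev (p e # ts))"
    by (metis hd_Cons_tl hd_rev list.distinct(1) rev_is_Nil_conv)
  have suc': "successively (\<lambda>x y. dist x y < \<epsilon>) (p ?d # rev (p e # ts))"
    using suc d(2) ne eps_pos by (metis dist_self successively.simps(3))
  have X: "set (rev (p e # ts)) \<subseteq> X" using ts(1) p_in[OF e] by simp
  have "foldl act ?d (rev (p e # ts)) = e" using eq by simp
  \<comment> \<open>The way back, undone from \<open>e\<close>, is \<open>p e\<close> and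
    \<open>ts\<close> once more, followed by a repetition of the last point. It leads to
    \<open>?d\<close> by \<open>run_back\<close> and to \<open>?c\<close> by definition.\<close>
  then have "foldl act e (rev (p ?d # rev (p e # ts))) = ?d"
    using run_back[OF d(1) X suc'] by metis
  then have "act (act e (p e)) (p e) = act e (p e) \<Longrightarrow> act ?c (last (p e # ts)) = ?d"
    using d(2) act_self[OF e] by simp
  then have "act ?c (last (p e # ts)) = ?d" using act_self[OF e] by simp
  then show "?d = ?c" using act_self[OF c(1)] c(2) by simp
qed

end

section \<open>The critical loop as a limit of triangles, and the comparison of the spectra\<close>

context pointed_geodesic_space
begin

lemma homotopy_critical_of_null_loops:
  assumes comp: "compact X" and \<epsilon>: "\<epsilon> > 0"
    and ex: "\<And>\<delta>. \<delta> > \<epsilon> \<Longrightarrow> \<exists>ys. eps_chain X \<epsilon> (b # ys) \<and> last (b # ys) = b \<and>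
      \<not> eps_null X b \<epsilon> (b # ys) \<and> eps_null X b \<delta> (b # ys)"
  shows "\<epsilon> \<in> homotopy_critical_spectrum X b"
proof -
  let ?A = "chain_classes X b \<epsilon>" and ?act = "chain_extend X \<epsilon>" and ?e = "chain_class X \<epsilon> [b]"
  interpret jump_space X \<epsilon> ?A chain_end ?act by (rule jump_space_chain[OF \<epsilon>])
  note e = base_class[OF b_in, of \<epsilon>]
  have "\<exists>m. m \<in> X \<and> dist x m = dist x y / 2 \<and> dist m y = dist x y / 2" if "x \<in> X" "y \<in> X" for x y
    using geodesic_point[OF geo that, of "dist x y / 2"] by fastforce
  then obtain m where m: "\<And>x y. x \<in> X \<Longrightarrow> y \<in> X \<Longrightarrow>
      m x y \<in> X \<and> dist x (m x y) = dist x y / 2 \<and> dist (m x y) y = dist x y / 2"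
    by metis
  \<comment> \<open>Any sequence decreasing to \<epsilon> would do that stays within 2\<epsilon>,
    the range in which jumps through midpoints are defined.\<close>
  define \<delta> where "\<delta> n = \<epsilon> + \<epsilon> / real (Suc n)" for n
  have \<delta>: "\<delta> n > \<epsilon>" "\<delta> n \<le> 2 * \<epsilon>" for n
    using \<epsilon> by (auto simp: \<delta>_def field_simps)
  have "\<delta> \<longlonglongrightarrow> \<epsilon> + 0"
    unfolding \<delta>_def using LIMSEQ_Suc[OF lim_const_over_n[of \<epsilon>]] by (intro tendsto_add tendsto_const) simp
  then have lim_\<delta>: "\<delta> \<longlonglongrightarrow> \<epsilon>" by simp
  have "\<exists>c y z. c \<in> ?A \<and> y \<in> X \<and> z \<in> X \<and> dist (chain_end c) y < \<delta> n \<and> dist y z < \<delta> n \<and>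
      dist (chain_end c) z < \<delta> n \<and>
      ?act (?act (?act (?act c (m (chain_end c) y)) y) (m y z)) z \<noteq> ?act (?act c (m (chain_end c) z)) z"
    for n
  proof (rule ccontr)
    assume no: "\<not> ?thesis"
    obtain ys where ys: "eps_chain X \<epsilon> (b # ys)" "\<not> eps_null X b \<epsilon> (b # ys)" "eps_null X b (\<delta> n) (b # ys)"
      using ex[OF \<delta>(1)] by blast
    have "foldl ?act ?e ys = ?e"
      by (rule run_null_of_midpoint[OF less_imp_le[OF \<delta>(1)[of n]] \<delta>(2)[of n] m])
        (use no ys e in auto)
    then show False using eps_null_iff_run[OF ys(1)] ys(2) by simp
  qed
  then obtain c y z where cyz: "\<And>n. c n \<in> ?A" "\<And>n. y n \<in> X" "\<And>n. z n \<in> X"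
    "\<And>n. dist (chain_end (c n)) (y n) < \<delta> n" "\<And>n. dist (y n) (z n) < \<delta> n"
    "\<And>n. dist (chain_end (c n)) (z n) < \<delta> n"
    "\<And>n. ?act (?act (?act (?act (c n) (m (chain_end (c n)) (y n))) (y n)) (m (y n) (z n))) (z n) \<noteq>
       ?act (?act (c n) (m (chain_end (c n)) (z n))) (z n)"
    by metis
  define x where "x n = chain_end (c n)" for n
  define u v w where "u n = m (x n) (y n)" and "v n = m (y n) (z n)" and "w n = m (x n) (z n)" for n
  have xX: "x n \<in> X" for n using p_in cyz(1) by (simp add: x_def)
  have X: "u n \<in> X" "v n \<in> X" "w n \<in> X" for n
    using m xX cyz(2,3) by (auto simp: u_def v_def w_def)
  have d: "dist (x n) (u n) \<le> \<delta> n / 2" "dist (u n) (y n) \<le> \<delta> n / 2" "dist (y n) (v n) \<le> \<delta> n / 2"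
    "dist (v n) (z n) \<le> \<delta> n / 2" "dist (z n) (w n) \<le> \<delta> n / 2" "dist (w n) (x n) \<le> \<delta> n / 2" for n
    using m[OF xX[of n] cyz(2)[of n]] m[OF cyz(2)[of n] cyz(3)[of n]] m[OF xX[of n] cyz(3)[of n]]
      cyz(4-6)[of n]
    by (auto simp: u_def v_def w_def x_def dist_commute)
  \<comment> \<open>A tuple, so that compactness gives one subsequence for all vertices. Only these
    points of \<open>X\<close> are passed to the limit; the classes \<open>c n\<close> over them are
    not.\<close>
  define F where "F n = (x n, u n, y n, v n, z n, w n)" for n
  have "compact (X \<times> X \<times> X \<times> X \<times> X \<times> X)" using comp by (intro compact_Times)
  moreover have "F n \<in> X \<times> X \<times> X \<times> X \<times> X \<times> X" for n using xX X cyz(2,3) by (simp add: F_def)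
  ultimately obtain l r where l: "l \<in> X \<times> X \<times> X \<times> X \<times> X \<times> X" and r: "strict_mono (r :: nat \<Rightarrow> nat)"
    and lim: "(F \<circ> r) \<longlonglongrightarrow> l"
    unfolding compact_def by metis
  obtain x0 u0 y0 v0 z0 w0 where l_eq: "l = (x0, u0, y0, v0, z0, w0)" by (metis prod_cases6)
  have X0: "x0 \<in> X" "u0 \<in> X" "y0 \<in> X" "v0 \<in> X" "z0 \<in> X" "w0 \<in> X" using l l_eq by auto
  have lims: "(\<lambda>n. x (r n)) \<longlonglongrightarrow> x0" "(\<lambda>n. u (r n)) \<longlonglongrightarrow> u0" "(\<lambda>n. y (r n)) \<longlonglongrightarrow> y0"
    "(\<lambda>n. v (r n)) \<longlonglongrightarrow> v0" "(\<lambda>n. z (r n)) \<longlonglongrightarrow> z0" "(\<lambda>n. w (r n)) \<longlonglongrightarrow> w0"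
    using tendsto_fst[OF lim] tendsto_snd[OF lim, THEN tendsto_fst]
      tendsto_snd[OF lim, THEN tendsto_snd, THEN tendsto_fst]
      tendsto_snd[OF lim, THEN tendsto_snd, THEN tendsto_snd, THEN tendsto_fst]
      tendsto_snd[OF lim, THEN tendsto_snd, THEN tendsto_snd, THEN tendsto_snd, THEN tendsto_fst]
      tendsto_snd[OF lim, THEN tendsto_snd, THEN tendsto_snd, THEN tendsto_snd, THEN tendsto_snd]
    unfolding l_eq F_def comp_def by simp_all
  have lim_\<delta>r: "(\<lambda>n. \<delta> (r n) / 2) \<longlonglongrightarrow> \<epsilon> / 2"
    using LIMSEQ_subseq_LIMSEQ[OF lim_\<delta> r] by (intro tendsto_divide tendsto_const) (auto simp: comp_def)
  have bound: "dist a0 a1 \<le> \<epsilon> / 2"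
    if "a \<longlonglongrightarrow> a0" "a' \<longlonglongrightarrow> a1" "\<And>n. dist (a n) (a' n) \<le> \<delta> (r n) / 2" for a a' a0 a1
    by (rule LIMSEQ_le[OF tendsto_dist[OF that(1,2)] lim_\<delta>r]) (use that(3) in auto)
  have suc: "successively (\<lambda>x y. dist x y \<le> \<epsilon> / 2) [x0, u0, y0, v0, z0, w0, x0]"
    using bound[OF lims(1,2) d(1)] bound[OF lims(2,3) d(2)] bound[OF lims(3,4) d(3)]
      bound[OF lims(4,5) d(4)] bound[OF lims(5,6) d(5)] bound[OF lims(6,1) d(6)] by simp
  let ?hex = "[u0, y0, v0, z0, w0, x0]"
  have "\<epsilon> / 8 > 0" using \<epsilon> by simp
  then have "\<forall>\<^sub>F n in sequentially. dist (x (r n)) x0 < \<epsilon> / 8 \<and> dist (u (r n)) u0 < \<epsilon> / 8 \<and>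
     dist (y (r n)) y0 < \<epsilon> / 8 \<and> dist (v (r n)) v0 < \<epsilon> / 8 \<and> dist (z (r n)) z0 < \<epsilon> / 8 \<and>
     dist (w (r n)) w0 < \<epsilon> / 8"
    by (intro eventually_conj) (rule lims[THEN tendstoD], assumption)+
  then obtain N where N: "dist (x (r N)) x0 < \<epsilon> / 8" "dist (u (r N)) u0 < \<epsilon> / 8"
     "dist (y (r N)) y0 < \<epsilon> / 8" "dist (v (r N)) v0 < \<epsilon> / 8" "dist (z (r N)) z0 < \<epsilon> / 8"
     "dist (w (r N)) w0 < \<epsilon> / 8"
    unfolding eventually_sequentially by blast
  define k where "k = r N"
  note N = N[folded k_def]
  have dk: "dist (x k) x0 < \<epsilon>" using N(1) \<epsilon> by simp

  \<comment> \<open>The bounds in \<open>d\<close> give only at most \<epsilon> here. Strictness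
    comes from the side itself, which is less than \<delta> at \<open>k\<close> and thus less than
    2\<epsilon>; it allows the jumps through \<open>w k\<close> to be undone.\<close>
  have strict: "dist (x k) (w k) < \<epsilon>" "dist (w k) (z k) < \<epsilon>"
    using m[OF xX[of k] cyz(3)[of k]] cyz(6)[of k] \<delta>(2)[of k] by (auto simp: w_def x_def)
  define c0 where "c0 = ?act (c k) x0"
  have c0: "c0 \<in> ?A" "chain_end c0 = x0"
    using act_in p_act cyz(1) X0 dk by (auto simp: c0_def x_def)
  \<comment> \<open>If the limiting hexagon acted trivially at \<open>c0\<close>, so would the
    hexagon of index \<open>k\<close> at \<open>c k\<close>. Undoing its last two jumps, from
    \<open>z k\<close> via \<open>w k\<close> to \<open>x k\<close>, would identify the two ways to
    \<open>z k\<close>, contrary to the choice of the triangle.\<close>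
  have nontriv: "foldl ?act c0 ?hex \<noteq> c0"
  proof
    assume triv: "foldl ?act c0 ?hex = c0"
    let ?hex' = "[u k, y k, v k, z k, w k, x k]"
    have la: "list_all2 (\<lambda>x' x. dist x' x < \<epsilon> / 8) ?hex' ?hex" using N by simp
    have sub: "set ?hex \<subseteq> X" "set ?hex' \<subseteq> X" using X0 X xX cyz(2,3) by auto
    have ce: "chain_end (c k) = x k" by (simp add: x_def)
    have loop: "foldl ?act (c k) ?hex' = c k"
      by (rule run_loop_parallel[OF la cyz(1) X0(1) _ sub suc]) (use N ce triv in \<open>auto simp: c0_def\<close>)
    let ?d = "foldl ?act (c k) [u k, y k, v k, z k]"
    have la4: "list_all2 (\<lambda>x' x. dist x' x < \<epsilon> / 8) [u k, y k, v k, z k] [u0, y0, v0, z0]" using N by simp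
    have dd: "?d \<in> ?A" "chain_end ?d = z k"
      using run_parallel(1,2)[OF la4 cyz(1) X0(1), of k] N ce sub suc by auto
    have dw: "?act ?d (w k) \<in> ?A" "chain_end (?act ?d (w k)) = w k"
      using act_in p_act dd X strict by (auto simp: dist_commute)
    have "?act (c k) (w k) = ?act (?act (?act ?d (w k)) (x k)) (w k)" using loop by simp
    also have "\<dots> = ?act ?d (w k)"
      using act_back[OF dw(1) xX, of k] dw(2) strict by (simp add: dist_commute)
    finally have "?act (?act (c k) (w k)) (z k) = ?act (?act ?d (w k)) (z k)" by simp
    also have "\<dots> = ?d"
      using act_back[OF dd(1) X(3), of k] dd(2) strict by (simp add: dist_commute)
    finally show False using cyz(7)[of k] by (simp add: u_def v_def w_def x_def)
  qed
  obtain xs where xs: "eps_chain X \<epsilon> xs" "hd xs = b" "c0 = chain_class X \<epsilon> xs"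
    using c0(1) by (auto simp: chain_classes_def)
  then obtain ts where ts: "xs = b # ts" by (cases xs) (auto simp: eps_chain_def)
  have last_ts: "last (b # ts) = x0" using c0(2) xs ts chain_end_class(1) by metis
  have hexX: "set ?hex \<subseteq> X" using X0 by simp
  \<comment> \<open>The class \<open>c0\<close> contains a chain from \<open>b\<close> to
    \<open>x0\<close>, and this chain is the tail that ties the hexagon to the base point.\<close>
  let ?ys = "ts @ ?hex @ rev (b # ts)"
  have chain: "eps_chain X \<epsilon> (b # ?ys)"
  proof -
    have "successively (\<lambda>x y. dist x y < \<epsilon>) (b # ts)" "set (b # ts) \<subseteq> X"
      using xs(1) ts by (auto simp: eps_chain_def)
    moreover from this(1) have "successively (\<lambda>x y. dist x y < \<epsilon>) (rev (b # ts))"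
      by (simp only: successively_rev dist_commute)
    moreover have "successively (\<lambda>x y. dist x y < \<epsilon>) ?hex" "dist x0 u0 < \<epsilon>"
      using suc \<epsilon> by auto
    moreover have "hd (rev (b # ts)) = x0" using last_ts by (simp only: hd_rev)
    ultimately have "successively (\<lambda>x y. dist x y < \<epsilon>) ((b # ts) @ ?hex @ rev (b # ts))"
      using last_ts \<epsilon> unfolding successively_append_iff by simp
    then show ?thesis
      using \<open>set (b # ts) \<subseteq> X\<close> hexX by (auto simp: eps_chain_def)
  qed
  \<comment> \<open>The same list is tested at every scale from \<epsilon> on, each time in the
    chain classes of that scale. Tail and hexagon are chains for all of them.\<close>
  have conj: "eps_null X b \<delta>' (b # ?ys) \<longleftrightarrow>
      foldl (chain_extend X \<delta>') (chain_class X \<delta>' (b # ts)) ?hex = chain_class X \<delta>' (b # ts)"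
    if "\<delta>' \<ge> \<epsilon>" for \<delta>'
  proof -
    have pos: "\<delta>' > 0" using that \<epsilon> by simp
    interpret D: jump_space X \<delta>' "chain_classes X b \<delta>'" chain_end "chain_extend X \<delta>'"
      by (rule jump_space_chain[OF pos])
    note e' = base_class[OF b_in, of \<delta>']
    have ch: "eps_chain X \<delta>' (b # ts)" using xs(1) ts that eps_chain_mono by blast
    have "\<epsilon> / 2 < \<delta>'" using \<epsilon> that by simp
    then have hexs: "successively (\<lambda>x y. dist x y < \<delta>') (x0 # ?hex)"
      using suc by (elim successively_mono) simp_all
    have ts': "set ts \<subseteq> X" "successively (\<lambda>x y. dist x y < \<delta>') (chain_end (chain_class X \<delta>' [b]) # ts)"
      using ch unfolding e'(2) eps_chain_def by auto
    have "foldl (chain_extend X \<delta>') (chain_class X \<delta>' [b]) ?ys = chain_class X \<delta>' [b] \<longleftrightarrow>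
       foldl (chain_extend X \<delta>') (foldl (chain_extend X \<delta>') (chain_class X \<delta>' [b]) ts) ?hex =
       foldl (chain_extend X \<delta>') (chain_class X \<delta>' [b]) ts"
      by (rule D.run_conjugate[OF e'(1) ts' hexX, unfolded e'(2) last_ts, OF hexs]) simp
    then show ?thesis
      unfolding eps_null_iff_run[OF eps_chain_mono[OF chain that]] run_chain_class[OF ch] .
  qed
  have "eps_null X b \<delta>' (b # ?ys)" if "\<delta>' > \<epsilon>" for \<delta>'
  proof -
    have pos: "\<delta>' > 0" using that \<epsilon> by simp
    interpret D: jump_space X \<delta>' "chain_classes X b \<delta>'" chain_end "chain_extend X \<delta>'"
      by (rule jump_space_chain[OF pos])
    have ch: "eps_chain X \<delta>' (b # ts)" using xs(1) ts that eps_chain_mono by fastforce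
    then have "chain_class X \<delta>' (b # ts) \<in> chain_classes X b \<delta>'" by (auto simp: chain_classes_def)
    moreover have "chain_end (chain_class X \<delta>' (b # ts)) = x0"
      using chain_end_class(1)[OF ch] last_ts by simp
    ultimately show ?thesis
      using D.run_hexagon[OF _ that, of "chain_class X \<delta>' (b # ts)" u0 y0 v0 z0 w0] X0 suc
        conj[of \<delta>'] that by simp
  qed
  moreover have "\<not> eps_null X b \<epsilon> (b # ?ys)"
    using conj[of \<epsilon>] nontriv xs(3) ts by simp
  moreover have "eps_loop X b \<epsilon> (b # ?ys)" using chain by (simp add: eps_loop_def)
  ultimately show ?thesis unfolding homotopy_critical_spectrum_def using \<epsilon> by blast
qed

text \<open>A critical loop, filled in by geodesics, lies in \<open>S\<^sub>\<delta>\<close> for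
  every \<delta> > 3\<epsilon>/2 but not for 3\<epsilon>/2. Conversely, since the groups increase,
  distinct groups differ by a class in the larger one, and an \<epsilon>-chain approximating a loop
  in it is null at the larger scale only.\<close>

theorem homotopy_critical_iff_covering:
  assumes comp: "compact X" and \<epsilon>: "\<epsilon> > 0"
  shows "\<epsilon> \<in> homotopy_critical_spectrum X b \<longleftrightarrow> 3 * \<epsilon> / 2 \<in> covering_spectrum X b"
proof
  assume "\<epsilon> \<in> homotopy_critical_spectrum X b"
  then obtain xs where xs: "eps_loop X b \<epsilon> xs" "\<not> eps_null X b \<epsilon> xs" "\<And>\<delta>. \<delta> > \<epsilon> \<Longrightarrow> eps_null X b \<delta> xs"
    by (auto simp: homotopy_critical_spectrum_def)
  then obtain ys where ys: "xs = b # ys" "eps_chain X \<epsilon> (b # ys)" "last (b # ys) = b"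
    by (cases xs) (auto simp: eps_loop_def eps_chain_def)
  have "delta_subgroup X b (3 * \<epsilon> / 2) \<noteq> delta_subgroup X b \<delta>'" if "\<delta>' > 3 * \<epsilon> / 2" for \<delta>'
  proof -
    have *: "2 * \<delta>' / 3 > \<epsilon>" "3 * (2 * \<delta>' / 3) / 2 = \<delta>'" using that by auto
    have "eps_chain X (2 * \<delta>' / 3) (b # ys)" using ys(2) * eps_chain_mono by fastforce
    then have "path_class X (realize X b ys) \<in> delta_subgroup X b \<delta>'"
      using realize_in_delta_subgroup_iff[of "2 * \<delta>' / 3" ys] ys xs(3)[OF *(1)] * \<epsilon> by simp
    moreover have "path_class X (realize X b ys) \<notin> delta_subgroup X b (3 * \<epsilon> / 2)"
      using realize_in_delta_subgroup_iff[OF \<epsilon> ys(2,3)] xs(2) ys(1) by simp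
    ultimately show ?thesis by blast
  qed
  then show "3 * \<epsilon> / 2 \<in> covering_spectrum X b" using \<epsilon> by (simp add: covering_spectrum_iff)
next
  assume cov: "3 * \<epsilon> / 2 \<in> covering_spectrum X b"
  show "\<epsilon> \<in> homotopy_critical_spectrum X b"
  proof (rule homotopy_critical_of_null_loops[OF comp \<epsilon>])
    fix \<delta> assume \<delta>: "\<delta> > \<epsilon>"
    then have "delta_subgroup X b (3 * \<epsilon> / 2) \<noteq> delta_subgroup X b (3 * \<delta> / 2)"
      using cov by (simp add: covering_spectrum_iff)
    then obtain P where P: "P \<in> delta_subgroup X b (3 * \<delta> / 2)" "P \<notin> delta_subgroup X b (3 * \<epsilon> / 2)"
      using delta_subgroup_mono[OF b_in, of "3 * \<epsilon> / 2" "3 * \<delta> / 2"] \<delta> by auto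
    have "P \<in> carrier (fundamental_group X b)"
      using P(1) group.generate_in_carrier[OF group_fundamental_group[OF b_in] lassos_subset]
      by (auto simp: delta_subgroup_eq)
    then obtain g where g: "g \<in> loops_at X b" "P = path_class X g" by (auto simp: fundamental_group_def)
    obtain ys where ys: "eps_chain X \<epsilon> (b # ys)" "last (b # ys) = b"
      and S: "\<And>\<delta>. \<delta> \<ge> 3 * \<epsilon> / 2 \<Longrightarrow> path_class X (realize X b ys) \<in> delta_subgroup X b \<delta> \<longleftrightarrow>
        path_class X g \<in> delta_subgroup X b \<delta>"
      using loop_approximation[OF \<epsilon> g(1)] by metis
    have "\<not> eps_null X b \<epsilon> (b # ys)"
      using realize_in_delta_subgroup_iff[OF \<epsilon> ys] S[of "3 * \<epsilon> / 2"] P g by simp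
    moreover have "eps_null X b \<delta> (b # ys)"
      using realize_in_delta_subgroup_iff[of \<delta> ys] eps_chain_mono[OF ys(1), of \<delta>] ys(2)
        S[of "3 * \<delta> / 2"] P(1) g(2) \<delta> \<epsilon> by simp
    ultimately show "\<exists>ys. eps_chain X \<epsilon> (b # ys) \<and> last (b # ys) = b \<and>
      \<not> eps_null X b \<epsilon> (b # ys) \<and> eps_null X b \<delta> (b # ys)" using ys by blast
  qed
qed

end

theorem mainTheorem2:
  fixes X :: "'a::metric_space set" and b :: 'a
  assumes "compact X" and "geodesic_space X" and "b \<in> X"
  shows "homotopy_critical_spectrum X b = (\<lambda>\<delta>. 2 / 3 * \<delta>) ` covering_spectrum X b \<and>
    (\<forall>\<epsilon>>0. \<epsilon> \<in> homotopy_critical_spectrum X b \<longleftrightarrow> 3 * \<epsilon> / 2 \<in> covering_spectrum X b)"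
proof -
  interpret pointed_geodesic_space X b by standard (fact assms)+
  have iff: "\<epsilon> \<in> homotopy_critical_spectrum X b \<longleftrightarrow> 3 * \<epsilon> / 2 \<in> covering_spectrum X b" if "\<epsilon> > 0" for \<epsilon>
    using homotopy_critical_iff_covering[OF assms(1) that] .
  have pos: "\<epsilon> \<in> homotopy_critical_spectrum X b \<Longrightarrow> \<epsilon> > 0" "\<epsilon> \<in> covering_spectrum X b \<Longrightarrow> \<epsilon> > 0" for \<epsilon>
    by (auto simp: homotopy_critical_spectrum_def covering_spectrum_def)
  have "homotopy_critical_spectrum X b = (\<lambda>\<delta>. 2 / 3 * \<delta>) ` covering_spectrum X b"
  proof (intro equalityI subsetI)
    fix \<epsilon> assume "\<epsilon> \<in> homotopy_critical_spectrum X b"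
    then have "3 * \<epsilon> / 2 \<in> covering_spectrum X b" using iff pos by blast
    then show "\<epsilon> \<in> (\<lambda>\<delta>. 2 / 3 * \<delta>) ` covering_spectrum X b" by (rule rev_image_eqI) simp
  next
    fix \<epsilon> assume "\<epsilon> \<in> (\<lambda>\<delta>. 2 / 3 * \<delta>) ` covering_spectrum X b"
    then obtain \<delta> where "\<delta> \<in> covering_spectrum X b" "\<epsilon> = 2 / 3 * \<delta>" by blast
    moreover have "3 * \<epsilon> / 2 = \<delta>" using \<open>\<epsilon> = _\<close> by simp
    ultimately show "\<epsilon> \<in> homotopy_critical_spectrum X b"
      using iff[of \<epsilon>] pos(2)[of \<delta>] by (simp only:) simp
  qed
  then show ?thesis using iff by blast
qed

end
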